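(* Let $M\geq2$ and let $\mathsf{A}=(A_1,\ldots,A_M)\in M_{d_1}(\mathbb{R})^M$ and $\mathsf{B}=(B_1,\ldots,B_M)\in M_{d_2}(\mathbb{R})^M$ be irreducible, where $d_1,d_2\geq1$. Let $s,t>0$, and suppose that $P(\mathsf{A},s),P(\mathsf{B},t)>-\infty$. Then the following are equivalent: (i) The equilibrium states of $(\mathsf{A},s)$ and $(\mathsf{B},t)$ are identical. (ii) There is a constant $C>0$ such that \[C^{-1}e^{-nP(\mathsf{A},s)}\|A_{i_n}\cdots A_{i_1}\|^s\leq e^{-nP(\mathsf{B},t)}\|B_{i_n}\cdots B_{i_1}\|^t\leq Ce^{-nP(\mathsf{A},s)}\|A_{i_n}\cdots A_{i_1}\|^s\] for every $n\geq1$ and every $(i_1,\ldots,i_n)\in\{1,\ldots,M\}^n$. (iii) We have \[e^{-nP(\mathsf{A},s)}\rho(A_{i_n}\cdots A_{i_1})^s=e^{-nP(\mathsf{B},t)}\rho(B_{i_n}\cdots B_{i_1})^t\] for every $n\geq1$ and every $(i_1,\ldots,i_n)\in\{1,\ldots,M\}^n$. (iv) There is a constant $\lambda\in\mathbb{R}$ such that $s\Lambda(\mathsf{A},\nu)=\lambda+t\Lambda(\mathsf{B},\nu)$ for every $\nu\in\mathcal{M}_\sigma$.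
   Context: $\Sigma_M:=\{1,\ldots,M\}^{\mathbb{N}}$ with the product topology; $\sigma$ is the shift $\sigma[(x_n)_{n=1}^\infty]=(x_{n+1})_{n=1}^\infty$; $\mathcal{M}_\sigma$ is the set of $\sigma$-invariant Borel probability measures on $\Sigma_M$; $h(\nu)$ is the metric entropy of $\nu\in\mathcal{M}_\sigma$. $M_d(\mathbb{R})$ is the set of real $d\times d$ matrices, $\|\cdot\|$ is the operator norm induced by the Euclidean norm, and $\rho$ denotes spectral radius. For $\mathsf{A}=(A_1,\ldots,A_M)\in M_d(\mathbb{R})^M$, $s>0$ and $\nu\in\mathcal{M}_\sigma$: the top Lyapunov exponent is $\Lambda(\mathsf{A},\nu):=\lim_{n\to\infty}\frac1n\int_{\Sigma_M}\log\|A_{x_n}\cdots A_{x_1}\|\,d\nu(x)\in[-\infty,\infty)$ (with $\log0=-\infty$, and in identities involving $-\infty$ the usual conventions $\lambda+t(-\infty)=-\infty$ apply); the pressure is $P(\mathsf{A},s):=\lim_{n\to\infty}\frac1n\log\left(\sum_{i_1,\ldots,i_n=1}^M\|A_{i_n}\cdots A_{i_1}\|^s\right)\in[-\infty,\infty)$; it is known that $P(\mathsf{A},s)=\sup_{\nu\in\mathcal{M}_\sigma}\bigl(h(\nu)+s\Lambda(\mathsf{A},\nu)\bigr)$, and an equilibrium state of $(\mathsf{A},s)$ is a measure attaining this supremum. $\mathsf{A}$ is irreducible if there is no linear subspace $U\subset\mathbb{R}^d$ with $0<\dim U<d$ and $A_iU\subseteq U$ for all $i$. If $\mathsf{A}$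 is irreducible and $P(\mathsf{A},s)>-\infty$, the equilibrium state of $(\mathsf{A},s)$ exists and is unique (Feng–Käenmäki for $d\geq2$; classical for $d=1$). *)

theory Defs
  imports "HOL-Probability.Probability"
begin

section \<open>Full shift and invariant measures\<close>

text \<open>Sequences are indexed from 0, so $x_n$ with $n \geq 1$ is the entry at index $n-1$.\<close>

definition full_shift :: "nat \<Rightarrow> (nat \<Rightarrow> nat) topology" where
  "full_shift M = product_topology (\<lambda>_. discrete_topology {1..M}) UNIV"

definition full_shift_borel :: "nat \<Rightarrow> (nat \<Rightarrow> nat) measure" where
  "full_shift_borel M = sigma (topspace (full_shift M)) {U. openin (full_shift M) U}"

definition shift :: "(nat \<Rightarrow> 'a) \<Rightarrow> nat \<Rightarrow> 'a" where
  "shift x = (\<lambda>n. x (Suc n))"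

definition invariant_measures :: "nat \<Rightarrow> (nat \<Rightarrow> nat) measure set" where
  "invariant_measures M =
     {\<nu>. sets \<nu> = sets (full_shift_borel M) \<and> prob_space \<nu> \<and> distr \<nu> \<nu> shift = \<nu>}"

section \<open>Metric (Kolmogorov--Sinai) entropy\<close>

definition finite_measurable_partition :: "'a measure \<Rightarrow> 'a set set \<Rightarrow> bool" where
  "finite_measurable_partition \<mu> \<xi> \<longleftrightarrow> finite \<xi> \<and> \<xi> \<subseteq> sets \<mu> \<and> partition_on (space \<mu>) \<xi>"

text \<open>The library's \<open>0 * ln 0 = 0\<close> is the usual convention.\<close>

definition partition_entropy :: "'a measure \<Rightarrow> 'a set set \<Rightarrow> real" where
  "partition_entropy \<mu> \<xi> = - (\<Sum>C\<in>\<xi>. measure \<mu> C * ln (measure \<mu> C))"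

text \<open>
  The join of the preimages of \<open>\<xi>\<close> under \<open>T ^^ 0, \<dots>, T ^^ (n - 1)\<close>. The empty set may
  occur as a member; it does not contribute to the entropy.
\<close>

definition dynamical_join :: "'a measure \<Rightarrow> ('a \<Rightarrow> 'a) \<Rightarrow> 'a set set \<Rightarrow> nat \<Rightarrow> 'a set set" where
  "dynamical_join \<mu> T \<xi> n =
     (\<lambda>c. {x \<in> space \<mu>. \<forall>k<n. (T ^^ k) x \<in> c k}) ` (PiE {..<n} (\<lambda>_. \<xi>))"

definition entropy_wrt_partition :: "'a measure \<Rightarrow> ('a \<Rightarrow> 'a) \<Rightarrow> 'a set set \<Rightarrow> real" where
  "entropy_wrt_partition \<mu> T \<xi> =
     lim (\<lambda>n. partition_entropy \<mu> (dynamical_join \<mu> T \<xi> n) / real n)"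

definition metric_entropy :: "'a measure \<Rightarrow> ('a \<Rightarrow> 'a) \<Rightarrow> ereal" where
  "metric_entropy \<mu> T =
     (SUP \<xi> \<in> {\<xi>. finite_measurable_partition \<mu> \<xi>}. ereal (entropy_wrt_partition \<mu> T \<xi>))"

section \<open>Matrix products\<close>

definition operator_norm :: "real ^ 'd ^ 'd \<Rightarrow> real" where
  "operator_norm A = onorm (\<lambda>v. A *v v)"

definition complex_spectrum :: "real ^ 'd ^ 'd \<Rightarrow> complex set" where
  "complex_spectrum A =
     {z. \<exists>v :: complex ^ 'd. v \<noteq> 0 \<and> (\<chi> i j. complex_of_real (A $ i $ j)) *v v = z *s v}"

definition spectral_radius :: "real ^ 'd ^ 'd \<Rightarrow> real" where
  "spectral_radius A = Max (norm ` complex_spectrum A)"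

text \<open>The list \<open>[i1, \<dots>, in]\<close> is mapped to $A_{i_n} \cdots A_{i_1}$, in this order.\<close>

primrec word_product :: "(nat \<Rightarrow> real ^ 'd ^ 'd) \<Rightarrow> nat list \<Rightarrow> real ^ 'd ^ 'd" where
  "word_product A [] = mat 1"
| "word_product A (i # w) = word_product A w ** A i"

definition words :: "nat \<Rightarrow> nat \<Rightarrow> nat list set" where
  "words M n = {w. length w = n \<and> set w \<subseteq> {1..M}}"

definition irreducible_tuple :: "nat \<Rightarrow> (nat \<Rightarrow> real ^ 'd ^ 'd) \<Rightarrow> bool" where
  "irreducible_tuple M A \<longleftrightarrow>
     \<not> (\<exists>U :: (real ^ 'd) set. subspace U \<and> 0 < dim U \<and> dim U < CARD('d) \<and>
          (\<forall>i\<in>{1..M}. (\<lambda>v. A i *v v) ` U \<subseteq> U))"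

section \<open>Lyapunov exponent, pressure and equilibrium states\<close>

definition extended_ln :: "real \<Rightarrow> ereal" where
  "extended_ln x = (if x = 0 then - \<infinity> else ereal (ln x))"

text \<open>
  Integral of an extended real valued function, as the integral of the positive part minus that
  of the negative part (\<^const>\<open>e2ennreal\<close> sends negative values to 0). It is used here only for
  functions that are bounded above, so no \<open>\<infinity> - \<infinity>\<close> arises.
\<close>

definition extended_integral :: "'a measure \<Rightarrow> ('a \<Rightarrow> ereal) \<Rightarrow> ereal" where
  "extended_integral \<nu> f =
     enn2ereal (\<integral>\<^sup>+x. e2ennreal (f x) \<partial>\<nu>) - enn2ereal (\<integral>\<^sup>+x. e2ennreal (- f x) \<partial>\<nu>)"

definition lyapunov :: "(nat \<Rightarrow> real ^ 'd ^ 'd) \<Rightarrow> (nat \<Rightarrow> nat) measure \<Rightarrow> ereal" where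
  "lyapunov A \<nu> =
     lim (\<lambda>n. extended_integral \<nu>
                 (\<lambda>x. extended_ln (operator_norm (word_product A (map x [0..<n])))) / ereal (real n))"

definition pressure :: "nat \<Rightarrow> (nat \<Rightarrow> real ^ 'd ^ 'd) \<Rightarrow> real \<Rightarrow> ereal" where
  "pressure M A s =
     lim (\<lambda>n. extended_ln (\<Sum>w\<in>words M n. operator_norm (word_product A w) powr s)
                 / ereal (real n))"

definition equilibrium_states ::
  "nat \<Rightarrow> (nat \<Rightarrow> real ^ 'd ^ 'd) \<Rightarrow> real \<Rightarrow> (nat \<Rightarrow> nat) measure set" where
  "equilibrium_states M A s =
     {\<mu> \<in> invariant_measures M.
        metric_entropy \<mu> shift + ereal s * lyapunov A \<mu> =
        (SUP \<nu> \<in> invariant_measures M. metric_entropy \<nu> shift + ereal s * lyapunov A \<nu>)}"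

end

theory Submission
  imports Defs "HOL-Computational_Algebra.Fundamental_Theorem_Algebra"
begin

text \<open>
  Write $a(w) = e^{-nP(A,s)} \|A_{i_n} \cdots A_{i_1}\|^s$ for the normalised weight of a word
  $w = i_1 \dots i_n$, and $b(w)$ for the corresponding weight of $(B,t)$. Condition (ii) says that
  the weights are comparable up to a constant. Each of the other conditions compares data that
  determine the weights up to a constant.

  \<^emph>\<open>Gibbs measures.\<close> If $X$ and $Y$ are nonzero matrices, irreducibility provides a word $u$ with
  $X A_u Y \neq 0$; by compactness finitely many $u$ suffice, with a uniform bound
  $\|X A_u Y\| \geq \varepsilon \|X\| \|Y\|$ (\<open>operator_norm_quasi_multiplicative\<close>). So $a$ is
  submultiplicative and, up to inserting one of finitely many words, supermultiplicative, and
  therefore its sums over the words of length $n$ lie between $1$ and a constant. Averaging the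
  sums of $a$ over all ways to extend a word gives a shift invariant mass function that is
  comparable with $a$, which is realised by an invariant measure $\mu_A$ (\<open>exists_gibbs\<close>).

  \<^emph>\<open>Equilibrium states.\<close> Everything about entropy rests on the Gibbs inequality
  $-\sum p \log p \leq -\sum p \log q + \sum q - 1$ (\<open>shannon_le_cross_entropy\<close>). With $q$ a
  predictor of the atom of a partition from finitely many coordinates, it shows that metric entropy
  is the growth rate of the entropy of words (\<open>metric_entropy_eq\<close>). With $q = a$ it gives
  $h(\nu) + s \Lambda(A,\nu) \leq P(A,s)$, with equality for $\mu_A$. If equality holds for $\nu$,
  then the relative entropies of $\nu$ with respect to $\mu_A$ on words of length $n$ are bounded, so
  $\nu$ is absolutely continuous with respect to $\mu_A$; as $\mu_A$ is ergodic by
  quasi-multiplicativity, $\nu = \mu_A$. Hence $\mu_A$ is the only equilibrium state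
  (\<open>equilibrium_states_eq_gibbs\<close>).

  \<^emph>\<open>The implications.\<close> (i) implies (ii), since a common equilibrium state is comparable with both
  $a$ and $b$. (ii) implies (iv) by integrating logarithms, and (iv) implies (i), since then the
  quantities that are maximised differ by a constant. (ii) implies (iii) by applying (ii) to the
  powers of a word: the norms of the powers of a matrix grow like the powers of its spectral radius.
  For (iii) implies (ii), the norm of $A_w$ has to be bounded by a multiple of the spectral radius of
  $A_w A_u$, for some $u$ from a finite set (\<open>spectral_radius_comparable_to_norm\<close>). By compactness
  this fails only if there is a nonzero limit $X$ of multiples of products such that all the products
  $X A_u$ are nilpotent; that is excluded by an argument of Levitzki
  (\<open>not_all_multiples_nilpotent\<close>).
\<close>

section \<open>Subadditive sequences\<close>

text \<open>
  Fekete's lemma: $a_n / n$ converges to its infimum. Dividing $n$ by $m$ with remainder gives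
  $a_n / n \leq a_m / m + B / n$, where $B$ bounds the effect of the remainder. The limit may be
  $-\infty$, as for Lyapunov exponents.
\<close>
lemma fekete:
  fixes a :: "nat \<Rightarrow> real"
  assumes sub: "\<And>m n. a (m + n) \<le> a m + a n"
  shows "(\<lambda>n. ereal (a n / real n)) \<longlonglongrightarrow> (INF n\<in>{1..}. ereal (a n / real n))"
    (is "_ \<longlonglongrightarrow> ?I")
proof (rule order_tendstoI)
  fix x assume "x < ?I"
  then have "x < ereal (a n / real n)" if "n \<ge> 1" for n
    using that by (meson INF_lower atLeast_iff less_le_trans)
  then show "\<forall>\<^sub>F n in sequentially. x < ereal (a n / real n)"
    by (intro eventually_sequentiallyI[of 1])
next
  fix x assume "?I < x"
  then obtain m where m: "m \<ge> 1" "ereal (a m / real m) < x"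
    by (auto simp: INF_less_iff)
  obtain y where y: "ereal (a m / real m) < ereal y" "ereal y < x"
    using m(2) ereal_dense2 by blast
  define B where "B = Max ((\<lambda>r. \<bar>a r\<bar>) ` {..<m}) + \<bar>a m\<bar>"
  have Bound: "a n / real n \<le> a m / real m + B / real n" if n: "n \<ge> 1" for n
  proof -
    have mult: "a (q * m + r) \<le> real q * a m + a r" for q r
    proof (induction q)
      case (Suc q)
      have "a (Suc q * m + r) \<le> a m + a (q * m + r)"
        using sub[of m "q * m + r"] by (simp add: add.assoc)
      with Suc show ?case by (simp add: algebra_simps)
    qed simp
    define q r where "q = n div m" and "r = n mod m"
    have n_eq: "n = q * m + r" and r: "r < m"
      using m(1) by (auto simp: q_def r_def)
    have "a r \<le> Max ((\<lambda>r. \<bar>a r\<bar>) ` {..<m})"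
      using r by (intro order_trans[OF abs_ge_self Max_ge]) auto
    moreover have "real q * a m \<le> real n * (a m / real m) + \<bar>a m\<bar>"
    proof -
      have "real n * (a m / real m) = real q * a m + real r / real m * a m"
        using m(1) by (simp add: n_eq field_simps)
      moreover have "\<bar>real r / real m * a m\<bar> \<le> 1 * \<bar>a m\<bar>"
        unfolding abs_mult using r m(1) by (intro mult_right_mono) auto
      ultimately show ?thesis by linarith
    qed
    ultimately have "a n \<le> real n * (a m / real m) + B"
      using mult[of q r] unfolding B_def n_eq[symmetric] by linarith
    then show ?thesis
      using n by (simp add: field_simps)
  qed
  have "(\<lambda>n. a m / real m + B / real n) \<longlonglongrightarrow> a m / real m + 0"
    by (intro tendsto_intros lim_const_over_n)
  then have "\<forall>\<^sub>F n in sequentially. a m / real m + B / real n < y"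
    using y(1) by (simp add: order_tendstoD)
  then show "\<forall>\<^sub>F n in sequentially. ereal (a n / real n) < x"
    using eventually_ge_at_top[of 1]
  proof eventually_elim
    case (elim n)
    then have "ereal (a n / real n) \<le> ereal y"
      using Bound[of n] by simp
    then show ?case using y(2) by (rule le_less_trans)
  qed
qed

lemma fekete_bounded_below:
  fixes a :: "nat \<Rightarrow> real"
  assumes sub: "\<And>m n. a (m + n) \<le> a m + a n" and lower: "\<And>n. a n \<ge> c * real n"
  obtains L where "(\<lambda>n. a n / real n) \<longlonglongrightarrow> L" "\<And>n. n \<ge> 1 \<Longrightarrow> L * real n \<le> a n" "L \<ge> c"
proof -
  let ?I = "INF n\<in>{1..}. ereal (a n / real n)"
  have "?I \<le> ereal (a 1 / real 1)" by (rule INF_lower) simp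
  moreover have "ereal c \<le> ?I"
  proof (rule INF_greatest)
    fix n :: nat assume "n \<in> {1..}"
    then show "ereal c \<le> ereal (a n / real n)" using lower[of n] by (simp add: field_simps)
  qed
  ultimately obtain L where L: "?I = ereal L" by (cases ?I) auto
  have "L \<ge> c" using \<open>ereal c \<le> ?I\<close> L by simp
  moreover have "(\<lambda>n. a n / real n) \<longlonglongrightarrow> L"
    using fekete[of a, OF sub] unfolding L by simp
  moreover have "L * real n \<le> a n" if "n \<ge> 1" for n
  proof -
    have "?I \<le> ereal (a n / real n)" using that by (intro INF_lower) simp
    then show ?thesis using that unfolding L by (simp add: field_simps)
  qed
  ultimately show thesis using that by blast
qed

section \<open>Eigenvalues and the growth of matrix powers\<close>

text \<open>
  The sequence may have repetitions, so it is not enough to consider the set of its values: a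
  repetition is itself a relation.
\<close>
lemma linear_relation_of_length:
  fixes x :: "nat \<Rightarrow> 'a::euclidean_space"
  assumes "n \<ge> DIM('a)"
  shows "\<exists>c. (\<exists>i\<le>n. c i \<noteq> 0) \<and> (\<Sum>i\<le>n. c i *\<^sub>R x i) = 0"
proof (cases "inj_on x {..n}")
  case True
  then have "card (x ` {..n}) > DIM('a)"
    using assms by (simp add: card_image)
  then have "dependent (x ` {..n})"
    by (intro dependent_biggerset) auto
  then obtain u where u: "\<exists>v\<in>x ` {..n}. u v \<noteq> 0" "(\<Sum>v\<in>x ` {..n}. u v *\<^sub>R v) = 0"
    by (subst (asm) dependent_finite) auto
  show ?thesis
    using u True by (intro exI[of _ "u \<circ> x"]) (auto simp: sum.reindex)
next
  case False
  then obtain i j where ij: "i \<le> n" "j \<le> n" "i \<noteq> j" "x i = x j"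
    by (auto simp: inj_on_def)
  define c where "c k = (if k = i then 1 else if k = j then - 1 else 0 :: real)" for k
  have "(\<Sum>k\<le>n. c k *\<^sub>R x k) = (\<Sum>k\<in>{i, j}. c k *\<^sub>R x k)"
    using ij by (intro sum.mono_neutral_right) (auto simp: c_def)
  also have "\<dots> = 0"
    using ij by (simp add: c_def)
  finally show ?thesis
    using ij(1) by (intro exI[of _ c]) (auto simp: c_def)
qed

definition complexify :: "real ^ 'd ^ 'd \<Rightarrow> complex ^ 'd ^ 'd" where
  "complexify A = (\<chi> i j. complex_of_real (A $ i $ j))"

abbreviation mat_power :: "real ^ 'd ^ 'd \<Rightarrow> nat \<Rightarrow> real ^ 'd ^ 'd" where
  "mat_power A k \<equiv> ((**) A ^^ k) (mat 1)"

abbreviation cact :: "real ^ 'd ^ 'd \<Rightarrow> complex ^ 'd \<Rightarrow> complex ^ 'd" where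
  "cact A v \<equiv> complexify A *v v"

lemma complexify_mult: "complexify (A ** B) = complexify A ** complexify B"
  by (simp add: complexify_def matrix_matrix_mult_def vec_eq_iff)

lemma complexify_one: "complexify (mat 1) = mat 1"
  by (simp add: complexify_def mat_def vec_eq_iff)

lemma cact_mat_power: "cact (mat_power A k) v = (cact A ^^ k) v"
  by (induction k) (simp_all add: complexify_one complexify_mult matrix_vector_mul_assoc [symmetric])

lemma cact_scale: "cact A (c *s v) = c *s cact A v"
  by (simp add: matrix_vector_mult_def vec_eq_iff sum_distrib_left mult_ac)

lemma complex_spectrum_iff: "z \<in> complex_spectrum A \<longleftrightarrow> (\<exists>v. v \<noteq> 0 \<and> cact A v = z *s v)"
  by (auto simp: complex_spectrum_def complexify_def)

text \<open>
  The vector $f(A) v$. Polynomials act on single vectors, so that no ring of matrices is needed.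
\<close>
definition poly_act :: "real ^ 'd ^ 'd \<Rightarrow> complex poly \<Rightarrow> complex ^ 'd \<Rightarrow> complex ^ 'd" where
  "poly_act A f v = (\<Sum>i\<le>degree f. coeff f i *s (cact A ^^ i) v)"

lemma poly_act_altdef:
  assumes "degree f \<le> n"
  shows "poly_act A f v = (\<Sum>i\<le>n. coeff f i *s (cact A ^^ i) v)"
  unfolding poly_act_def using assms
  by (intro sum.mono_neutral_left) (auto simp: coeff_eq_0)

lemma poly_act_linear_factor:
  "poly_act A ([:- l, 1:] * g) v = poly_act A g (cact A v - l *s v)"
proof -
  let ?n = "Suc (degree g)"
  let ?T = "\<lambda>i. (cact A ^^ i) v"
  have deg: "degree ([:- l, 1:] * g) \<le> ?n"
    using degree_mult_le[of "[:- l, 1:]" g] by simp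
  have co: "coeff ([:- l, 1:] * g) i = (case i of 0 \<Rightarrow> 0 | Suc j \<Rightarrow> coeff g j) - l * coeff g i" for i
    by (simp add: coeff_pCons split: nat.splits)
  have pow: "(cact A ^^ i) (cact A v - l *s v) = ?T (Suc i) - l *s ?T i" for i
    by (induction i) (simp_all add: matrix_vector_mult_diff_distrib cact_scale)
  have "poly_act A ([:- l, 1:] * g) v
      = (\<Sum>i\<le>?n. (case i of 0 \<Rightarrow> 0 | Suc j \<Rightarrow> coeff g j) *s ?T i) - (\<Sum>i\<le>?n. (l * coeff g i) *s ?T i)"
    unfolding poly_act_altdef[OF deg] co by (simp add: vec.scale_left_diff_distrib sum_subtractf)
  also have "(\<Sum>i\<le>?n. (case i of 0 \<Rightarrow> 0 | Suc j \<Rightarrow> coeff g j) *s ?T i)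
      = (\<Sum>i\<le>degree g. coeff g i *s ?T (Suc i))"
    by (simp only: sum.atMost_Suc_shift) simp
  also have "(\<Sum>i\<le>?n. (l * coeff g i) *s ?T i) = (\<Sum>i\<le>degree g. (l * coeff g i) *s ?T i)"
    by (simp add: coeff_eq_0)
  also have "(\<Sum>i\<le>degree g. coeff g i *s ?T (Suc i)) - (\<Sum>i\<le>degree g. (l * coeff g i) *s ?T i)
      = poly_act A g (cact A v - l *s v)"
    unfolding poly_act_def pow
    by (simp add: sum_subtractf vec.scale_right_diff_distrib mult.commute)
  finally show ?thesis .
qed

text \<open>
  The vector $(A - l_n) \cdots (A - l_1) v$ for the list $[l_1, \dots, l_n]$.
\<close>
definition factor_act :: "real ^ 'd ^ 'd \<Rightarrow> complex list \<Rightarrow> complex ^ 'd \<Rightarrow> complex ^ 'd" where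
  "factor_act A ls v = fold (\<lambda>l u. cact A u - l *s u) ls v"

lemma factor_act_simps [simp]:
  "factor_act A [] v = v"
  "factor_act A (l # ls) v = factor_act A ls (cact A v - l *s v)"
  by (simp_all add: factor_act_def)

lemma factor_act_commute:
  "factor_act A ls (cact A v - l *s v) = cact A (factor_act A ls v) - l *s factor_act A ls v"
proof (induction ls arbitrary: v)
  case (Cons k ls)
  have eq: "cact A (cact A v - l *s v) - k *s (cact A v - l *s v)
      = cact A (cact A v - k *s v) - l *s (cact A v - k *s v)"
    by (simp add: matrix_vector_mult_diff_distrib cact_scale vec.scale_right_diff_distrib
        mult.commute[of k l])
  show ?case by (simp only: factor_act_simps eq Cons)
qed simp

lemma factor_act_zero: "factor_act A ls 0 = 0"
  by (induction ls) simp_all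

lemma factor_act_append: "factor_act A (ls @ ks) v = factor_act A ks (factor_act A ls v)"
  by (simp add: factor_act_def)

text \<open>
  Split $f$ into linear factors. A factor $A - l$ where $l$ is not an eigenvalue is injective and
  can be dropped, as all factors commute.
\<close>
lemma eigenvalue_factors_of_poly_act:
  assumes "f \<noteq> 0" "poly_act A f v = 0"
  shows "\<exists>ls. length ls \<le> degree f \<and> set ls \<subseteq> complex_spectrum A \<and> factor_act A ls v = 0"
  using assms
proof (induction "degree f" arbitrary: f v)
  case 0
  then obtain c where "f = [:c:]" "c \<noteq> 0"
    by (metis degree_eq_zeroE pCons_0_0)
  then have "v = 0"
    using 0 by (simp add: poly_act_def)
  then show ?case by (intro exI[of _ "[]"]) simp
next
  case (Suc n)
  have "\<not> constant (poly f)"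
    using Suc.hyps(2) by (simp add: constant_degree)
  then obtain l where "poly f l = 0"
    using fundamental_theorem_of_algebra by blast
  then obtain g where f: "f = [:- l, 1:] * g"
    by (metis dvdE poly_eq_0_iff_dvd)
  then have g: "g \<noteq> 0" using Suc.prems by auto
  then have deg: "degree f = Suc (degree g)"
    unfolding f by (subst degree_mult_eq) simp_all
  then have "\<exists>ls. length ls \<le> degree g \<and> set ls \<subseteq> complex_spectrum A \<and>
      factor_act A ls (cact A v - l *s v) = 0"
    using Suc.prems(2) g Suc.hyps(2) unfolding f poly_act_linear_factor by (intro Suc.hyps(1)) auto
  then obtain ls where ls: "length ls \<le> degree g" "set ls \<subseteq> complex_spectrum A"
    "factor_act A ls (cact A v - l *s v) = 0" by blast
  show ?case
  proof (cases "l \<in> complex_spectrum A")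
    case True
    then show ?thesis
      using ls deg by (intro exI[of _ "l # ls"]) auto
  next
    case False
    have "cact A (factor_act A ls v) = l *s factor_act A ls v"
      using ls(3) by (simp add: factor_act_commute)
    then have "factor_act A ls v = 0"
      using False by (auto simp: complex_spectrum_iff)
    then show ?thesis using ls deg by (intro exI[of _ ls]) auto
  qed
qed

text \<open>
  The powers of $A$ up to the dimension of the space of matrices are linearly dependent. This weak
  form of the theorem of Cayley and Hamilton avoids determinants; only the existence of a bound for
  the degree that is independent of $A$ matters later.
\<close>
lemma annihilating_polynomial:
  fixes A :: "real ^ 'd ^ 'd"
  obtains f where "f \<noteq> 0" "degree f \<le> CARD('d) * CARD('d)" "\<And>v. poly_act A f v = 0"
proof -
  let ?n = "CARD('d) * CARD('d)"
  have "DIM(real ^ 'd ^ 'd) \<le> ?n" by simp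
  from linear_relation_of_length[OF this, of "mat_power A"]
  obtain c where c: "\<exists>i\<le>?n. c i \<noteq> 0" "(\<Sum>i\<le>?n. c i *\<^sub>R mat_power A i) = 0" by auto
  define f where "f = (\<Sum>i\<le>?n. monom (complex_of_real (c i)) i)"
  have co: "coeff f i = (if i \<le> ?n then of_real (c i) else 0)" for i
    by (simp add: f_def coeff_sum)
  have deg: "degree f \<le> ?n" by (intro degree_le) (simp add: co)
  have nz: "f \<noteq> 0" using c(1) co by (metis coeff_0 of_real_eq_0_iff)
  have "poly_act A f v = 0" for v
  proof -
    have "poly_act A f v = (\<Sum>i\<le>?n. of_real (c i) *s cact (mat_power A i) v)"
      unfolding poly_act_altdef[OF deg] by (simp add: co cact_mat_power)
    also have "\<dots> = cact (\<Sum>i\<le>?n. c i *\<^sub>R mat_power A i) v"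
      by (simp add: vec_eq_iff complexify_def matrix_vector_mult_def sum_distrib_left
          sum_distrib_right sum.swap[of _ "{..?n}"] mult_ac)
    also have "\<dots> = 0" unfolding c(2) by (simp add: vec_eq_iff complexify_def matrix_vector_mult_def)
    finally show ?thesis .
  qed
  with nz deg that show thesis by blast
qed

lemma eigenvalue_power:
  assumes "cact A v = z *s v"
  shows "(cact A ^^ k) v = z ^ k *s v"
  by (induction k) (simp_all add: assms cact_scale mult.commute)

lemma finite_complex_spectrum: "finite (complex_spectrum A)"
proof -
  obtain f where f: "f \<noteq> 0" "\<And>v. poly_act A f v = 0"
    using annihilating_polynomial by metis
  have "complex_spectrum A \<subseteq> {z. poly f z = 0}"
  proof
    fix z assume "z \<in> complex_spectrum A"
    then obtain v where v: "v \<noteq> 0" "cact A v = z *s v" by (auto simp: complex_spectrum_iff)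
    have "poly_act A f v = poly f z *s v"
      by (simp add: poly_act_def eigenvalue_power[OF v(2)] poly_altdef vec.scale_sum_left)
    then show "z \<in> {z. poly f z = 0}"
      using f(2)[of v] v(1) by simp
  qed
  then show ?thesis
    using poly_roots_finite[OF f(1)] finite_subset by blast
qed

lemma eigenvalue_factors:
  fixes A :: "real ^ 'd ^ 'd"
  obtains ls where "length ls \<le> CARD('d) * CARD('d)" "set ls \<subseteq> complex_spectrum A"
    "factor_act A ls v = 0"
proof -
  obtain f :: "complex poly" where "f \<noteq> 0" "degree f \<le> CARD('d) * CARD('d)" "poly_act A f v = 0"
    using annihilating_polynomial[of A] by metis
  then show thesis
    using eigenvalue_factors_of_poly_act[of f A v] that order_trans by blast
qed

lemma complex_spectrum_nonempty: "complex_spectrum (A :: real ^ 'd ^ 'd) \<noteq> {}"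
proof
  assume "complex_spectrum A = {}"
  moreover obtain ls where "set ls \<subseteq> complex_spectrum A" "factor_act A ls (1 :: complex ^ 'd) = 0"
    using eigenvalue_factors by metis
  ultimately show False by simp
qed

lemma norm_le_spectral_radius: "z \<in> complex_spectrum A \<Longrightarrow> norm z \<le> spectral_radius A"
  unfolding spectral_radius_def by (intro Max_ge) (auto simp: finite_complex_spectrum)

lemma spectral_radius_attained: "\<exists>z\<in>complex_spectrum A. norm z = spectral_radius A"
  unfolding spectral_radius_def
  using Max_in[of "norm ` complex_spectrum A"] finite_complex_spectrum complex_spectrum_nonempty
  by fastforce

lemma spectral_radius_nonneg: "spectral_radius A \<ge> 0"
  using spectral_radius_attained[of A] norm_ge_zero by metis

lemma operator_norm_bound: "norm (A *v x) \<le> operator_norm A * norm x"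
  unfolding operator_norm_def by (rule onorm[OF matrix_vector_mul_bounded_linear])

lemma operator_norm_le: "(\<And>x. norm (A *v x) \<le> b * norm x) \<Longrightarrow> operator_norm A \<le> b"
  unfolding operator_norm_def by (rule onorm_le)

lemma operator_norm_nonneg: "operator_norm A \<ge> 0"
  unfolding operator_norm_def by (rule onorm_pos_le[OF matrix_vector_mul_bounded_linear])

lemma operator_norm_mult: "operator_norm (A ** B) \<le> operator_norm A * operator_norm B"
proof (rule operator_norm_le)
  fix x
  have "norm ((A ** B) *v x) \<le> operator_norm A * norm (B *v x)"
    using operator_norm_bound[of A "B *v x"] by (simp add: matrix_vector_mul_assoc)
  also have "\<dots> \<le> operator_norm A * (operator_norm B * norm x)"
    by (intro mult_left_mono operator_norm_bound operator_norm_nonneg)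
  finally show "norm ((A ** B) *v x) \<le> operator_norm A * operator_norm B * norm x"
    by (simp add: mult.assoc)
qed

lemma operator_norm_one: "operator_norm (mat 1 :: real ^ 'd ^ 'd) = 1"
proof -
  have "(\<lambda>v. (mat 1 :: real ^ 'd ^ 'd) *v v) = (\<lambda>v. v)" by simp
  then show ?thesis unfolding operator_norm_def by (simp only: onorm_id)
qed

lemma operator_norm_eq_0: "operator_norm A = 0 \<longleftrightarrow> A = 0"
proof
  assume "operator_norm A = 0"
  then have "A *v x = 0" for x
    using operator_norm_bound[of A x] by simp
  then show "A = 0" by (simp add: matrix_eq)
next
  assume "A = 0"
  then show "operator_norm A = 0" by (simp add: operator_norm_def onorm_zero)
qed

text \<open>
  The action on complex vectors has the same norm as the real action, because real and imaginary
  parts are mapped separately.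
\<close>
lemma norm_cact_le: "norm (cact A v) \<le> operator_norm A * norm v"
proof -
  define re :: "complex ^ 'a \<Rightarrow> real ^ 'a" where "re v = (\<chi> i. Re (v $ i))" for v
  define im :: "complex ^ 'a \<Rightarrow> real ^ 'a" where "im v = (\<chi> i. Im (v $ i))" for v
  have split: "(norm v)\<^sup>2 = (norm (re v))\<^sup>2 + (norm (im v))\<^sup>2" for v
    by (simp add: norm_vec_def L2_set_def sum_nonneg re_def im_def cmod_power2 sum.distrib)
  have "re (cact A v) = A *v re v" "im (cact A v) = A *v im v"
    by (simp_all add: re_def im_def complexify_def matrix_vector_mult_def vec_eq_iff)
  then have "(norm (cact A v))\<^sup>2 \<le> (operator_norm A * norm (re v))\<^sup>2 + (operator_norm A * norm (im v))\<^sup>2"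
    unfolding split[of "cact A v"]
    by (intro add_mono power_mono) (simp_all add: operator_norm_bound)
  also have "\<dots> = (operator_norm A * norm v)\<^sup>2"
    by (simp add: power_mult_distrib split[of v] algebra_simps)
  finally show ?thesis
    by (rule power2_le_imp_le) (simp add: operator_norm_nonneg)
qed

lemma norm_cact_power_le: "norm ((cact A ^^ k) v) \<le> operator_norm A ^ k * norm v"
proof (induction k)
  case (Suc k)
  have "norm ((cact A ^^ Suc k) v) \<le> operator_norm A * norm ((cact A ^^ k) v)"
    by (simp add: norm_cact_le)
  also have "\<dots> \<le> operator_norm A * (operator_norm A ^ k * norm v)"
    by (intro mult_left_mono Suc operator_norm_nonneg)
  finally show ?case by (simp add: mult.assoc)
qed simp

lemma norm_vector_scalar_mult: "norm (c *s (v :: complex ^ 'd)) = norm c * norm v"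
  by (simp add: norm_vec_def norm_mult L2_set_right_distrib)

definition cvec :: "real ^ 'd \<Rightarrow> complex ^ 'd" where
  "cvec x = (\<chi> i. complex_of_real (x $ i))"

lemma cact_cvec: "cact A (cvec x) = cvec (A *v x)"
  by (simp add: cvec_def complexify_def matrix_vector_mult_def vec_eq_iff)

lemma norm_cvec: "norm (cvec x) = norm x"
  by (simp add: norm_vec_def cvec_def)

lemma spectral_radius_power_le: "spectral_radius A ^ k \<le> operator_norm (mat_power A k)"
proof -
  obtain z where z: "z \<in> complex_spectrum A" "norm z = spectral_radius A"
    using spectral_radius_attained by blast
  then obtain v where v: "v \<noteq> 0" "cact A v = z *s v" by (auto simp: complex_spectrum_iff)
  have "cact (mat_power A k) v = z ^ k *s v"
    by (simp add: cact_mat_power eigenvalue_power[OF v(2)])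
  then have "spectral_radius A ^ k * norm v \<le> operator_norm (mat_power A k) * norm v"
    using norm_cact_le[of "mat_power A k" v] z(2)
    by (simp add: norm_vector_scalar_mult norm_power)
  then show ?thesis using v(1) by simp
qed

lemma spectral_radius_le_operator_norm: "spectral_radius A \<le> operator_norm A"
  using spectral_radius_power_le[of A 1] by simp

text \<open>
  One factor $A - l$ at a time: if $u = Av - lv$, then $A^{k+1} v = l A^k v + A^k u$, and the bound
  $K R^k$ for $A^k u$ yields a bound of the same form for $A^k v$, because $|l| < R$.
\<close>
lemma orbit_growth:
  assumes "R > 0" "\<And>l. l \<in> set ls \<Longrightarrow> norm l < R" "factor_act A ls v = 0"
  shows "\<exists>K. \<forall>k. norm ((cact A ^^ k) v) \<le> K * R ^ k"
  using assms(2,3)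
proof (induction ls arbitrary: v)
  case Nil
  have "(cact A ^^ k) 0 = 0" for k by (induction k) auto
  then show ?case using Nil by (intro exI[of _ 0]) auto
next
  case (Cons l ls)
  have "\<exists>K. \<forall>k. norm ((cact A ^^ k) (cact A v - l *s v)) \<le> K * R ^ k"
    using Cons.prems by (intro Cons.IH) auto
  then obtain K where K: "\<And>k. norm ((cact A ^^ k) (cact A v - l *s v)) \<le> K * R ^ k"
    by blast
  define K' where "K' = max (norm v) (K / (R - norm l))"
  have lR: "norm l < R" using Cons.prems by simp
  have K': "K \<le> K' * (R - norm l)"
    using lR unfolding K'_def by (metis diff_gt_0_iff_gt max.cobounded2 pos_divide_le_eq)
  have "norm ((cact A ^^ k) v) \<le> K' * R ^ k" for k
  proof (induction k)
    case 0
    then show ?case by (simp add: K'_def)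
  next
    case (Suc k)
    have "(cact A ^^ k) (cact A v - l *s v) = (cact A ^^ Suc k) v - l *s (cact A ^^ k) v"
      by (induction k) (simp_all add: matrix_vector_mult_diff_distrib cact_scale)
    then have "norm ((cact A ^^ Suc k) v) \<le> norm l * norm ((cact A ^^ k) v) + K * R ^ k"
      using K[of k] norm_triangle_sub[of "(cact A ^^ Suc k) v" "l *s (cact A ^^ k) v"]
      by (simp add: norm_vector_scalar_mult)
    also have "\<dots> \<le> norm l * (K' * R ^ k) + K' * (R - norm l) * R ^ k"
      using assms(1) by (intro add_mono mult_left_mono mult_right_mono Suc K') auto
    also have "\<dots> = K' * R ^ Suc k" by (simp add: algebra_simps)
    finally show ?case .
  qed
  then show ?case by blast
qed

text \<open>
  This and \<open>spectral_radius_power_le\<close> make up the part of Gelfand's formula that is needed.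
\<close>
lemma operator_norm_power_growth:
  fixes A :: "real ^ 'd ^ 'd"
  assumes "R > spectral_radius A"
  obtains K where "K > 0" "\<And>k. operator_norm (mat_power A k) \<le> K * R ^ k"
proof -
  have R: "R > 0" using assms spectral_radius_nonneg[of A] by linarith
  have "\<exists>K. \<forall>k. norm (mat_power A k *v axis i 1) \<le> K * R ^ k" for i :: 'd
  proof -
    obtain ls where ls: "set ls \<subseteq> complex_spectrum A" "factor_act A ls (cvec (axis i 1)) = 0"
      using eigenvalue_factors by metis
    have "\<exists>K. \<forall>k. norm ((cact A ^^ k) (cvec (axis i 1))) \<le> K * R ^ k"
      using R ls(1) assms norm_le_spectral_radius by (intro orbit_growth[OF _ _ ls(2)]) fastforce+
    moreover have "norm ((cact A ^^ k) (cvec (axis i 1))) = norm (mat_power A k *v axis i 1)" for k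
      by (simp flip: cact_mat_power add: cact_cvec norm_cvec)
    ultimately show ?thesis by simp
  qed
  then obtain K where K: "\<And>i k. norm (mat_power A k *v axis i 1) \<le> K i * R ^ k" by metis
  have "operator_norm (mat_power A k) \<le> (\<Sum>i\<in>UNIV. K i) * R ^ k" for k
  proof (rule operator_norm_le)
    fix x :: "real ^ 'd"
    have "mat_power A k *v x = mat_power A k *v (\<Sum>i\<in>UNIV. (x $ i) *\<^sub>R axis i 1)"
      by (subst basis_expansion[symmetric, of x])
         (simp add: vector_scalar_mult_def scaleR_vec_def)
    also have "\<dots> = (\<Sum>i\<in>UNIV. (x $ i) *\<^sub>R (mat_power A k *v axis i 1))"
      by (simp add: linear_sum[OF matrix_vector_mul_linear] matrix_vector_mult_scaleR)
    also have "norm \<dots> \<le> (\<Sum>i\<in>UNIV. norm x * (K i * R ^ k))"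
      by (intro sum_norm_le) (auto intro!: mult_mono K component_le_norm_cart)
    finally show "norm (mat_power A k *v x) \<le> (\<Sum>i\<in>UNIV. K i) * R ^ k * norm x"
      by (simp add: sum_distrib_left sum_distrib_right mult_ac)
  qed
  moreover have "(\<Sum>i\<in>UNIV. K i) * R ^ k \<le> max 1 (\<Sum>i\<in>UNIV. K i) * R ^ k" for k
    using R by (intro mult_right_mono) auto
  ultimately show thesis
    by (intro that[of "max 1 (\<Sum>i\<in>UNIV. K i)"]) (auto intro: order_trans)
qed

lemma norm_factor_act_minus_power:
  assumes "\<And>l. l \<in> set ls \<Longrightarrow> norm l \<le> r" "r \<ge> 0"
  shows "norm (factor_act A ls v - (cact A ^^ length ls) v)
      \<le> ((operator_norm A + r) ^ length ls - operator_norm A ^ length ls) * norm v"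
  using assms(1)
proof (induction ls arbitrary: v)
  case (Cons l ls)
  let ?a = "operator_norm A" and ?n = "length ls"
  let ?u = "cact A v - l *s v"
  have a: "?a \<ge> 0" by (rule operator_norm_nonneg)
  have l: "norm (l *s v) \<le> r * norm v"
    using Cons.prems by (simp add: norm_vector_scalar_mult mult_right_mono)
  then have u: "norm ?u \<le> (?a + r) * norm v"
    using norm_cact_le[of A v] norm_triangle_ineq4[of "cact A v" "l *s v"]
    by (simp add: algebra_simps)
  have "(cact A ^^ ?n) ?u - (cact A ^^ Suc ?n) v = - (cact A ^^ ?n) (l *s v)"
  proof -
    have "(cact A ^^ n) ?u = (cact A ^^ Suc n) v - (cact A ^^ n) (l *s v)" for n
      by (induction n) (simp_all add: matrix_vector_mult_diff_distrib)
    then show ?thesis by simp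
  qed
  then have 1: "norm ((cact A ^^ ?n) ?u - (cact A ^^ Suc ?n) v) \<le> ?a ^ ?n * (r * norm v)"
    using order_trans[OF norm_cact_power_le mult_left_mono[OF l zero_le_power[OF a]]] by simp
  have "norm (factor_act A ls ?u - (cact A ^^ ?n) ?u) \<le> ((?a + r) ^ ?n - ?a ^ ?n) * norm ?u"
    using Cons by simp
  also have "\<dots> \<le> ((?a + r) ^ ?n - ?a ^ ?n) * ((?a + r) * norm v)"
    using a assms(2) by (intro mult_left_mono u) (simp add: power_mono)
  finally have 2: "norm (factor_act A ls ?u - (cact A ^^ ?n) ?u)
      \<le> ((?a + r) ^ ?n - ?a ^ ?n) * ((?a + r) * norm v)" .
  have "factor_act A (l # ls) v - (cact A ^^ Suc ?n) v
      = (factor_act A ls ?u - (cact A ^^ ?n) ?u) + ((cact A ^^ ?n) ?u - (cact A ^^ Suc ?n) v)"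
    by simp
  then have "norm (factor_act A (l # ls) v - (cact A ^^ Suc ?n) v)
      \<le> ((?a + r) ^ ?n - ?a ^ ?n) * ((?a + r) * norm v) + ?a ^ ?n * (r * norm v)"
    using norm_triangle_mono[OF 2 1] by simp
  also have "\<dots> = ((?a + r) ^ Suc ?n - ?a ^ Suc ?n) * norm v"
    by (simp add: algebra_simps)
  finally show ?case by simp
qed simp

lemma power_add_minus_power_le:
  fixes a r :: real
  assumes "a \<ge> 0" "r \<ge> 0"
  shows "(a + r) ^ Suc n - a ^ Suc n \<le> r * real (Suc n) * (a + r) ^ n"
proof (induction n)
  case (Suc n)
  have "(a + r) ^ Suc (Suc n) - a ^ Suc (Suc n) = (a + r) * ((a + r) ^ Suc n - a ^ Suc n) + r * a ^ Suc n"
    by (simp add: algebra_simps)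
  also have "\<dots> \<le> (a + r) * (r * real (Suc n) * (a + r) ^ n) + r * (a + r) ^ Suc n"
    using assms by (intro add_mono mult_left_mono Suc power_mono) auto
  also have "\<dots> = r * real (Suc (Suc n)) * (a + r) ^ Suc n"
    by (simp add: algebra_simps)
  finally show ?case .
qed simp

text \<open>
  A quantitative form of the fact that a matrix without nonzero eigenvalues is nilpotent. In the
  expansion of $(A - l_1) \cdots (A - l_D) v = 0$ all terms except $A^D v$ contain at least one
  eigenvalue, so $A^D v$ is small if the eigenvalues are. Both sides are homogeneous of degree $D$ in $A$, which allows
  the bound to be transferred from matrices of norm one to arbitrary multiples.
\<close>
lemma mat_power_le_spectral_radius:
  fixes A :: "real ^ 'd ^ 'd"
  shows "operator_norm (mat_power A (CARD('d) * CARD('d)))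
    \<le> spectral_radius A * real (CARD('d) * CARD('d)) * (2 * operator_norm A) ^ (CARD('d) * CARD('d) - 1)"
proof -
  let ?D = "CARD('d) * CARD('d)" and ?a = "operator_norm A" and ?r = "spectral_radius A"
  have D: "?D = Suc (?D - 1)" by simp
  have r: "?r \<ge> 0" by (rule spectral_radius_nonneg)
  have a: "?a \<ge> 0" by (rule operator_norm_nonneg)
  have "operator_norm (mat_power A ?D) \<le> (?a + ?r) ^ ?D - ?a ^ ?D"
  proof (rule operator_norm_le)
    fix x :: "real ^ 'd"
    obtain ls where ls: "length ls \<le> ?D" "set ls \<subseteq> complex_spectrum A" "factor_act A ls (cvec x) = 0"
      using eigenvalue_factors by metis
    \<comment> \<open>Padding by zeros gives exactly D factors without affecting the bound for the roots.\<close>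
    define ks where "ks = ls @ replicate (?D - length ls) 0"
    have ks: "length ks = ?D" "factor_act A ks (cvec x) = 0"
      using ls by (auto simp: ks_def factor_act_append factor_act_zero)
    have "norm l \<le> ?r" if "l \<in> set ks" for l
      using that ls(2) norm_le_spectral_radius r by (auto simp: ks_def split: if_splits)
    then have "norm (factor_act A ks (cvec x) - (cact A ^^ ?D) (cvec x))
        \<le> ((?a + ?r) ^ ?D - ?a ^ ?D) * norm (cvec x)"
      using norm_factor_act_minus_power[of ks ?r A "cvec x"] r ks(1) by simp
    then show "norm (mat_power A ?D *v x) \<le> ((?a + ?r) ^ ?D - ?a ^ ?D) * norm x"
      by (simp add: ks(2) norm_cvec cact_cvec flip: cact_mat_power)
  qed
  also have "\<dots> \<le> ?r * real ?D * (?a + ?r) ^ (?D - 1)"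
    using power_add_minus_power_le[OF a r, of "?D - 1"] D by metis
  also have "\<dots> \<le> ?r * real ?D * (2 * ?a) ^ (?D - 1)"
    using r a spectral_radius_le_operator_norm[of A] by (intro mult_left_mono power_mono) auto
  finally show ?thesis .
qed

section \<open>Irreducible tuples of matrices\<close>

text \<open>
  The sets where a single $g_i$ exceeds $1/(m+1)$ cover $K$; take a finite subcover.
\<close>
lemma compact_uniformly_positive:
  fixes g :: "'i \<Rightarrow> 'a::topological_space \<Rightarrow> real"
  assumes K: "compact K" and cont: "\<And>i. i \<in> I \<Longrightarrow> continuous_on UNIV (g i)"
    and pos: "\<And>x. x \<in> K \<Longrightarrow> \<exists>i\<in>I. g i x > 0"
  obtains F e where "finite F" "F \<subseteq> I" "e > 0" "\<And>x. x \<in> K \<Longrightarrow> \<exists>i\<in>F. g i x > e"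
proof -
  define U where "U = (\<lambda>(i, m). {x. g i x > 1 / real (Suc m)})"
  have op: "open (U c)" if "c \<in> I \<times> UNIV" for c
    using that cont by (auto simp: U_def intro!: open_Collect_less continuous_intros)
  have cover: "K \<subseteq> (\<Union>c\<in>I \<times> UNIV. U c)"
  proof
    fix x assume "x \<in> K"
    then obtain i where "i \<in> I" "g i x > 0" using pos by blast
    moreover then obtain m where "1 / real (Suc m) < g i x" using nat_approx_posE by blast
    ultimately show "x \<in> (\<Union>c\<in>I \<times> UNIV. U c)" by (auto simp: U_def)
  qed
  obtain C where C: "C \<subseteq> I \<times> UNIV" "finite C" "K \<subseteq> (\<Union>c\<in>C. U c)"
    using compactE_image[OF K op cover] by blast
  define N where "N = Max (insert 0 (snd ` C))"
  have "\<exists>i\<in>fst ` C. g i x > 1 / real (Suc N)" if x: "x \<in> K" for x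
  proof -
    obtain i m where im: "(i, m) \<in> C" "g i x > 1 / real (Suc m)"
      using C(3) x by (fastforce simp: U_def)
    then have "m \<le> N"
      using C(2) unfolding N_def by (intro Max_ge) force+
    then have "1 / real (Suc N) \<le> 1 / real (Suc m)"
      by (intro divide_left_mono) auto
    with im show ?thesis by force
  qed
  moreover have "finite (fst ` C)" "fst ` C \<subseteq> I" "1 / real (Suc N) > 0"
    using C by auto
  ultimately show thesis using that by blast
qed

lemma continuous_on_matrix_mult [continuous_intros]:
  fixes f :: "'a::topological_space \<Rightarrow> real ^ 'n ^ 'm" and g :: "'a \<Rightarrow> real ^ 'k ^ 'n"
  assumes "continuous_on S f" "continuous_on S g"
  shows "continuous_on S (\<lambda>x. f x ** g x)"
  unfolding matrix_matrix_mult_def using assms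
  by (intro continuous_intros)

lemma continuous_on_mat_power:
  assumes "continuous_on S f"
  shows "continuous_on S (\<lambda>x. mat_power (f x) k)"
  by (induction k) (auto intro!: continuous_intros assms)

lemma norm_le_operator_norm:
  fixes A :: "real ^ 'd ^ 'd"
  shows "norm A \<le> real (CARD('d) * CARD('d)) * operator_norm A"
proof -
  have "norm A \<le> (\<Sum>i\<in>UNIV. norm (A $ i))"
    unfolding norm_vec_def by (rule L2_set_le_sum) simp
  also have "\<dots> \<le> (\<Sum>i\<in>UNIV. \<Sum>j\<in>UNIV. \<bar>A $ i $ j\<bar>)"
    by (intro sum_mono norm_le_l1_cart)
  also have "\<dots> \<le> (\<Sum>i\<in>(UNIV :: 'd set). \<Sum>j\<in>(UNIV :: 'd set). operator_norm A)"
    unfolding operator_norm_def by (intro sum_mono matrix_component_le_onorm)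
  finally show ?thesis by simp
qed

lemma operator_norm_le_norm:
  fixes A :: "real ^ 'd ^ 'd"
  shows "operator_norm A \<le> real (CARD('d) * CARD('d)) * norm A"
proof -
  have "\<bar>A $ i $ j\<bar> \<le> norm A" for i j
    by (rule order_trans[OF component_le_norm_cart Finite_Cartesian_Product.norm_nth_le])
  then show ?thesis
    unfolding operator_norm_def
    using onorm_le_matrix_component[of A "norm A"] by simp
qed

lemma mat_one_nonzero: "(mat 1 :: real ^ 'd ^ 'd) \<noteq> 0"
proof
  assume "(mat 1 :: real ^ 'd ^ 'd) = 0"
  then have "operator_norm (mat 1 :: real ^ 'd ^ 'd) = 0" by (simp add: operator_norm_eq_0)
  then show False by (simp add: operator_norm_one)
qed

lemma word_product_append: "word_product A (u @ v) = word_product A v ** word_product A u"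
  by (induction u) (simp_all add: matrix_mul_assoc)

text \<open>
  The span of the orbit of $y$ under all products is invariant under the tuple and contains $y$, the
  image under the empty product.
\<close>
lemma orbit_spans:
  fixes A :: "nat \<Rightarrow> real ^ 'd ^ 'd"
  assumes irr: "irreducible_tuple M A" and y: "y \<noteq> 0"
  shows "span ((\<lambda>u. word_product A u *v y) ` lists {1..M}) = UNIV"
proof -
  let ?S = "(\<lambda>u. word_product A u *v y) ` lists {1..M}"
  have "A i *v z \<in> span ?S" if i: "i \<in> {1..M}" and z: "z \<in> span ?S" for i z
  proof -
    have "(*v) (A i) ` ?S \<subseteq> ?S"
    proof
      fix z assume "z \<in> (*v) (A i) ` ?S"
      then obtain u where z: "z = A i *v (word_product A u *v y)" and "u \<in> lists {1..M}" by blast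
      then have "u @ [i] \<in> lists {1..M}" using i by auto
      moreover have "A i *v (word_product A u *v y) = word_product A (u @ [i]) *v y"
        by (simp add: word_product_append matrix_vector_mul_assoc)
      ultimately show "z \<in> ?S" unfolding z by (metis imageI)
    qed
    then have "(*v) (A i) ` span ?S \<subseteq> span ?S"
      by (metis linear_span_image matrix_vector_mul_linear span_mono)
    with z show ?thesis by auto
  qed
  moreover have "y \<in> span ?S"
    by (rule span_base) (auto intro!: image_eqI[of _ _ "[]"])
  then have "dim (span ?S) > 0"
    using y by (metis dim_eq_0 gr0I singletonD subsetD)
  ultimately have "dim (span ?S) = CARD('d)"
    using irr dim_subset_UNIV_cart[of "span ?S"]
    unfolding irreducible_tuple_def by (metis image_subsetI le_neq_implies_less subspace_span)
  then show ?thesis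
    by (metis DIM_cart DIM_real dim_eq_full mult.right_neutral span_span)
qed

lemma exists_word_bridging:
  fixes A :: "nat \<Rightarrow> real ^ 'd ^ 'd"
  assumes irr: "irreducible_tuple M A" and "X \<noteq> 0" "Y \<noteq> 0"
  shows "\<exists>u\<in>lists {1..M}. X ** word_product A u ** Y \<noteq> 0"
proof (rule ccontr)
  assume "\<not> ?thesis"
  then have zero: "X ** word_product A u ** Y = 0" if "u \<in> lists {1..M}" for u
    using that by blast
  obtain v where v: "Y *v v \<noteq> 0" using \<open>Y \<noteq> 0\<close> by (metis matrix_eq matrix_vector_mult_0)
  obtain z where z: "X *v z \<noteq> 0" using \<open>X \<noteq> 0\<close> by (metis matrix_eq matrix_vector_mult_0)
  have "z \<in> span ((\<lambda>u. word_product A u *v (Y *v v)) ` lists {1..M})"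
    using orbit_spans[OF irr v] by simp
  then have "X *v z = 0"
  proof (induction rule: span_induct)
    case base
    show ?case by (auto simp: subspace_def matrix_vector_right_distrib matrix_vector_mult_scaleR)
  next
    case (step x)
    then obtain u where "u \<in> lists {1..M}" "x = word_product A u *v (Y *v v)" by blast
    then have "X *v x = (X ** word_product A u ** Y) *v v" "X ** word_product A u ** Y = 0"
      using zero by (simp_all add: matrix_vector_mul_assoc matrix_mul_assoc)
    then show ?case by simp
  qed
  with z show False by simp
qed

lemma matrix_mult_scaleR:
  fixes X :: "real ^ 'd ^ 'd"
  shows "(c *\<^sub>R X) ** Y = c *\<^sub>R (X ** Y)" "X ** (c *\<^sub>R Y) = c *\<^sub>R (X ** Y)"
  by (simp_all add: matrix_matrix_mult_def vec_eq_iff sum_distrib_left mult_ac)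

lemma mat_power_scaleR: "mat_power (c *\<^sub>R X) k = c ^ k *\<^sub>R mat_power X k"
  by (induction k) (simp_all add: matrix_mult_scaleR)

text \<open>
  Quasi-multiplicativity. For matrices $X, Y$ on the unit sphere the words $u$ with
  $X A_u Y \neq 0$ from \<open>exists_word_bridging\<close> can be chosen from a finite set with a uniform
  lower bound, by compactness; the general case follows by scaling. The Euclidean norm of matrices
  serves for compactness, and it is equivalent to the operator norm.
\<close>
lemma operator_norm_quasi_multiplicative:
  fixes A :: "nat \<Rightarrow> real ^ 'd ^ 'd"
  assumes irr: "irreducible_tuple M A"
  obtains F e where "finite F" "F \<subseteq> lists {1..M}" "e > 0"
    "\<And>X Y. \<exists>u\<in>F. operator_norm (X ** word_product A u ** Y) \<ge> e * operator_norm X * operator_norm Y"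
proof -
  let ?S = "sphere (0 :: real ^ 'd ^ 'd) 1"
  let ?g = "\<lambda>u p. norm (fst p ** word_product A u ** snd p)"
  have comp: "compact (?S \<times> ?S)" by (intro compact_Times compact_sphere)
  have cont: "continuous_on UNIV (?g u)" if "u \<in> lists {1..M}" for u by (intro continuous_intros)
  have pos: "\<exists>u\<in>lists {1..M}. ?g u p > 0" if p: "p \<in> ?S \<times> ?S" for p
  proof -
    have "fst p \<noteq> 0" "snd p \<noteq> 0" using p by auto
    then show ?thesis using exists_word_bridging[OF irr, of "fst p" "snd p"] by simp
  qed
  obtain F e where F: "finite F" "F \<subseteq> lists {1..M}" "e > 0"
    and unif: "\<And>p. p \<in> ?S \<times> ?S \<Longrightarrow> \<exists>u\<in>F. ?g u p > e"
    using compact_uniformly_positive[OF comp cont pos] by blast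
  define c where "c = real (CARD('d) * CARD('d))"
  have c: "c > 0" by (simp add: c_def)
  have "\<exists>u\<in>F. operator_norm (X ** word_product A u ** Y) \<ge> (e / c ^ 3) * operator_norm X * operator_norm Y"
    for X Y :: "real ^ 'd ^ 'd"
  proof -
    have XY: "\<exists>u\<in>F. norm (X ** word_product A u ** Y) \<ge> e * norm X * norm Y"
    proof (cases "X = 0 \<or> Y = 0")
      case True
      have "\<exists>u. u \<in> F"
        using unif[of "((1 / norm (mat 1 :: real ^ 'd ^ 'd)) *\<^sub>R mat 1, (1 / norm (mat 1 :: real ^ 'd ^ 'd)) *\<^sub>R mat 1)"]
          mat_one_nonzero[where 'd = 'd] by auto
      then show ?thesis using True by (auto simp: operator_norm_nonneg)
    next
      case False
      let ?p = "((1 / norm X) *\<^sub>R X, (1 / norm Y) *\<^sub>R Y)"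
      obtain u where u: "u \<in> F" "?g u ?p > e"
        using unif[of ?p] False by auto
      moreover have "?g u ?p = norm (X ** word_product A u ** Y) / (norm X * norm Y)"
        by (simp add: matrix_mult_scaleR field_simps)
      ultimately have "e * (norm X * norm Y) \<le> norm (X ** word_product A u ** Y)"
        using False by (simp add: pos_less_divide_eq less_imp_le)
      with u(1) show ?thesis by (auto simp: mult.assoc)
    qed
    then obtain u where u: "u \<in> F" "norm (X ** word_product A u ** Y) \<ge> e * norm X * norm Y" by blast
    have "e / c ^ 3 * operator_norm X * operator_norm Y = e / c ^ 3 * (operator_norm X * operator_norm Y)"
      by simp
    also have "\<dots> \<le> e / c ^ 3 * ((c * norm X) * (c * norm Y))"
      using F(3) c operator_norm_le_norm[of X] operator_norm_le_norm[of Y]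
      by (intro mult_left_mono mult_mono) (auto simp: c_def operator_norm_nonneg)
    also have "\<dots> = e * norm X * norm Y / c"
      using c by (simp add: power3_eq_cube field_simps)
    also have "\<dots> \<le> norm (X ** word_product A u ** Y) / c"
      using u(2) c by (simp add: divide_right_mono)
    also have "\<dots> \<le> operator_norm (X ** word_product A u ** Y)"
      using norm_le_operator_norm[of "X ** word_product A u ** Y"] c
      by (simp add: c_def field_simps)
    finally show ?thesis using u(1) by blast
  qed
  moreover have "e / c ^ 3 > 0" using F(3) c by simp
  ultimately show thesis using F that by blast
qed

lemma mat_power_rotate: "mat_power (P ** Q) (Suc k) = P ** mat_power (Q ** P) k ** Q"
  by (induction k) (simp_all add: matrix_mul_assoc)

text \<open>
  This is Levitzki's argument. Suppose that all $BX$ with $X \in T$ are nilpotent. Choose $Y \neq 0$ of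
  minimal rank among the matrices $X_1 B X_2$ with $X_1, X_2 \in T$. For $X \in T$ the matrix $YXY$ is
  again of this form, so it vanishes or has the same rank as $Y$. In the second case $YX$ maps the range of $Y$ onto itself;
  but cyclic rotation of the factors of $YX = X_1 B X_2 X$ gives the nilpotent matrix $B X_2 X X_1$, so
  $YX$ is nilpotent. Thus $YXY = 0$ for all $X \in T$. As the vectors $XYv$ span the whole space if
  $Yv \neq 0$, this forces $Y = 0$.
\<close>
lemma not_all_multiples_nilpotent:
  fixes B :: "real ^ 'd ^ 'd"
  assumes one: "mat 1 \<in> T" and mult: "\<And>X Y. X \<in> T \<Longrightarrow> Y \<in> T \<Longrightarrow> X ** Y \<in> T"
    and spans: "\<And>y. y \<noteq> 0 \<Longrightarrow> span ((\<lambda>X. X *v y) ` T) = UNIV"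
    and B: "B \<in> T" "B \<noteq> 0"
  shows "\<exists>X\<in>T. \<forall>k. mat_power (B ** X) k \<noteq> 0"
proof (rule ccontr)
  assume "\<not> ?thesis"
  then have nil: "\<exists>k. mat_power (B ** X) k = 0" if "X \<in> T" for X using that by blast
  define J where "J = {X1 ** B ** X2 |X1 X2. X1 \<in> T \<and> X2 \<in> T} - {0}"
  have "mat 1 ** B ** mat 1 \<in> J" using one B(2) by (force simp: J_def)
  then obtain Y where Y: "Y \<in> J" and min: "\<And>Z. Z \<in> J \<Longrightarrow> rank Y \<le> rank Z"
    using exists_least_iff[of "\<lambda>n. \<exists>Z\<in>J. rank Z = n"] by (metis not_le)
  obtain X1 X2 where X12: "Y = X1 ** B ** X2" "X1 \<in> T" "X2 \<in> T" using Y by (auto simp: J_def)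
  have YT: "Y \<in> T" using X12 mult B(1) by blast
  have Y0: "Y \<noteq> 0" using Y by (simp add: J_def)
  have cross: "Y ** X ** Y = 0" if X: "X \<in> T" for X
  proof (rule ccontr)
    assume nz: "Y ** X ** Y \<noteq> 0"
    have "Y ** X ** Y = (Y ** X ** X1) ** B ** X2"
      by (simp add: X12(1) matrix_mul_assoc)
    then have "Y ** X ** Y \<in> J"
      unfolding J_def using nz YT X X12(2,3) mult by blast
    then have rank: "rank Y \<le> rank (Y ** X ** Y)" by (rule min)
    let ?V = "range ((*v) Y)"
    have sub: "(*v) (Y ** X) ` ?V \<subseteq> ?V"
      by (auto simp flip: matrix_vector_mul_assoc)
    have eq: "(*v) (Y ** X) ` ?V = ?V"
    proof (rule subspace_dim_equal[OF _ _ sub])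
      show "subspace ?V" by (intro linear_subspace_image) auto
      then show "subspace ((*v) (Y ** X) ` ?V)" by (intro linear_subspace_image) auto
      have "(*v) (Y ** X) ` ?V = range ((*v) (Y ** X ** Y))"
        by (auto simp: matrix_vector_mul_assoc image_image)
      then show "dim ?V \<le> dim ((*v) (Y ** X) ` ?V)"
        using rank by (simp add: rank_dim_range)
    qed
    have iter: "(*v) (mat_power (Y ** X) k) ` ?V = ?V" for k
    proof (induction k)
      case (Suc k)
      have "(*v) (mat_power (Y ** X) (Suc k)) ` ?V = (*v) (Y ** X) ` ((*v) (mat_power (Y ** X) k) ` ?V)"
        by (simp add: image_image matrix_vector_mul_assoc matrix_mul_assoc)
      with Suc eq show ?case by simp
    qed auto
    have "X2 ** X ** X1 \<in> T" using X X12 mult by blast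
    then obtain k where k: "mat_power (B ** (X2 ** X ** X1)) k = 0" using nil by blast
    have "Y ** X = X1 ** (B ** (X2 ** X))" "B ** (X2 ** X ** X1) = (B ** (X2 ** X)) ** X1"
      by (simp_all add: X12(1) matrix_mul_assoc)
    then have "mat_power (Y ** X) (Suc k) = 0"
      using k by (simp only: mat_power_rotate) simp
    then have "(*v) (mat_power (Y ** X) (Suc k)) ` ?V \<subseteq> {0}"
      by (simp only:) auto
    then have "?V \<subseteq> {0}" using iter[of "Suc k"] by simp
    then have "Y *v x = 0" for x by auto
    then show False using Y0 by (simp add: matrix_eq)
  qed
  obtain v where v: "Y *v v \<noteq> 0" using Y0 by (metis matrix_eq matrix_vector_mult_0)
  have "Y *v z = 0" for z
  proof -
    have "z \<in> span ((\<lambda>X. X *v (Y *v v)) ` T)" using spans[OF v] by simp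
    then show ?thesis
    proof (induction rule: span_induct)
      case base
      show ?case by (auto simp: subspace_def matrix_vector_right_distrib matrix_vector_mult_scaleR)
    next
      case (step x)
      then obtain X where "X \<in> T" "x = X *v (Y *v v)" by blast
      then have "Y *v x = (Y ** X ** Y) *v v" "Y ** X ** Y = 0"
        using cross by (simp_all add: matrix_vector_mul_assoc matrix_mul_assoc)
      then show ?case by simp
    qed
  qed
  then show False using Y0 by (simp add: matrix_eq)
qed

text \<open>
  Let $T$ be the closure of the set of multiples of products. If $B \in T$ has norm one, then some
  $B A_u$ is not nilpotent by \<open>not_all_multiples_nilpotent\<close>, so that its $D$-th power does not
  vanish, where $D$ is the fixed exponent of \<open>mat_power_le_spectral_radius\<close>. By compactness of the
  set of these $B$, finitely many $u$ suffice and the norms of the powers are bounded below. The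
  estimate of that lemma turns this into a lower bound for the spectral radius.
\<close>
lemma spectral_radius_comparable_to_norm:
  fixes A :: "nat \<Rightarrow> real ^ 'd ^ 'd"
  assumes irr: "irreducible_tuple M A"
  obtains F e where "finite F" "F \<subseteq> lists {1..M}" "e > 0"
    "\<And>w. w \<in> lists {1..M} \<Longrightarrow>
      \<exists>u\<in>F. spectral_radius (word_product A (u @ w)) \<ge> e * operator_norm (word_product A w)"
proof -
  define D where "D = CARD('d) * CARD('d)"
  have D: "D > 0" by (simp add: D_def)
  define C where "C = {c *\<^sub>R word_product A u |c u. u \<in> lists {1..M}}"
  define T where "T = closure C"
  have in_T: "c *\<^sub>R word_product A u \<in> T" if "u \<in> lists {1..M}" for c u
    using that closure_subset[of C] by (auto simp: T_def C_def)
  have in_T': "word_product A u \<in> T" if "u \<in> lists {1..M}" for u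
    using in_T[OF that, of 1] by simp
  have one: "mat 1 \<in> T" using in_T'[of "[]"] by simp
  have mult: "X ** Y \<in> T" if XY: "X \<in> T" "Y \<in> T" for X Y
  proof -
    have "(\<lambda>p. fst p ** snd p) ` closure (C \<times> C) \<subseteq> T"
    proof (rule image_closure_subset)
      show "continuous_on (closure (C \<times> C)) (\<lambda>p. fst p ** snd p)" by (intro continuous_intros)
      show "closed T" by (simp add: T_def)
      show "(\<lambda>p. fst p ** snd p) ` (C \<times> C) \<subseteq> T"
      proof clarsimp
        fix X Y assume "X \<in> C" "Y \<in> C"
        then obtain c u d v where "X = c *\<^sub>R word_product A u" "Y = d *\<^sub>R word_product A v"
          "u \<in> lists {1..M}" "v \<in> lists {1..M}" by (auto simp: C_def)
        then have "X ** Y = (c * d) *\<^sub>R word_product A (v @ u)" "v @ u \<in> lists {1..M}"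
          by (auto simp: matrix_mult_scaleR word_product_append mult.commute)
        then show "X ** Y \<in> T" using in_T by simp
      qed
    qed
    then show ?thesis using XY by (force simp: closure_Times T_def)
  qed
  have spans: "span ((\<lambda>X. X *v y) ` T) = UNIV" if "y \<noteq> 0" for y
  proof -
    have "(\<lambda>u. word_product A u *v y) ` lists {1..M} \<subseteq> (\<lambda>X. X *v y) ` T"
      using in_T' by auto
    then show ?thesis using orbit_spans[OF irr that] span_mono by (metis top.extremum_uniqueI)
  qed
  define g where "g u B = norm (mat_power (B ** word_product A u) D)" for u B
  have comp: "compact (sphere 0 1 \<inter> T)"
    by (intro compact_Int_closed compact_sphere) (simp add: T_def)
  have cont: "continuous_on UNIV (g u)" if "u \<in> lists {1..M}" for u
    unfolding g_def by (intro continuous_intros continuous_on_mat_power)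
  have pos: "\<exists>u\<in>lists {1..M}. g u B > 0" if B: "B \<in> sphere 0 1 \<inter> T" for B
  proof (rule ccontr)
    assume "\<not> ?thesis"
    then have zero: "mat_power (B ** word_product A u) D = 0" if "u \<in> lists {1..M}" for u
      using that by (auto simp: g_def)
    have "(\<lambda>X. mat_power (B ** X) D) ` closure C \<subseteq> {0}"
    proof (rule image_closure_subset)
      show "continuous_on (closure C) (\<lambda>X. mat_power (B ** X) D)"
        by (intro continuous_intros continuous_on_mat_power)
      show "(\<lambda>X. mat_power (B ** X) D) ` C \<subseteq> {0}"
      proof clarify
        fix X assume "X \<in> C"
        then obtain c u where u: "X = c *\<^sub>R word_product A u" "u \<in> lists {1..M}"
          unfolding C_def by blast
        show "mat_power (B ** X) D = 0"
          unfolding u(1) matrix_mult_scaleR mat_power_scaleR zero[OF u(2)] by simp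
      qed
    qed simp
    then have "\<forall>X\<in>T. mat_power (B ** X) D = 0" by (auto simp: T_def)
    moreover have "\<exists>X\<in>T. \<forall>k. mat_power (B ** X) k \<noteq> 0"
      using B by (intro not_all_multiples_nilpotent one mult spans) auto
    ultimately show False by blast
  qed
  obtain F e where F: "finite F" "F \<subseteq> lists {1..M}" "e > 0"
    and unif: "\<And>B. B \<in> sphere 0 1 \<inter> T \<Longrightarrow> \<exists>u\<in>F. g u B > e"
    using compact_uniformly_positive[OF comp cont pos] by blast
  define L where "L = Max (insert 1 ((\<lambda>u. operator_norm (word_product A u)) ` F))"
  have L: "L \<ge> 1" and L_ge: "operator_norm (word_product A u) \<le> L" if "u \<in> F" for u
    unfolding L_def using F(1) that by auto
  have L1: "L \<ge> 1" unfolding L_def using F(1) by (intro Max_ge) auto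
  define c where "c = real D"
  have c: "c > 0" using D by (simp add: c_def)
  define e' where "e' = e / (c ^ (D + 2) * (2 * L) ^ (D - 1))"
  have e': "e' > 0" using F(3) c L1 by (simp add: e'_def)
  have "\<exists>u\<in>F. spectral_radius (word_product A (u @ w)) \<ge> e' * operator_norm (word_product A w)"
    if w: "w \<in> lists {1..M}" for w
  proof (cases "word_product A w = 0")
    case True
    have "word_product A [] \<noteq> 0"
      by (simp add: mat_one_nonzero)
    then have "(1 / norm (word_product A [])) *\<^sub>R word_product A [] \<in> sphere 0 1 \<inter> T"
      using in_T[of "[]"] by simp
    then show ?thesis using unif True
      by (metis mult_zero_right operator_norm_eq_0 spectral_radius_nonneg)
  next
    case False
    let ?W = "word_product A w"
    have "(1 / norm ?W) *\<^sub>R ?W \<in> sphere 0 1 \<inter> T"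
      using False in_T[OF w] by simp
    then obtain u where u: "u \<in> F" "e < g u ((1 / norm ?W) *\<^sub>R ?W)" using unif by blast
    define X where "X = ?W ** word_product A u"
    have X: "X = word_product A (u @ w)" by (simp add: X_def word_product_append)
    define a where "a = operator_norm ?W"
    have a: "a > 0" using False operator_norm_eq_0[of ?W] operator_norm_nonneg[of ?W] by (simp add: a_def less_le)
    have aX: "operator_norm X \<le> a * L"
      unfolding X_def using operator_norm_mult[of ?W "word_product A u"] L_ge[OF u(1)] a
      by (smt (verit) a_def mult_left_mono)
    have "e < norm (mat_power X D) / norm ?W ^ D"
      using u(2) by (simp add: g_def matrix_mult_scaleR mat_power_scaleR X_def power_divide)
    then have "e * norm ?W ^ D \<le> norm (mat_power X D)"
      using False by (simp add: field_simps)
    also have "\<dots> \<le> c * operator_norm (mat_power X D)"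
      unfolding c_def D_def by (rule norm_le_operator_norm)
    also have "\<dots> \<le> c * (spectral_radius X * c * (2 * operator_norm X) ^ (D - 1))"
      using c mat_power_le_spectral_radius[of X] unfolding c_def D_def by (intro mult_left_mono) auto
    also have "\<dots> \<le> c * (spectral_radius X * c * (2 * (a * L)) ^ (D - 1))"
      using c aX by (intro mult_left_mono power_mono) (auto simp: spectral_radius_nonneg operator_norm_nonneg)
    also have "\<dots> = spectral_radius X * (c ^ 2 * (2 * L) ^ (D - 1)) * a ^ (D - 1)"
      by (simp add: power_mult_distrib power2_eq_square)
    finally have 1: "e * norm ?W ^ D \<le> spectral_radius X * (c ^ 2 * (2 * L) ^ (D - 1)) * a ^ (D - 1)" .
    have "e * (a / c) ^ D \<le> e * norm ?W ^ D"
      using F(3) a c operator_norm_le_norm[of ?W]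
      by (intro mult_left_mono power_mono) (auto simp: a_def c_def D_def field_simps)
    with 1 have "e * (a / c) ^ D \<le> spectral_radius X * (c ^ 2 * (2 * L) ^ (D - 1)) * a ^ (D - 1)"
      by linarith
    moreover have "a ^ D = a * a ^ (D - 1)" using D by (metis Suc_diff_1 power_Suc)
    ultimately have "e * (a * a ^ (D - 1)) \<le> (spectral_radius X * (c ^ 2 * (2 * L) ^ (D - 1)) * a ^ (D - 1)) * c ^ D"
      using c by (simp only: power_divide pos_divide_le_eq zero_less_power times_divide_eq_right)
    also have "\<dots> = (spectral_radius X * (c ^ (D + 2) * (2 * L) ^ (D - 1))) * a ^ (D - 1)"
      unfolding power_add by (simp only: mult_ac)
    finally have "(e * a) * a ^ (D - 1) \<le> (spectral_radius X * (c ^ (D + 2) * (2 * L) ^ (D - 1))) * a ^ (D - 1)"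
      by (simp only: mult.assoc)
    then have "e * a \<le> spectral_radius X * (c ^ (D + 2) * (2 * L) ^ (D - 1))"
      using a by (simp only: mult_le_cancel_right zero_less_power)
    then have "e' * a \<le> spectral_radius X"
      using c L1 by (simp add: e'_def pos_divide_le_eq)
    then show ?thesis using u(1) X unfolding a_def by auto
  qed
  then show thesis using F e' that by blast
qed

section \<open>Entropy of functions with finitely many values\<close>

definition law :: "'a measure \<Rightarrow> ('a \<Rightarrow> 'c) \<Rightarrow> 'c \<Rightarrow> real" where
  "law M Z z = measure M (Z -` {z} \<inter> space M)"

definition shannon :: "'a measure \<Rightarrow> ('a \<Rightarrow> 'c) \<Rightarrow> real" where
  "shannon M Z = - (\<Sum>z\<in>Z ` space M. law M Z z * ln (law M Z z))"

lemma law_nonneg: "law M Z z \<ge> 0"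
  by (simp add: law_def)

lemma law_outside: "z \<notin> Z ` space M \<Longrightarrow> law M Z z = 0"
proof -
  assume "z \<notin> Z ` space M"
  then have "Z -` {z} \<inter> space M = {}" by auto
  then show ?thesis by (simp add: law_def)
qed

lemma shannon_cong:
  assumes "\<And>x. x \<in> space M \<Longrightarrow> Y x = Z x"
  shows "shannon M Y = shannon M Z"
proof -
  have "law M Y = law M Z"
    unfolding law_def using assms by (intro ext arg_cong[of _ _ "measure M"]) auto
  moreover have "Y ` space M = Z ` space M" using assms by (intro image_cong) auto
  ultimately show ?thesis unfolding shannon_def by simp
qed

context prob_space
begin

lemma law_le_1: "law M Z z \<le> 1"
  by (simp add: law_def)

lemma integral_simple:
  fixes g :: "'c \<Rightarrow> real"
  assumes Z: "simple_function M Z" and S: "finite S" "Z ` space M \<subseteq> S"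
  shows "(\<integral>x. g (Z x) \<partial>M) = (\<Sum>z\<in>S. law M Z z * g z)"
proof -
  have "(\<integral>x. g (Z x) \<partial>M) = (\<integral>x. (\<Sum>z\<in>S. indicator (Z -` {z} \<inter> space M) x * g z) \<partial>M)"
  proof (intro Bochner_Integration.integral_cong refl)
    fix x assume x: "x \<in> space M"
    have "(\<Sum>z\<in>S. indicator (Z -` {z} \<inter> space M) x * g z) = (\<Sum>z\<in>{Z x}. indicator (Z -` {z} \<inter> space M) x * g z)"
      using S x by (intro sum.mono_neutral_right) auto
    then show "g (Z x) = (\<Sum>z\<in>S. indicator (Z -` {z} \<inter> space M) x * g z)"
      using x by simp
  qed
  also have "\<dots> = (\<Sum>z\<in>S. law M Z z * g z)"
    using simple_functionD(2)[OF Z]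
    by (subst Bochner_Integration.integral_sum) (auto simp: law_def less_top[symmetric])
  finally show ?thesis .
qed

lemma sum_law:
  assumes "simple_function M Z" "finite S" "Z ` space M \<subseteq> S"
  shows "(\<Sum>z\<in>S. law M Z z) = 1"
  using integral_simple[OF assms, of "\<lambda>_. 1"] by (simp add: prob_space)

lemma shannon_altdef:
  assumes "finite S" "Z ` space M \<subseteq> S"
  shows "shannon M Z = - (\<Sum>z\<in>S. law M Z z * ln (law M Z z))"
  unfolding shannon_def using assms
  by (intro arg_cong[of _ _ uminus] sum.mono_neutral_left) (auto simp: law_outside)

lemma shannon_nonneg: "shannon M Z \<ge> 0"
proof -
  have "law M Z z * ln (law M Z z) \<le> 0" for z
    using law_nonneg[of M Z z] law_le_1[of Z z] by (cases "law M Z z = 0") (auto intro!: mult_nonneg_nonpos)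
  then show ?thesis unfolding shannon_def by (simp add: sum_nonpos)
qed

text \<open>
  The Gibbs inequality, from $\log x \leq x - 1$. It is stated for arbitrary nonnegative weights $q$,
  as it is applied both to probabilities and to weights with bounded sums.
\<close>
lemma shannon_le_cross_entropy:
  assumes Z: "simple_function M Z" and S: "finite S" "Z ` space M \<subseteq> S"
    and q: "\<And>z. z \<in> S \<Longrightarrow> q z \<ge> 0" "\<And>z. z \<in> S \<Longrightarrow> law M Z z > 0 \<Longrightarrow> q z > 0"
  shows "shannon M Z \<le> - (\<Sum>z\<in>S. law M Z z * ln (q z)) + (sum q S - 1)"
proof -
  have "- (law M Z z * ln (law M Z z)) \<le> - (law M Z z * ln (q z)) + (q z - law M Z z)" if z: "z \<in> S" for z
  proof (cases "law M Z z = 0")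
    case False
    then have p: "law M Z z > 0" using law_nonneg[of M Z z] by linarith
    then have qz: "q z > 0" using q(2) z by blast
    have "ln (q z / law M Z z) \<le> q z / law M Z z - 1"
      using p qz by (intro ln_le_minus_one) simp
    then have "law M Z z * (ln (q z) - ln (law M Z z)) \<le> law M Z z * (q z / law M Z z - 1)"
      using p qz by (intro mult_left_mono) (simp_all add: ln_div)
    also have "\<dots> = q z - law M Z z" using p by (simp add: field_simps)
    finally show ?thesis by (simp add: algebra_simps)
  qed (use q z in simp)
  then have "(\<Sum>z\<in>S. - (law M Z z * ln (law M Z z)))
      \<le> (\<Sum>z\<in>S. - (law M Z z * ln (q z)) + (q z - law M Z z))"
    by (rule sum_mono)
  then show ?thesis
    using sum_law[OF Z S] by (simp add: shannon_altdef[OF S] sum.distrib sum_subtractf sum_negf)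
qed

lemma shannon_comp_le:
  assumes Y: "simple_function M Y"
  shows "shannon M (\<lambda>x. F (Y x)) \<le> shannon M Y"
proof -
  let ?S = "Y ` space M" and ?Z = "\<lambda>x. F (Y x)"
  have S: "finite ?S" using Y by (simp add: simple_functionD)
  have Z: "simple_function M ?Z" using Y by (rule simple_function_compose1)
  have "(\<Sum>z\<in>F ` ?S. law M ?Z z * ln (law M ?Z z)) = (\<integral>x. ln (law M ?Z (F (Y x))) \<partial>M)"
    by (rule integral_simple[OF Z, symmetric]) (use S in auto)
  also have "\<dots> = (\<Sum>y\<in>?S. law M Y y * ln (law M ?Z (F y)))"
    using integral_simple[OF Y S, of "\<lambda>y. ln (law M ?Z (F y))"] by simp
  finally have "shannon M ?Z = - (\<Sum>y\<in>?S. law M Y y * ln (law M ?Z (F y)))"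
    using shannon_altdef[of "F ` ?S" ?Z] S by auto
  also have "\<dots> \<le> - (\<Sum>y\<in>?S. law M Y y * ln (law M Y y))"
  proof -
    have "law M Y y * ln (law M Y y) \<le> law M Y y * ln (law M ?Z (F y))" for y
    proof (cases "law M Y y = 0")
      case False
      then have "law M Y y > 0" using law_nonneg[of M Y y] by linarith
      moreover have "law M Y y \<le> law M ?Z (F y)"
        unfolding law_def using Z by (intro finite_measure_mono) (auto simp: simple_functionD)
      ultimately show ?thesis by (intro mult_left_mono) auto
    qed simp
    then show ?thesis by (simp add: sum_mono)
  qed
  finally show ?thesis by (simp add: shannon_def)
qed

lemma shannon_comp_inj:
  assumes Y: "simple_function M Y" and F: "inj_on F (Y ` space M)"
  shows "shannon M (\<lambda>x. F (Y x)) = shannon M Y"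
proof (rule antisym)
  show "shannon M (\<lambda>x. F (Y x)) \<le> shannon M Y" by (rule shannon_comp_le[OF Y])
  have "shannon M Y = shannon M (\<lambda>x. the_inv_into (Y ` space M) F (F (Y x)))"
    using F by (intro shannon_cong) (simp add: the_inv_into_f_f)
  also have "\<dots> \<le> shannon M (\<lambda>x. F (Y x))"
    using shannon_comp_le[OF simple_function_compose1[OF Y, of F], of "the_inv_into (Y ` space M) F"] by simp
  finally show "shannon M Y \<le> shannon M (\<lambda>x. F (Y x))" .
qed

lemma shannon_pair_le:
  assumes Y: "simple_function M Y" and Z: "simple_function M Z"
  shows "shannon M (\<lambda>x. (Y x, Z x)) \<le> shannon M Y + shannon M Z"
proof -
  let ?P = "\<lambda>x. (Y x, Z x)" and ?S = "Y ` space M \<times> Z ` space M"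
  let ?q = "\<lambda>(y, z). law M Y y * law M Z z"
  have P: "simple_function M ?P" using Y Z by (rule simple_function_Pair)
  have finY: "finite (Y ` space M)" and finZ: "finite (Z ` space M)"
    using Y Z by (simp_all add: simple_functionD)
  then have S: "finite ?S" "?P ` space M \<subseteq> ?S" by auto
  have pos: "law M Y y > 0 \<and> law M Z z > 0" if "law M ?P (y, z) > 0" for y z
  proof -
    have "law M ?P (y, z) \<le> law M Y y" "law M ?P (y, z) \<le> law M Z z"
      unfolding law_def using Y Z by (auto intro!: finite_measure_mono simp: simple_functionD)
    with that show ?thesis by linarith
  qed
  have "(\<Sum>p\<in>?S. law M ?P p * ln (?q p)) = (\<Sum>p\<in>?S. law M ?P p * (ln (law M Y (fst p)) + ln (law M Z (snd p))))"
  proof (rule sum.cong[OF refl])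
    fix p show "law M ?P p * ln (?q p) = law M ?P p * (ln (law M Y (fst p)) + ln (law M Z (snd p)))"
      using pos[of "fst p" "snd p"] law_nonneg[of M ?P p]
      by (cases p; cases "law M ?P p = 0") (auto simp: ln_mult)
  qed
  also have "\<dots> = (\<Sum>p\<in>?S. law M ?P p * ln (law M Y (fst p))) + (\<Sum>p\<in>?S. law M ?P p * ln (law M Z (snd p)))"
    by (simp add: distrib_left sum.distrib)
  also have "(\<Sum>p\<in>?S. law M ?P p * ln (law M Y (fst p))) = - shannon M Y"
    unfolding integral_simple[OF P S, symmetric]
    using integral_simple[OF Y finY order_refl, of "\<lambda>y. ln (law M Y y)"] by (simp add: shannon_def)
  also have "(\<Sum>p\<in>?S. law M ?P p * ln (law M Z (snd p))) = - shannon M Z"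
    unfolding integral_simple[OF P S, symmetric]
    using integral_simple[OF Z finZ order_refl, of "\<lambda>y. ln (law M Z y)"] by (simp add: shannon_def)
  finally have cross: "(\<Sum>p\<in>?S. law M ?P p * ln (?q p)) = - shannon M Y - shannon M Z" by simp
  have "sum ?q ?S = (\<Sum>y\<in>Y ` space M. law M Y y) * (\<Sum>z\<in>Z ` space M. law M Z z)"
    by (simp add: sum_product sum.cartesian_product)
  then have one: "sum ?q ?S = 1"
    using sum_law[OF Y finY order_refl] sum_law[OF Z finZ order_refl] by simp
  have "shannon M ?P \<le> - (\<Sum>p\<in>?S. law M ?P p * ln (?q p)) + (sum ?q ?S - 1)"
  proof (rule shannon_le_cross_entropy[OF P S])
    show "0 \<le> ?q p" if "p \<in> ?S" for p by (cases p) (simp add: law_nonneg)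
    show "0 < ?q p" if "p \<in> ?S" "0 < law M ?P p" for p
      using pos[of "fst p" "snd p"] that(2) by (cases p) simp
  qed
  then show ?thesis using cross one by simp
qed

end

section \<open>Blocks along orbits and entropy of partitions\<close>

locale measure_preserving_system = prob_space M for M :: "'a measure" +
  fixes T :: "'a \<Rightarrow> 'a"
  assumes measurable_T [measurable]: "T \<in> measurable M M"
    and distr_T: "distr M M T = M"
begin

lemma measurable_iterate [measurable]: "T ^^ k \<in> measurable M M"
  by (induction k) (auto intro!: measurable_comp[OF measurable_T, unfolded comp_def] simp: id_def comp_def)

lemma distr_iterate: "distr M M (T ^^ k) = M"
proof (induction k)
  case (Suc k)
  have "distr M M (T ^^ Suc k) = distr (distr M M (T ^^ k)) M T"
    by (subst distr_distr) auto
  then show ?case unfolding Suc distr_T .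
qed (simp add: distr_id id_def)

lemma iterate_in_space: "x \<in> space M \<Longrightarrow> (T ^^ k) x \<in> space M"
  using measurable_space[OF measurable_iterate] by blast

lemma measure_iterate_vimage:
  assumes "E \<in> sets M"
  shows "measure M ((T ^^ k) -` E \<inter> space M) = measure M E"
  using measure_distr[OF measurable_iterate assms, of k] by (simp add: distr_iterate)

lemma simple_function_iterate:
  assumes "simple_function M X"
  shows "simple_function M (\<lambda>x. X ((T ^^ k) x))"
proof -
  have "(\<lambda>x. X ((T ^^ k) x)) ` space M \<subseteq> X ` space M" using iterate_in_space by blast
  moreover have "(\<lambda>x. X ((T ^^ k) x)) -` {z} \<inter> space M \<in> sets M" for z
  proof -
    have "(\<lambda>x. X ((T ^^ k) x)) -` {z} \<inter> space M = (T ^^ k) -` (X -` {z} \<inter> space M) \<inter> space M"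
      using iterate_in_space by auto
    then show ?thesis
      using measurable_sets[OF measurable_iterate simple_functionD(2)[OF assms]]
      by (simp del: vimage_Int)
  qed
  ultimately show ?thesis
    using assms unfolding simple_function_def by (auto intro: finite_subset)
qed

lemma law_iterate:
  assumes "simple_function M X"
  shows "law M (\<lambda>x. X ((T ^^ k) x)) z = law M X z"
proof -
  have "(\<lambda>x. X ((T ^^ k) x)) -` {z} \<inter> space M = (T ^^ k) -` (X -` {z} \<inter> space M) \<inter> space M"
    using iterate_in_space by auto
  then show ?thesis
    using measure_iterate_vimage[OF simple_functionD(2)[OF assms]]
    by (simp add: law_def del: vimage_Int)
qed

lemma shannon_iterate:
  assumes X: "simple_function M X"
  shows "shannon M (\<lambda>x. X ((T ^^ k) x)) = shannon M X"
proof -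
  have "finite (X ` space M)" "(\<lambda>x. X ((T ^^ k) x)) ` space M \<subseteq> X ` space M"
    using X iterate_in_space by (auto simp: simple_functionD)
  then show ?thesis
    by (simp add: shannon_altdef[of "X ` space M"] law_iterate[OF X])
qed

text \<open>
  Blocks are restricted functions rather than lists, because the cells of \<^const>\<open>dynamical_join\<close> are
  indexed in this way and since sums of products over such functions factorise.
\<close>
definition block :: "('a \<Rightarrow> 'c) \<Rightarrow> nat \<Rightarrow> 'a \<Rightarrow> nat \<Rightarrow> 'c" where
  "block X n x = (\<lambda>k\<in>{..<n}. X ((T ^^ k) x))"

lemma block_in_PiE: "x \<in> space M \<Longrightarrow> block X n x \<in> PiE {..<n} (\<lambda>_. X ` space M)"
  using iterate_in_space by (auto simp: block_def)

lemma simple_function_block: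
  assumes X: "simple_function M X"
  shows "simple_function M (block X n)"
proof (induction n)
  case 0
  have "block X 0 = (\<lambda>_ _. undefined)" by (simp add: block_def fun_eq_iff)
  then show ?case by simp
next
  case (Suc n)
  have "block X (Suc n) = (\<lambda>x. (\<lambda>(c, a). c(n := a)) (block X n x, X ((T ^^ n) x)))"
    by (auto simp: block_def fun_eq_iff restrict_def less_Suc_eq)
  then show ?case
    using simple_function_compose1[OF simple_function_Pair[OF Suc simple_function_iterate[OF X]],
        where g = "\<lambda>(c, a). c(n := a)"] by (simp only:)
qed

lemma shannon_block_subadditive:
  fixes X :: "'a \<Rightarrow> 'c"
  assumes X: "simple_function M X"
  shows "shannon M (block X (m + n)) \<le> shannon M (block X m) + shannon M (block X n)"
proof -
  define F :: "(nat \<Rightarrow> 'c) \<times> (nat \<Rightarrow> 'c) \<Rightarrow> nat \<Rightarrow> 'c"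
    where "F = (\<lambda>(c, d). \<lambda>k\<in>{..<m + n}. if k < m then c k else d (k - m))"
  have "block X (m + n) x = F (block X m x, block X n ((T ^^ m) x))" for x
  proof
    fix k
    have "(T ^^ (k - m)) ((T ^^ m) x) = (T ^^ k) x" if "\<not> k < m"
      using that by (metis funpow_add le_add_diff_inverse2 not_less o_apply)
    then show "block X (m + n) x k = F (block X m x, block X n ((T ^^ m) x)) k"
      by (auto simp: block_def F_def restrict_def)
  qed
  then have "shannon M (block X (m + n)) = shannon M (\<lambda>x. F (block X m x, block X n ((T ^^ m) x)))"
    by presburger
  also have "\<dots> \<le> shannon M (\<lambda>x. (block X m x, block X n ((T ^^ m) x)))"
    by (intro shannon_comp_le simple_function_Pair simple_function_block X
        simple_function_iterate[of "block X n"])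
  also have "\<dots> \<le> shannon M (block X m) + shannon M (\<lambda>x. block X n ((T ^^ m) x))"
    by (intro shannon_pair_le simple_function_block X simple_function_iterate[of "block X n"])
  also have "shannon M (\<lambda>x. block X n ((T ^^ m) x)) = shannon M (block X n)"
    by (intro shannon_iterate simple_function_block X)
  finally show ?thesis .
qed

definition atom :: "'a set set \<Rightarrow> 'a \<Rightarrow> 'a set" where
  "atom \<xi> x = (THE C. C \<in> \<xi> \<and> x \<in> C)"

lemma atom_eq:
  assumes "finite_measurable_partition M \<xi>" "C \<in> \<xi>" "x \<in> C"
  shows "atom \<xi> x = C"
proof -
  have disj: "disjoint \<xi>" using assms(1) by (simp add: finite_measurable_partition_def partition_on_def)
  show ?thesis
    unfolding atom_def
  proof (rule the_equality)
    fix D assume D: "D \<in> \<xi> \<and> x \<in> D"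
    show "D = C"
    proof (rule ccontr)
      assume "D \<noteq> C"
      then have "D \<inter> C = {}" using disjointD[OF disj] D assms(2) by simp
      with D assms(3) show False by blast
    qed
  qed (use assms in simp)
qed

lemma atom_props:
  assumes "finite_measurable_partition M \<xi>" "x \<in> space M"
  shows "atom \<xi> x \<in> \<xi>" "x \<in> atom \<xi> x"
proof -
  obtain C where "C \<in> \<xi>" "x \<in> C"
    using assms by (auto simp: finite_measurable_partition_def partition_on_def)
  then show "atom \<xi> x \<in> \<xi>" "x \<in> atom \<xi> x"
    using atom_eq[OF assms(1)] by auto
qed

lemma simple_function_atom:
  assumes \<xi>: "finite_measurable_partition M \<xi>"
  shows "simple_function M (atom \<xi>)"
proof -
  have img: "atom \<xi> ` space M \<subseteq> \<xi>" using atom_props(1)[OF \<xi>] by blast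
  have fib: "atom \<xi> -` {C} \<inter> space M = C" if "C \<in> \<xi>" for C
  proof -
    have "C \<subseteq> space M"
      using that \<xi> sets.sets_into_space by (auto simp: finite_measurable_partition_def)
    then show ?thesis using that atom_eq[OF \<xi>] atom_props(2)[OF \<xi>] by auto
  qed
  have "finite \<xi>" "\<xi> \<subseteq> sets M" using \<xi> by (simp_all add: finite_measurable_partition_def)
  show ?thesis
    unfolding simple_function_def
  proof (intro conjI ballI)
    show "finite (atom \<xi> ` space M)" using img \<open>finite \<xi>\<close> by (rule finite_subset)
    fix C assume "C \<in> atom \<xi> ` space M"
    then have "C \<in> \<xi>" using img by blast
    then show "atom \<xi> -` {C} \<inter> space M \<in> sets M" using fib \<open>\<xi> \<subseteq> sets M\<close> by auto
  qed
qed

text \<open>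
  Different index functions may give the same cell only if the cell is empty, and the empty set does
  not contribute. So the entropy of the join is that of the block of atoms visited.
\<close>
lemma partition_entropy_dynamical_join:
  assumes \<xi>: "finite_measurable_partition M \<xi>"
  shows "partition_entropy M (dynamical_join M T \<xi> n) = shannon M (block (atom \<xi>) n)"
proof -
  let ?B = "block (atom \<xi>) n"
  define cell where "cell c = {x \<in> space M. \<forall>k<n. (T ^^ k) x \<in> c k}" for c
  have cell: "cell c = ?B -` {c} \<inter> space M" if c: "c \<in> PiE {..<n} (\<lambda>_. \<xi>)" for c
  proof -
    have A: "(T ^^ k) x \<in> c k \<longleftrightarrow> atom \<xi> ((T ^^ k) x) = c k" if "x \<in> space M" "k < n" for x k
    proof -
      have "c k \<in> \<xi>" using c that(2) by auto
      then show ?thesis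
        using atom_eq[OF \<xi>] atom_props(2)[OF \<xi> iterate_in_space[OF that(1), of k]] by auto
    qed
    have B: "?B x = c \<longleftrightarrow> (\<forall>k<n. atom \<xi> ((T ^^ k) x) = c k)" for x
    proof
      assume "\<forall>k<n. atom \<xi> ((T ^^ k) x) = c k"
      then show "?B x = c" using c by (auto simp: block_def fun_eq_iff restrict_def PiE_def extensional_def)
    next
      assume eq: "?B x = c"
      have "atom \<xi> ((T ^^ k) x) = ?B x k" if "k < n" for k using that by (simp add: block_def)
      then show "\<forall>k<n. atom \<xi> ((T ^^ k) x) = c k" unfolding eq by blast
    qed
    have "x \<in> cell c \<longleftrightarrow> x \<in> ?B -` {c} \<inter> space M" for x
      by (cases "x \<in> space M") (simp_all add: cell_def A B)
    then show ?thesis by blast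
  qed
  have img: "?B ` space M \<subseteq> PiE {..<n} (\<lambda>_. \<xi>)"
    using atom_props(1)[OF \<xi>] iterate_in_space by (auto simp: block_def)
  have fin: "finite (PiE {..<n} (\<lambda>_. \<xi>))"
    using \<xi> by (auto simp: finite_measurable_partition_def intro!: finite_PiE)
  have "inj_on cell (?B ` space M)"
  proof (rule inj_onI)
    fix c d assume cd: "c \<in> ?B ` space M" "d \<in> ?B ` space M" "cell c = cell d"
    then obtain x where "x \<in> space M" "c = ?B x" by blast
    then have "x \<in> cell d" using cell[of c] cd img by blast
    then show "c = d" using cell[of d] cd(2) img \<open>c = ?B x\<close> by blast
  qed
  then have "(\<Sum>C\<in>cell ` (?B ` space M). measure M C * ln (measure M C))
      = (\<Sum>c\<in>?B ` space M. measure M (cell c) * ln (measure M (cell c)))"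
    by (simp add: sum.reindex)
  also have "\<dots> = (\<Sum>c\<in>?B ` space M. law M ?B c * ln (law M ?B c))"
    using cell img by (intro sum.cong refl) (auto simp: law_def)
  also have "(\<Sum>C\<in>cell ` (?B ` space M). measure M C * ln (measure M C))
      = (\<Sum>C\<in>cell ` PiE {..<n} (\<lambda>_. \<xi>). measure M C * ln (measure M C))"
  proof (rule sum.mono_neutral_left)
    show "finite (cell ` PiE {..<n} (\<lambda>_. \<xi>))" using fin by simp
    show "cell ` (?B ` space M) \<subseteq> cell ` PiE {..<n} (\<lambda>_. \<xi>)" using img by blast
    show "\<forall>C\<in>cell ` PiE {..<n} (\<lambda>_. \<xi>) - cell ` (?B ` space M). measure M C * ln (measure M C) = 0"
    proof
      fix C assume "C \<in> cell ` PiE {..<n} (\<lambda>_. \<xi>) - cell ` (?B ` space M)"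
      then obtain c where "c \<in> PiE {..<n} (\<lambda>_. \<xi>)" "C = cell c" "c \<notin> ?B ` space M" by blast
      then have "C = {}" using cell[of c] by auto
      then show "measure M C * ln (measure M C) = 0" by simp
    qed
  qed
  finally show ?thesis
    unfolding partition_entropy_def dynamical_join_def shannon_def cell_def by simp
qed

lemma entropy_rate:
  assumes X: "simple_function M X"
  obtains h where "(\<lambda>n. shannon M (block X n) / real n) \<longlonglongrightarrow> h"
    "\<And>n. n \<ge> 1 \<Longrightarrow> h * real n \<le> shannon M (block X n)" "h \<ge> 0"
proof -
  have "0 * real n \<le> shannon M (block X n)" for n by (simp add: shannon_nonneg)
  from fekete_bounded_below[of "\<lambda>n. shannon M (block X n)", OF shannon_block_subadditive[OF X] this]
  show thesis using that by blast
qed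

lemma entropy_wrt_partition_eq:
  assumes "finite_measurable_partition M \<xi>"
    and "(\<lambda>n. shannon M (block (atom \<xi>) n) / real n) \<longlonglongrightarrow> h"
  shows "entropy_wrt_partition M T \<xi> = h"
  unfolding entropy_wrt_partition_def partition_entropy_dynamical_join[OF assms(1)]
  using assms(2) by (rule limI)

end

section \<open>Cylinder sets of the full shift\<close>

lemma topspace_full_shift: "topspace (full_shift M) = PiE UNIV (\<lambda>_. {1..M})"
  by (simp add: full_shift_def)

text \<open>
  The union of the cylinders of the words in $W$ of length $n$. As $W$ is arbitrary, sets of this form
  with a common $n$ are closed under Boolean operations.
\<close>
definition cylset :: "nat \<Rightarrow> nat \<Rightarrow> nat list set \<Rightarrow> (nat \<Rightarrow> nat) set" where
  "cylset M n W = {x \<in> topspace (full_shift M). map x [0..<n] \<in> W}"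

lemma mem_full_shift: "x \<in> topspace (full_shift M) \<longleftrightarrow> (\<forall>n. x n \<in> {1..M})"
  by (auto simp: topspace_full_shift PiE_UNIV_domain)

lemma finite_words: "finite (words M n)"
  unfolding words_def using finite_lists_length_eq[of "{1..M}" n] by (simp add: conj_commute)

lemma map_in_words: "x \<in> topspace (full_shift M) \<Longrightarrow> map x [0..<n] \<in> words M n"
  by (auto simp: words_def mem_full_shift)

lemma openin_cylset: "openin (full_shift M) (cylset M n W)"
  unfolding full_shift_def openin_product_topology_alt
proof
  fix x assume x: "x \<in> cylset M n W"
  define U where "U i = (if i < n then {x i} else {1..M})" for i
  have "{i \<in> UNIV. U i \<noteq> topspace (discrete_topology {1..M})} \<subseteq> {..<n}"
    by (auto simp: U_def split: if_splits)
  then have "finite {i \<in> UNIV. U i \<noteq> topspace (discrete_topology {1..M})}"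
    using finite_subset by blast
  moreover have "\<forall>i\<in>UNIV. openin (discrete_topology {1..M}) (U i)"
    using x by (auto simp: U_def cylset_def mem_full_shift)
  moreover have "x \<in> PiE UNIV U"
    using x by (auto simp: U_def PiE_UNIV_domain cylset_def mem_full_shift)
  moreover have "PiE UNIV U \<subseteq> cylset M n W"
  proof
    fix y assume y: "y \<in> PiE UNIV U"
    have yU: "y i \<in> U i" for i using y by (auto simp: PiE_UNIV_domain)
    have "y i = x i" if "i < n" for i using yU[of i] that by (simp add: U_def)
    then have yx: "map y [0..<n] = map x [0..<n]" by simp
    have "y i \<in> {1..M}" for i
    proof (cases "i < n")
      case True
      then show ?thesis using yU[of i] x by (auto simp: U_def cylset_def mem_full_shift)
    next
      case False
      then show ?thesis using yU[of i] by (simp add: U_def)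
    qed
    then show "y \<in> cylset M n W" using x unfolding cylset_def mem_full_shift yx mem_Collect_eq by blast
  qed
  ultimately show "\<exists>U. finite {i \<in> UNIV. U i \<noteq> topspace (discrete_topology {1..M})} \<and>
      (\<forall>i\<in>UNIV. openin (discrete_topology {1..M}) (U i)) \<and> x \<in> PiE UNIV U \<and> PiE UNIV U \<subseteq> cylset M n W"
    by blast
qed

lemma open_full_shift_contains_cylinder:
  assumes U: "openin (full_shift M) U" and x: "x \<in> U"
  shows "\<exists>n. cylset M n {map x [0..<n]} \<subseteq> U"
proof -
  obtain V where V: "finite {i. V i \<noteq> {1..M}}" "x \<in> PiE UNIV V" "PiE UNIV V \<subseteq> U"
    using U x unfolding full_shift_def openin_product_topology_alt by fastforce
  obtain n where n: "\<And>i. V i \<noteq> {1..M} \<Longrightarrow> i < n"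
    using V(1) by (metis (mono_tags, lifting) bounded_nat_set_is_finite finite_nat_bounded lessThan_iff mem_Collect_eq subsetD)
  have "cylset M n {map x [0..<n]} \<subseteq> PiE UNIV V"
  proof
    fix y assume y: "y \<in> cylset M n {map x [0..<n]}"
    have "y i \<in> V i" for i
    proof (cases "i < n")
      case True
      then have "y i = x i" using y by (auto simp: cylset_def)
      then show ?thesis using V(2) by (simp add: PiE_UNIV_domain Pi_iff)
    next
      case False
      then have "V i = {1..M}" using n by blast
      then show ?thesis using y by (simp add: cylset_def mem_full_shift)
    qed
    then show "y \<in> PiE UNIV V" by (simp add: PiE_UNIV_domain)
  qed
  with V(3) show ?thesis by blast
qed

definition cylsets :: "nat \<Rightarrow> (nat \<Rightarrow> nat) set set" where
  "cylsets M = {cylset M n W |n W. True}"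

lemma space_full_shift_borel: "space (full_shift_borel M) = topspace (full_shift M)"
proof -
  have "{U. openin (full_shift M) U} \<subseteq> Pow (topspace (full_shift M))" using openin_subset by auto
  then show ?thesis by (simp add: full_shift_borel_def space_measure_of)
qed

lemma sets_full_shift_borel: "sets (full_shift_borel M) = sigma_sets (topspace (full_shift M)) (cylsets M)"
proof -
  let ?O = "topspace (full_shift M)"
  have "sets (full_shift_borel M) = sigma_sets ?O {U. openin (full_shift M) U}"
    unfolding full_shift_borel_def using openin_subset by (intro sets_measure_of) auto
  also have "\<dots> = sigma_sets ?O (cylsets M)"
  proof (rule sigma_sets_eqI)
    fix U assume "U \<in> {U. openin (full_shift M) U}"
    then have U: "openin (full_shift M) U" by simp
    define I where "I = {(n, w). cylset M n {w} \<subseteq> U}"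
    have "U = (\<Union>(n, w)\<in>I. cylset M n {w})"
    proof (intro equalityI subsetI)
      fix x assume x: "x \<in> U"
      then obtain n where "cylset M n {map x [0..<n]} \<subseteq> U"
        using open_full_shift_contains_cylinder[OF U] by blast
      moreover have "x \<in> cylset M n {map x [0..<n]}"
        using x openin_subset[OF U] by (auto simp: cylset_def)
      ultimately show "x \<in> (\<Union>(n, w)\<in>I. cylset M n {w})" by (auto simp: I_def)
    qed (auto simp: I_def)
    moreover have "(\<Union>(n, w)\<in>I. cylset M n {w}) \<in> sigma_sets ?O (cylsets M)"
    proof (rule sigma_algebra.countable_UN'')
      show "sigma_algebra ?O (sigma_sets ?O (cylsets M))"
        by (intro sigma_algebra_sigma_sets) (auto simp: cylsets_def cylset_def)
    qed (auto simp: cylsets_def split: prod.splits intro!: sigma_sets.Basic)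
    ultimately show "U \<in> sigma_sets ?O (cylsets M)" by simp
  next
    fix U assume "U \<in> cylsets M"
    then show "U \<in> sigma_sets ?O {U. openin (full_shift M) U}"
      using openin_cylset by (auto simp: cylsets_def)
  qed
  finally show ?thesis .
qed

lemma cylset_extend:
  assumes "n \<le> n'"
  shows "cylset M n W = cylset M n' {w. take n w \<in> W}"
  using assms by (auto simp: cylset_def take_map)

lemma cylset_refine2:
  obtains n V V' where "cylset M m W = cylset M n V" "cylset M m' W' = cylset M n V'"
  using cylset_extend[of m "max m m'" M W] cylset_extend[of m' "max m m'" M W'] that by auto

lemma algebra_cylsets: "algebra (topspace (full_shift M)) (cylsets M)"
  unfolding algebra_iff_Un
proof (intro conjI ballI)
  show "cylsets M \<subseteq> Pow (topspace (full_shift M))" by (auto simp: cylsets_def cylset_def)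
  have "{} = cylset M 0 {}" by (simp add: cylset_def)
  then show "{} \<in> cylsets M" unfolding cylsets_def by blast
next
  fix U assume "U \<in> cylsets M"
  then obtain n W where "U = cylset M n W" by (auto simp: cylsets_def)
  then have "topspace (full_shift M) - U = cylset M n (- W)" by (auto simp: cylset_def)
  then show "topspace (full_shift M) - U \<in> cylsets M" unfolding cylsets_def by blast
next
  fix U V assume "U \<in> cylsets M" "V \<in> cylsets M"
  then obtain n W n' W' where "U = cylset M n W" "V = cylset M n' W'" by (auto simp: cylsets_def)
  then obtain k X X' where "U = cylset M k X" "V = cylset M k X'" using cylset_refine2 by metis
  then have "U \<union> V = cylset M k (X \<union> X')" by (auto simp: cylset_def)
  then show "U \<union> V \<in> cylsets M" unfolding cylsets_def by blast
qed

text \<open>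
  The sets that can be approximated form a $\sigma$-algebra. Two measures are treated simultaneously,
  since absolute continuity compares the measures of one and the same approximating set.
\<close>
lemma approx_by_algebra:
  assumes alg: "algebra \<Omega> \<A>"
    and N: "finite_measure N" "sets N = sigma_sets \<Omega> \<A>"
    and N': "finite_measure N'" "sets N' = sigma_sets \<Omega> \<A>"
    and G: "G \<in> sets N" and e: "e > 0"
  shows "\<exists>U\<in>\<A>. measure N (sym_diff G U) + measure N' (sym_diff G U) < e"
proof -
  interpret N: finite_measure N by fact
  interpret N': finite_measure N' by fact
  interpret algebra \<Omega> \<A> by fact
  define d where "d U = measure N U + measure N' U" for U
  have sets_eq: "sets N' = sets N" using N(2) N'(2) by simp
  have d_mono: "d U \<le> d V" if "U \<subseteq> V" "V \<in> sets N" for U V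
    unfolding d_def using that by (intro add_mono N.finite_measure_mono N'.finite_measure_mono) (simp_all add: sets_eq)
  have d_Un: "d (U \<union> V) \<le> d U + d V" if "U \<in> sets N" "V \<in> sets N" for U V
    using measure_Un_le[of U N V] measure_Un_le[of U N' V] that by (simp add: d_def sets_eq)
  have d_UN: "d (\<Union>i\<le>n. U i) \<le> (\<Sum>i\<le>n. d (U i))" if "\<And>i. U i \<in> sets N" for U :: "nat \<Rightarrow> _" and n :: nat
  proof (induction n)
    case (Suc n)
    have "d (\<Union>i\<le>Suc n. U i) = d ((\<Union>i\<le>n. U i) \<union> U (Suc n))"
      by (simp add: atMost_Suc Un_commute)
    also have "\<dots> \<le> d (\<Union>i\<le>n. U i) + d (U (Suc n))"
      using that by (intro d_Un sets.finite_UN) auto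
    finally show ?case using Suc by simp
  qed simp
  have A_sets: "U \<in> sets N" if "U \<in> \<A>" for U using that N(2) by auto
  have "G \<in> sigma_sets \<Omega> \<A>" using G N(2) by simp
  then have "\<exists>U\<in>\<A>. d (sym_diff G U) < e" using e
  proof (induction arbitrary: e rule: sigma_sets.induct)
    case (Basic a)
    then show ?case by (intro bexI[of _ a]) (auto simp: d_def)
  next
    case Empty
    then show ?case by (intro bexI[of _ "{}"]) (auto simp: d_def)
  next
    case (Compl a)
    then obtain U where U: "U \<in> \<A>" "d (sym_diff a U) < e" by blast
    have "a \<subseteq> \<Omega>" using Compl(1) space_closed sigma_sets_into_sp by blast
    then have "sym_diff (\<Omega> - a) (\<Omega> - U) = sym_diff a U"
      using U(1) space_closed by blast
    with U show ?case by (intro bexI[of _ "\<Omega> - U"]) auto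
  next
    case (Union a)
    have a: "a i \<in> sets N" for i using Union(1) N(2) by simp
    have lim: "(\<lambda>n. measure L (\<Union>i\<le>n. a i)) \<longlonglongrightarrow> measure L (\<Union>i. a i)"
      if "finite_measure L" "sets L = sets N" for L
    proof -
      interpret L: finite_measure L by fact
      have "(\<lambda>n. measure L (\<Union>i\<le>n. a i)) \<longlonglongrightarrow> measure L (\<Union>n. \<Union>i\<le>n. a i)"
        using a that(2) by (intro L.finite_Lim_measure_incseq) (auto simp: incseq_def intro: order_trans)
      moreover have "(\<Union>n. \<Union>i\<le>n. a i) = (\<Union>i. a i)" by auto
      ultimately show ?thesis by simp
    qed
    have "(\<lambda>n. d (\<Union>i\<le>n. a i)) \<longlonglongrightarrow> d (\<Union>i. a i)"
      unfolding d_def using lim[OF N(1)] lim[OF N'(1) sets_eq] by (intro tendsto_add) auto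
    then have "\<forall>\<^sub>F n in sequentially. d (\<Union>i. a i) - e / 2 < d (\<Union>i\<le>n. a i)"
      using Union.prems by (intro order_tendstoD) auto
    then obtain n where n: "d (\<Union>i. a i) - e / 2 < d (\<Union>i\<le>n. a i)"
      by (auto simp: eventually_sequentially)
    define r where "r = e / (2 * real (Suc n))"
    have "r > 0" using Union.prems by (simp add: r_def)
    then have "\<exists>U\<in>\<A>. d (sym_diff (a i) U) < r" for i using Union.IH by blast
    then obtain U where U: "\<And>i. U i \<in> \<A>" "\<And>i. d (sym_diff (a i) (U i)) < r" by metis
    have U_sets: "U i \<in> sets N" for i using A_sets U(1) by blast
    have S: "(\<Union>i\<le>n. U i) \<in> \<A>" using U(1) by auto
    have un_a: "(\<Union>i\<le>n. a i) \<in> sets N" "(\<Union>i. a i) \<in> sets N" using a by auto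
    have "d (sym_diff (\<Union>i. a i) (\<Union>i\<le>n. U i))
        \<le> d (((\<Union>i. a i) - (\<Union>i\<le>n. a i)) \<union> (\<Union>i\<le>n. sym_diff (a i) (U i)))"
      using a U_sets un_a by (intro d_mono) auto
    also have "\<dots> \<le> d ((\<Union>i. a i) - (\<Union>i\<le>n. a i)) + d (\<Union>i\<le>n. sym_diff (a i) (U i))"
      using a U_sets un_a by (intro d_Un) auto
    also have "d ((\<Union>i. a i) - (\<Union>i\<le>n. a i)) = d (\<Union>i. a i) - d (\<Union>i\<le>n. a i)"
    proof -
      have "(\<Union>i\<le>n. a i) \<subseteq> (\<Union>i. a i)" by auto
      then show ?thesis
        using un_a unfolding d_def
        by (simp add: N.finite_measure_Diff N'.finite_measure_Diff sets_eq)
    qed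
    also have "d (\<Union>i\<le>n. sym_diff (a i) (U i)) \<le> (\<Sum>i\<le>n. d (sym_diff (a i) (U i)))"
      using a U_sets by (intro d_UN) auto
    also have "\<dots> \<le> (\<Sum>i\<le>n. r)" using U(2) by (intro sum_mono less_imp_le)
    also have "\<dots> = e / 2" by (simp add: r_def field_simps)
    finally show ?case using n S by (intro bexI[of _ "\<Union>i\<le>n. U i"]) auto
  qed
  then show ?thesis by (simp add: d_def)
qed

lemma approx_by_cylset_two_measures:
  assumes "finite_measure N" "sets N = sets (full_shift_borel M)"
    and "finite_measure N'" "sets N' = sets (full_shift_borel M)" and "G \<in> sets N" "e > 0"
  obtains n W where "measure N (sym_diff G (cylset M n W)) + measure N' (sym_diff G (cylset M n W)) < e"
  using approx_by_algebra[OF algebra_cylsets, of N M N' G e] assms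
  unfolding sets_full_shift_borel cylsets_def by auto

lemma approx_by_cylset:
  assumes "finite_measure N" "sets N = sets (full_shift_borel M)" "G \<in> sets N" "e > 0"
  obtains n W where "measure N (sym_diff G (cylset M n W)) < e"
proof (rule approx_by_cylset_two_measures[OF assms(1,2) assms(1-4)])
  fix n W
  assume "measure N (sym_diff G (cylset M n W)) + measure N (sym_diff G (cylset M n W)) < e"
  then have "measure N (sym_diff G (cylset M n W)) < e"
    using measure_nonneg[of N "sym_diff G (cylset M n W)"] by linarith
  then show thesis by (rule that)
qed

section \<open>Invariant measures on the full shift and their entropy\<close>

abbreviation initial :: "nat \<Rightarrow> (nat \<Rightarrow> 'a) \<Rightarrow> 'a list" where
  "initial n x \<equiv> map x [0..<n]"

definition cyl_prob :: "(nat \<Rightarrow> nat) measure \<Rightarrow> nat list \<Rightarrow> real" where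
  "cyl_prob \<nu> w = law \<nu> (initial (length w)) w"

lemma nth_words: "w \<in> words M n \<Longrightarrow> k < n \<Longrightarrow> w ! k \<in> {1..M}"
  unfolding words_def by (metis (mono_tags, lifting) mem_Collect_eq nth_mem subsetD)

lemma shift_iterate: "(shift ^^ k) x = (\<lambda>n. x (n + k))"
  by (induction k) (auto simp: shift_def)

lemma initial_add: "initial (m + n) x = initial m x @ initial n ((shift ^^ m) x)"
  unfolding shift_iterate by (intro nth_equalityI) (auto simp: nth_append)

lemma initial_window: "k + n \<le> m \<Longrightarrow> take n (drop k (initial m x)) = initial n ((shift ^^ k) x)"
  unfolding shift_iterate by (intro nth_equalityI) (auto simp: add.commute)

lemma shift_in_full_shift: "x \<in> topspace (full_shift M) \<Longrightarrow> shift x \<in> topspace (full_shift M)"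
  by (simp add: mem_full_shift shift_def)

lemma measurable_shift_full_shift:
  assumes sets: "sets N = sets (full_shift_borel M)"
  shows "shift \<in> measurable N N"
proof -
  have sp: "space N = topspace (full_shift M)"
    using sets_eq_imp_space_eq[OF sets] by (simp add: space_full_shift_borel)
  show ?thesis
  proof (rule measurable_sigma_sets)
    show "sets N = sigma_sets (topspace (full_shift M)) (cylsets M)"
      using sets by (simp add: sets_full_shift_borel)
    show "cylsets M \<subseteq> Pow (topspace (full_shift M))" by (auto simp: cylsets_def cylset_def)
    show "shift \<in> space N \<rightarrow> topspace (full_shift M)" using shift_in_full_shift sp by auto
    fix U assume "U \<in> cylsets M"
    then obtain n W where U: "U = cylset M n W" by (auto simp: cylsets_def)
    have "initial (Suc n) x = x 0 # initial n (shift x)" for x :: "nat \<Rightarrow> nat"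
      using initial_add[where m = 1 and n = n and x = x] by (simp add: shift_iterate shift_def)
    then have "shift -` U \<inter> space N = cylset M (Suc n) {w. tl w \<in> W}"
      unfolding U cylset_def sp using shift_in_full_shift by (auto simp del: upt_Suc)
    then show "shift -` U \<inter> space N \<in> sets N"
      unfolding sets sets_full_shift_borel by (auto simp: cylsets_def)
  qed
qed

locale shift_invariant =
  fixes M :: nat and \<nu> :: "(nat \<Rightarrow> nat) measure"
  assumes invariant: "\<nu> \<in> invariant_measures M"
begin

lemma sets_\<nu>: "sets \<nu> = sets (full_shift_borel M)"
  using invariant by (simp add: invariant_measures_def)

sublocale measure_preserving_system \<nu> shift
  using invariant measurable_shift_full_shift[OF sets_\<nu>]
  by (auto simp: measure_preserving_system_def measure_preserving_system_axioms_def invariant_measures_def)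

lemma space_\<nu>: "space \<nu> = topspace (full_shift M)"
  using sets_eq_imp_space_eq[OF sets_\<nu>] by (simp add: space_full_shift_borel)

lemma cylset_sets [simp, intro]: "cylset M n W \<in> sets \<nu>"
  unfolding sets_\<nu> sets_full_shift_borel by (auto simp: cylsets_def)

lemma initial_in_words: "x \<in> space \<nu> \<Longrightarrow> initial n x \<in> words M n"
  by (simp add: space_\<nu> map_in_words)

lemma initial_vimage: "initial n -` W \<inter> space \<nu> = cylset M n W"
  by (auto simp: cylset_def space_\<nu>)

lemma simple_function_initial: "simple_function \<nu> (initial n)"
  unfolding simple_function_def
proof
  show "finite (initial n ` space \<nu>)"
    by (rule finite_subset[OF _ finite_words[of M n]]) (auto intro: initial_in_words)
qed (use initial_vimage in auto)

lemma law_initial: "w \<in> words M n \<Longrightarrow> law \<nu> (initial n) w = cyl_prob \<nu> w"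
  by (simp add: cyl_prob_def words_def)

lemma cyl_prob_altdef: "cyl_prob \<nu> w = measure \<nu> (cylset M (length w) {w})"
  by (simp add: cyl_prob_def law_def initial_vimage)

lemma cyl_prob_nonneg: "cyl_prob \<nu> w \<ge> 0"
  by (simp add: cyl_prob_altdef)

lemma integral_initial:
  fixes g :: "nat list \<Rightarrow> real"
  shows "(\<integral>x. g (initial n x) \<partial>\<nu>) = (\<Sum>w\<in>words M n. cyl_prob \<nu> w * g w)"
  using integral_simple[OF simple_function_initial[of n] finite_words[of M n], of g] initial_in_words
  by (auto simp: law_initial)

lemma integrable_initial:
  fixes g :: "nat list \<Rightarrow> real"
  shows "integrable \<nu> (\<lambda>x. g (initial n x))"
proof -
  have "simple_function \<nu> (\<lambda>x. g (initial n x))"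
    by (rule simple_function_compose1[OF simple_function_initial])
  then show ?thesis by (rule integrable_simple_function) simp
qed

lemma integral_iterate:
  fixes f :: "(nat \<Rightarrow> nat) \<Rightarrow> real"
  assumes "f \<in> borel_measurable \<nu>"
  shows "(\<integral>x. f ((shift ^^ k) x) \<partial>\<nu>) = (\<integral>x. f x \<partial>\<nu>)"
  using integral_distr[OF measurable_iterate assms, of k] by (simp add: distr_iterate)

lemma measure_cylset: "measure \<nu> (cylset M n W) = (\<Sum>w\<in>words M n \<inter> W. cyl_prob \<nu> w)"
proof -
  have "measure \<nu> (cylset M n W) = (\<integral>x. indicator W (initial n x) \<partial>\<nu>)"
  proof -
    have "(\<integral>x. indicator W (initial n x) \<partial>\<nu>) = (\<integral>x. indicator (cylset M n W) x \<partial>\<nu>)"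
      by (intro Bochner_Integration.integral_cong) (auto simp: cylset_def space_\<nu> indicator_def)
    also have "\<dots> = measure \<nu> (cylset M n W \<inter> space \<nu>)" by simp
    also have "cylset M n W \<inter> space \<nu> = cylset M n W" by (auto simp: cylset_def space_\<nu>)
    finally show ?thesis by simp
  qed
  also have "\<dots> = (\<Sum>w\<in>words M n. cyl_prob \<nu> w * indicator W w)"
    by (rule integral_initial)
  also have "\<dots> = (\<Sum>w\<in>words M n \<inter> W. cyl_prob \<nu> w)"
    by (auto simp: indicator_def sum.inter_restrict[OF finite_words] intro!: sum.cong)
  finally show ?thesis .
qed

lemma sum_cyl_prob: "(\<Sum>w\<in>words M n. cyl_prob \<nu> w) = 1"
  using integral_initial[of "\<lambda>_. 1" n] by (simp add: prob_space)

lemma AE_cyl_prob_pos: "AE x in \<nu>. cyl_prob \<nu> (initial n x) > 0"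
proof (rule AE_I)
  show "{x \<in> space \<nu>. \<not> cyl_prob \<nu> (initial n x) > 0} \<subseteq> cylset M n {w. cyl_prob \<nu> w = 0}"
    using cyl_prob_nonneg by (auto simp: cylset_def space_\<nu> not_less intro: antisym)
  have "measure \<nu> (cylset M n {w. cyl_prob \<nu> w = 0}) = 0"
    unfolding measure_cylset by (intro sum.neutral) auto
  then show "emeasure \<nu> (cylset M n {w. cyl_prob \<nu> w = 0}) = 0" by (simp add: emeasure_eq_measure)
qed simp

definition word_entropy :: "nat \<Rightarrow> real" where
  "word_entropy n = shannon \<nu> (initial n)"

lemma word_entropy_eq: "word_entropy n = - (\<Sum>w\<in>words M n. cyl_prob \<nu> w * ln (cyl_prob \<nu> w))"
  unfolding word_entropy_def
  using shannon_altdef[OF finite_words, of "initial n" M n] initial_in_words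
  by (auto simp: law_initial)

lemma word_entropy_subadditive: "word_entropy (m + n) \<le> word_entropy m + word_entropy n"
proof -
  have "shannon \<nu> (initial (m + n)) = shannon \<nu> (\<lambda>x. (\<lambda>(u, v). u @ v) (initial m x, initial n ((shift ^^ m) x)))"
    by (simp add: initial_add)
  also have "\<dots> \<le> shannon \<nu> (\<lambda>x. (initial m x, initial n ((shift ^^ m) x)))"
    by (intro shannon_comp_le simple_function_Pair simple_function_initial
        simple_function_iterate[of "initial n"])
  also have "\<dots> \<le> shannon \<nu> (initial m) + shannon \<nu> (\<lambda>x. initial n ((shift ^^ m) x))"
    by (intro shannon_pair_le simple_function_initial simple_function_iterate[of "initial n"])
  also have "shannon \<nu> (\<lambda>x. initial n ((shift ^^ m) x)) = shannon \<nu> (initial n)"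
    by (rule shannon_iterate[OF simple_function_initial])
  finally show ?thesis by (simp add: word_entropy_def)
qed

lemma word_entropy_nonneg: "word_entropy n \<ge> 0"
  by (simp add: word_entropy_def shannon_nonneg)

definition word_entropy_rate :: real where
  "word_entropy_rate = lim (\<lambda>n. word_entropy n / real n)"

lemma word_entropy_rate:
  shows "(\<lambda>n. word_entropy n / real n) \<longlonglongrightarrow> word_entropy_rate"
    and "word_entropy_rate * real n \<le> word_entropy n"
proof -
  have "0 * real n \<le> word_entropy n" for n by (simp add: word_entropy_nonneg)
  from fekete_bounded_below[of word_entropy, OF word_entropy_subadditive this]
  obtain L where L: "(\<lambda>n. word_entropy n / real n) \<longlonglongrightarrow> L"
    "\<And>n. n \<ge> 1 \<Longrightarrow> L * real n \<le> word_entropy n" by blast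
  then have "word_entropy_rate = L" unfolding word_entropy_rate_def by (intro limI)
  then show "(\<lambda>n. word_entropy n / real n) \<longlonglongrightarrow> word_entropy_rate"
    and "word_entropy_rate * real n \<le> word_entropy n"
    using L word_entropy_nonneg by (cases "n = 0"; simp)+
qed

text \<open>
  Approximate each level set by a cylinder set of a common length $N$. Where $X$ and the resulting
  prediction differ, the point lies in the symmetric difference of a level set and its approximation.
\<close>
lemma approx_simple_function:
  assumes X: "simple_function \<nu> X" and e: "e > 0"
  obtains N l where "\<And>w. l w \<in> X ` space \<nu>"
    "measure \<nu> {x \<in> space \<nu>. X x \<noteq> l (initial N x)} \<le> e"
proof -
  let ?L = "X ` space \<nu>"
  define r where "r = real (card ?L)"
  have finL: "finite ?L" using X by (simp add: simple_functionD)
  have "?L \<noteq> {}" using not_empty by simp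
  then have r: "r > 0" unfolding r_def using finL by (simp add: card_gt_0_iff)
  define G where "G i = X -` {i} \<inter> space \<nu>" for i
  have G: "G i \<in> sets \<nu>" for i using X by (simp add: G_def simple_functionD)
  have "\<exists>n W. measure \<nu> (sym_diff (G i) (cylset M n W)) < e / r" for i
    using approx_by_cylset[OF finite_measure_axioms sets_\<nu> G] e r by (metis divide_pos_pos)
  then obtain n W where nW: "\<And>i. measure \<nu> (sym_diff (G i) (cylset M (n i) (W i))) < e / r" by metis
  define N where "N = Max (n ` ?L)"
  define V where "V i = {w. take (n i) w \<in> W i}" for i
  have V: "cylset M (n i) (W i) = cylset M N (V i)" if "i \<in> ?L" for i
    unfolding V_def using that finL by (intro cylset_extend) (auto simp: N_def)
  obtain i0 where i0: "i0 \<in> ?L" using \<open>?L \<noteq> {}\<close> by blast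
  define l where "l w = (if \<exists>i\<in>?L. w \<in> V i then (SOME i. i \<in> ?L \<and> w \<in> V i) else i0)" for w
  have l: "l w \<in> ?L" for w
    unfolding l_def using i0 someI_ex[of "\<lambda>i. i \<in> ?L \<and> w \<in> V i"] by auto
  have sub: "{x \<in> space \<nu>. X x \<noteq> l (initial N x)} \<subseteq> (\<Union>i\<in>?L. sym_diff (G i) (cylset M N (V i)))"
  proof
    fix x assume x: "x \<in> {x \<in> space \<nu>. X x \<noteq> l (initial N x)}"
    show "x \<in> (\<Union>i\<in>?L. sym_diff (G i) (cylset M N (V i)))"
    proof (rule ccontr)
      assume no: "x \<notin> (\<Union>i\<in>?L. sym_diff (G i) (cylset M N (V i)))"
      have iff: "X x = i \<longleftrightarrow> initial N x \<in> V i" if "i \<in> ?L" for i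
        using no that x by (auto simp: G_def cylset_def space_\<nu>)
      have "X x \<in> ?L" using x by blast
      then have ex: "\<exists>i\<in>?L. initial N x \<in> V i" using iff by blast
      then have "l (initial N x) \<in> ?L \<and> initial N x \<in> V (l (initial N x))"
        unfolding l_def using someI_ex[of "\<lambda>i. i \<in> ?L \<and> initial N x \<in> V i"] by auto
      then have "X x = l (initial N x)" using iff by blast
      with x show False by simp
    qed
  qed
  have "measure \<nu> {x \<in> space \<nu>. X x \<noteq> l (initial N x)} \<le> measure \<nu> (\<Union>i\<in>?L. sym_diff (G i) (cylset M N (V i)))"
  proof (rule finite_measure_mono[OF sub])
    show "(\<Union>i\<in>?L. sym_diff (G i) (cylset M N (V i))) \<in> sets \<nu>"
      using G by (intro sets.finite_UN finL sets.Un sets.Diff cylset_sets)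
  qed
  also have "\<dots> \<le> (\<Sum>i\<in>?L. measure \<nu> (sym_diff (G i) (cylset M N (V i))))"
  proof (rule finite_measure_subadditive_finite[OF finL])
    have "sym_diff (G i) (cylset M N (V i)) \<in> sets \<nu>" for i
      using G by (intro sets.Un sets.Diff cylset_sets)
    then show "(\<lambda>i. sym_diff (G i) (cylset M N (V i))) ` ?L \<subseteq> sets \<nu>" by blast
  qed
  also have "\<dots> \<le> (\<Sum>i\<in>?L. e / r)"
  proof (rule sum_mono)
    fix i assume "i \<in> ?L"
    show "measure \<nu> (sym_diff (G i) (cylset M N (V i))) \<le> e / r"
      unfolding V[OF \<open>i \<in> ?L\<close>, symmetric] by (rule less_imp_le[OF nW])
  qed
  also have "\<dots> = e" using r by (simp add: r_def)
  finally show thesis using that[of l N] l by blast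
qed

text \<open>
  The core of the Kolmogorov--Sinai theorem. Let $l(u)$ predict the value of $X$ from the word $u$ of
  the first $N$ coordinates. Encode the word of length $n + N$ optimally, and given this word, encode
  the values of $X$ along the orbit by the kernel $q$ that gives the predicted value probability
  $1 - d$ and distributes the remaining mass $d$ evenly over all values. The cross entropy of this
  code is the entropy of words of length $n + N$ plus $n$ times the cost of a single step, which is small
  if mispredictions are rare. The Gibbs inequality bounds the entropy by the cross entropy.
\<close>
lemma shannon_block_le:
  fixes X :: "(nat \<Rightarrow> nat) \<Rightarrow> 'c"
  assumes X: "simple_function \<nu> X" and e: "e > 0"
  obtains N where "\<And>n. shannon \<nu> (block X n) \<le> word_entropy (n + N) + real n * e"
proof -
  let ?L = "X ` space \<nu>"
  define r where "r = real (card ?L)"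
  have finL: "finite ?L" using X by (simp add: simple_functionD)
  have "card ?L > 0" using finL not_empty by (simp add: card_gt_0_iff)
  then have r: "r \<ge> 1" unfolding r_def by linarith
  \<comment> \<open>With this choice a correct prediction costs at most e / 2.\<close>
  define d where "d = 1 - exp (- (e / 2))"
  have d: "0 < d" "d < 1" "- ln (1 - d) = e / 2" using e by (simp_all add: d_def)
  have lnrd: "ln (r / d) > 0" using r d by (intro ln_gt_zero) (simp add: field_simps)
  \<comment> \<open>A wrong prediction costs an additional ln (r / d) at most, so this bounds the admissible error.\<close>
  have cost: "e / (2 * ln (r / d)) > 0" using e lnrd by simp
  obtain N l where l: "\<And>w. l w \<in> ?L"
    and small: "measure \<nu> {x \<in> space \<nu>. X x \<noteq> l (initial N x)} \<le> e / (2 * ln (r / d))"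
  proof (rule approx_simple_function[OF X cost])
    fix N l
    assume "\<And>w. l w \<in> ?L"
      and "measure \<nu> {x \<in> space \<nu>. X x \<noteq> l (initial N x)} \<le> e / (2 * ln (r / d))"
    then show thesis by (rule that)
  qed
  define q where "q i u = (1 - d) * of_bool (i = l u) + d / r" for i u
  have q_pos: "q i u > 0" for i u using d r by (auto simp: q_def intro!: add_nonneg_pos)
  have q_sum: "(\<Sum>i\<in>?L. q i u) = 1" for u
  proof -
    have "(\<Sum>i\<in>?L. q i u) = (1 - d) * (\<Sum>i\<in>?L. of_bool (i = l u)) + real (card ?L) * (d / r)"
      by (simp add: q_def sum.distrib sum_distrib_left)
    also have "(\<Sum>i\<in>?L. of_bool (i = l u)) = (1 :: real)"
      using l finL by (simp add: sum.If_cases of_bool_def if_distrib cong: if_cong)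
    finally show ?thesis using r by (simp add: r_def)
  qed
  define Bad where "Bad = {x \<in> space \<nu>. X x \<noteq> l (initial N x)}"
  have mem_Bad: "x \<in> Bad \<longleftrightarrow> X x \<noteq> l (initial N x)" if "x \<in> space \<nu>" for x
    unfolding Bad_def using that by blast
  define bad where "bad x = indicat_real Bad x" for x
  have simple_XN: "simple_function \<nu> (\<lambda>x. (X x, initial N x))"
    by (intro simple_function_Pair X simple_function_initial)
  have simple_g: "simple_function \<nu> (\<lambda>x. g (X x) (initial N x))" for g :: "'c \<Rightarrow> nat list \<Rightarrow> real"
    using simple_function_compose1[OF simple_XN, of "\<lambda>p. g (fst p) (snd p)"] by simp
  have int_g: "integrable \<nu> (\<lambda>x. g (X x) (initial N x))" for g :: "'c \<Rightarrow> nat list \<Rightarrow> real"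
    using simple_g by (rule integrable_simple_function) simp
  have meas_g: "(\<lambda>x. g (X x) (initial N x)) \<in> borel_measurable \<nu>" for g :: "'c \<Rightarrow> nat list \<Rightarrow> real"
    using int_g by (rule borel_measurable_integrable)
  have pointwise: "- ln (q (X x) (initial N x)) \<le> e / 2 + ln (r / d) * bad x" if x: "x \<in> space \<nu>" for x
  proof (cases "X x = l (initial N x)")
    case True
    have "1 - d \<le> q (X x) (initial N x)" using True d r by (simp add: q_def)
    then have "ln (1 - d) \<le> ln (q (X x) (initial N x))" using d by simp
    then show ?thesis using d mem_Bad[OF x] True by (simp add: bad_def)
  next
    case False
    then have "ln (q (X x) (initial N x)) = - ln (r / d)" using d r by (simp add: q_def ln_div)
    then show ?thesis using mem_Bad[OF x] False e by (simp add: bad_def)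
  qed
  have "Bad = (\<lambda>x. of_bool (X x \<noteq> l (initial N x)) :: real) -` {1} \<inter> space \<nu>"
    unfolding Bad_def of_bool_def vimage_def by (intro set_eqI) simp
  then have Bad_sets: "Bad \<in> sets \<nu>"
    using simple_functionD(2)[OF simple_g[of "\<lambda>i u. of_bool (i \<noteq> l u)"]] by simp
  then have Bad_space: "Bad \<inter> space \<nu> = Bad" by (simp add: sets.sets_into_space Int_absorb2)
  have int_bad: "integrable \<nu> bad"
    unfolding bad_def using Bad_sets by (simp add: less_top[symmetric])
  have "(\<integral>x. bad x \<partial>\<nu>) = measure \<nu> Bad"
    unfolding bad_def by (simp add: Bad_space)
  then have "(\<integral>x. bad x \<partial>\<nu>) \<le> e / (2 * ln (r / d))" using small by (simp add: Bad_def)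
  then have "ln (r / d) * (\<integral>x. bad x \<partial>\<nu>) \<le> ln (r / d) * (e / (2 * ln (r / d)))"
    using lnrd by (intro mult_left_mono) auto
  then have bad_le: "ln (r / d) * (\<integral>x. bad x \<partial>\<nu>) \<le> e / 2" using lnrd by simp
  have "(\<integral>x. - ln (q (X x) (initial N x)) \<partial>\<nu>) \<le> (\<integral>x. e / 2 + ln (r / d) * bad x \<partial>\<nu>)"
  proof (rule integral_mono)
    show "integrable \<nu> (\<lambda>x. - ln (q (X x) (initial N x)))" by (rule int_g[of "\<lambda>i u. - ln (q i u)"])
    show "integrable \<nu> (\<lambda>x. e / 2 + ln (r / d) * bad x)" using int_bad by simp
  qed (rule pointwise)
  also have "\<dots> = e / 2 + ln (r / d) * (\<integral>x. bad x \<partial>\<nu>)"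
    using int_bad by (simp add: prob_space)
  finally have local_cost: "(\<integral>x. - ln (q (X x) (initial N x)) \<partial>\<nu>) \<le> e" using bad_le by simp
  have "shannon \<nu> (block X n) \<le> word_entropy (n + N) + real n * e" for n
  proof -
    let ?P = "\<lambda>x. (initial (n + N) x, block X n x)"
    let ?S = "words M (n + N) \<times> PiE {..<n} (\<lambda>_. ?L)"
    define K where "K w c = (\<Prod>k<n. q (c k) (take N (drop k w)))" for w c
    let ?Q = "\<lambda>p. cyl_prob \<nu> (fst p) * K (fst p) (snd p)"
    have P: "simple_function \<nu> ?P"
      by (intro simple_function_Pair simple_function_initial simple_function_block X)
    have S: "finite ?S" "?P ` space \<nu> \<subseteq> ?S"
      using finL by (auto intro!: finite_cartesian_product finite_words finite_PiE initial_in_words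
          subsetD[OF _ block_in_PiE] dest: block_in_PiE)
    have K_pos: "K w c > 0" for w c unfolding K_def by (intro prod_pos) (simp add: q_pos)
    have K_sum: "(\<Sum>c\<in>PiE {..<n} (\<lambda>_. ?L). K w c) = 1" for w
    proof -
      have "(\<Prod>k<n. \<Sum>i\<in>?L. q i (take N (drop k w))) = (\<Sum>c\<in>PiE {..<n} (\<lambda>_. ?L). K w c)"
        unfolding K_def using finL by (intro prod_sum_PiE) auto
      then show ?thesis by (simp add: q_sum)
    qed
    have "sum ?Q ?S = (\<Sum>w\<in>words M (n + N). cyl_prob \<nu> w * (\<Sum>c\<in>PiE {..<n} (\<lambda>_. ?L). K w c))"
      unfolding sum.cartesian_product' by (simp only: fst_conv snd_conv sum_distrib_left)
    then have Q_sum: "sum ?Q ?S = 1" by (simp add: K_sum sum_cyl_prob)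
    have cyl_pos: "cyl_prob \<nu> (fst p) > 0" if p: "p \<in> ?S" "law \<nu> ?P p > 0" for p
    proof -
      have "law \<nu> ?P p \<le> law \<nu> (initial (n + N)) (fst p)"
        unfolding law_def
      proof (rule finite_measure_mono)
        show "initial (n + N) -` {fst p} \<inter> space \<nu> \<in> sets \<nu>"
          by (rule simple_functionD(2)[OF simple_function_initial])
        show "?P -` {p} \<inter> space \<nu> \<subseteq> initial (n + N) -` {fst p} \<inter> space \<nu>"
          by (intro subsetI IntI vimageI2) (simp_all add: vimage_def prod_eq_iff)
      qed
      moreover have "fst p \<in> words M (n + N)" using p(1) by (simp add: mem_Times_iff)
      ultimately show ?thesis using p(2) law_initial[of "fst p" "n + N"] by linarith
    qed
    have "shannon \<nu> (block X n) \<le> shannon \<nu> ?P"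
      using shannon_comp_le[OF P, of snd] by simp
    also have "\<dots> \<le> - (\<Sum>p\<in>?S. law \<nu> ?P p * ln (?Q p)) + (sum ?Q ?S - 1)"
    proof (rule shannon_le_cross_entropy[OF P S])
      show "0 \<le> ?Q p" for p
        by (intro mult_nonneg_nonneg cyl_prob_nonneg less_imp_le[OF K_pos])
      show "0 < ?Q p" if "p \<in> ?S" "law \<nu> ?P p > 0" for p
        by (intro mult_pos_pos cyl_pos[OF that] K_pos)
    qed
    finally have entropy_le: "shannon \<nu> (block X n) \<le> - (\<Sum>p\<in>?S. law \<nu> ?P p * ln (?Q p))"
      unfolding Q_sum by simp
    have "(\<Sum>p\<in>?S. law \<nu> ?P p * ln (?Q p))
        = (\<Sum>p\<in>?S. law \<nu> ?P p * (ln (cyl_prob \<nu> (fst p)) + ln (K (fst p) (snd p))))"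
    proof (rule sum.cong[OF refl])
      fix p assume p: "p \<in> ?S"
      show "law \<nu> ?P p * ln (?Q p) = law \<nu> ?P p * (ln (cyl_prob \<nu> (fst p)) + ln (K (fst p) (snd p)))"
      proof (cases "law \<nu> ?P p = 0")
        case False
        then have "law \<nu> ?P p > 0" using law_nonneg[of \<nu> ?P p] by linarith
        then show ?thesis using cyl_pos[OF p] K_pos[of "fst p" "snd p"] by (simp add: ln_mult)
      qed simp
    qed
    also have "\<dots> = (\<integral>x. ln (cyl_prob \<nu> (initial (n + N) x)) + ln (K (initial (n + N) x) (block X n x)) \<partial>\<nu>)"
      using integral_simple[OF P S, of "\<lambda>p. ln (cyl_prob \<nu> (fst p)) + ln (K (fst p) (snd p))"] by simp
    also have "\<dots> = (\<integral>x. ln (cyl_prob \<nu> (initial (n + N) x))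
        + (\<Sum>k<n. ln (q (X ((shift ^^ k) x)) (initial N ((shift ^^ k) x)))) \<partial>\<nu>)"
    proof (intro Bochner_Integration.integral_cong refl)
      fix x
      have "K (initial (n + N) x) (block X n x) = (\<Prod>k<n. q (X ((shift ^^ k) x)) (initial N ((shift ^^ k) x)))"
        unfolding K_def
      proof (rule prod.cong[OF refl])
        fix k assume "k \<in> {..<n}"
        then have "block X n x k = X ((shift ^^ k) x)"
          and "take N (drop k (initial (n + N) x)) = initial N ((shift ^^ k) x)"
          by (simp add: block_def, intro initial_window, simp)
        then show "q (block X n x k) (take N (drop k (initial (n + N) x)))
            = q (X ((shift ^^ k) x)) (initial N ((shift ^^ k) x))" by (simp only:)
      qed
      moreover have "ln (prod f {..<n}) = (\<Sum>k<n. ln (f k))" if "\<And>k. f k > 0" for f :: "nat \<Rightarrow> real"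
        using that by (intro ln_prod) (auto simp: less_imp_neq[symmetric])
      ultimately show "ln (cyl_prob \<nu> (initial (n + N) x)) + ln (K (initial (n + N) x) (block X n x))
        = ln (cyl_prob \<nu> (initial (n + N) x)) + (\<Sum>k<n. ln (q (X ((shift ^^ k) x)) (initial N ((shift ^^ k) x))))"
        using q_pos by presburger
    qed
    also have "\<dots> = (\<integral>x. ln (cyl_prob \<nu> (initial (n + N) x)) \<partial>\<nu>)
        + (\<Sum>k<n. \<integral>x. ln (q (X ((shift ^^ k) x)) (initial N ((shift ^^ k) x))) \<partial>\<nu>)"
    proof -
      have int_k: "integrable \<nu> (\<lambda>x. ln (q (X ((shift ^^ k) x)) (initial N ((shift ^^ k) x))))" for k
        using simple_function_iterate[OF simple_g[of "\<lambda>i u. ln (q i u)"], of k]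
        by (rule integrable_simple_function) simp
      have int_sum: "integrable \<nu> (\<lambda>x. \<Sum>k<n. ln (q (X ((shift ^^ k) x)) (initial N ((shift ^^ k) x))))"
        by (rule Bochner_Integration.integrable_sum) (rule int_k)
      have int_w: "integrable \<nu> (\<lambda>x. ln (cyl_prob \<nu> (initial (n + N) x)))"
        by (rule integrable_initial)
      show ?thesis
        unfolding Bochner_Integration.integral_add[OF int_w int_sum]
        by (subst Bochner_Integration.integral_sum) (rule int_k, rule refl)
    qed
    finally have cross: "(\<Sum>p\<in>?S. law \<nu> ?P p * ln (?Q p)) = (\<integral>x. ln (cyl_prob \<nu> (initial (n + N) x)) \<partial>\<nu>)
        + (\<Sum>k<n. \<integral>x. ln (q (X ((shift ^^ k) x)) (initial N ((shift ^^ k) x))) \<partial>\<nu>)" .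
    have word_part: "(\<integral>x. ln (cyl_prob \<nu> (initial (n + N) x)) \<partial>\<nu>) = - word_entropy (n + N)"
      using integral_initial[of "\<lambda>w. ln (cyl_prob \<nu> w)" "n + N"] word_entropy_eq[of "n + N"] by linarith
    have q_part: "(\<Sum>k<n. \<integral>x. ln (q (X ((shift ^^ k) x)) (initial N ((shift ^^ k) x))) \<partial>\<nu>)
        = real n * (\<integral>x. ln (q (X x) (initial N x)) \<partial>\<nu>)"
      unfolding integral_iterate[OF meas_g[of "\<lambda>i u. ln (q i u)"]] by simp
    have "real n * (\<integral>x. - ln (q (X x) (initial N x)) \<partial>\<nu>) \<le> real n * e"
      using local_cost by (rule mult_left_mono) simp
    then have "- (real n * (\<integral>x. ln (q (X x) (initial N x)) \<partial>\<nu>)) \<le> real n * e" by simp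
    then show ?thesis
      using entropy_le unfolding cross word_part q_part by linarith
  qed
  then show thesis by (rule that)
qed

lemma entropy_wrt_partition_le:
  assumes \<xi>: "finite_measurable_partition \<nu> \<xi>"
  shows "entropy_wrt_partition \<nu> shift \<xi> \<le> word_entropy_rate"
proof -
  let ?X = "atom \<xi>"
  have X: "simple_function \<nu> ?X" by (rule simple_function_atom[OF \<xi>])
  obtain h where h: "(\<lambda>n. shannon \<nu> (block ?X n) / real n) \<longlonglongrightarrow> h" "h \<ge> 0"
    using entropy_rate[OF X] by blast
  have "h \<le> word_entropy_rate + e" if e: "e > 0" for e
  proof -
    obtain N where N: "\<And>n. shannon \<nu> (block ?X n) \<le> word_entropy (n + N) + real n * e"
      using shannon_block_le[OF X e] by blast
    have bound: "shannon \<nu> (block ?X n) / real n \<le> word_entropy n / real n + word_entropy N / real n + e"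
      if "n \<ge> 1" for n
    proof -
      have "shannon \<nu> (block ?X n) \<le> word_entropy n + word_entropy N + real n * e"
        using N[of n] word_entropy_subadditive[of n N] by linarith
      then show ?thesis using that by (simp add: field_simps)
    qed
    have "(\<lambda>n. word_entropy n / real n + word_entropy N / real n + e) \<longlonglongrightarrow> word_entropy_rate + 0 + e"
      by (intro tendsto_intros word_entropy_rate(1) lim_const_over_n)
    then show ?thesis
      using LIMSEQ_le[OF h(1), of _ "word_entropy_rate + e"] bound by auto
  qed
  then have "h \<le> word_entropy_rate" by (rule field_le_epsilon)
  then show ?thesis using entropy_wrt_partition_eq[OF \<xi> h(1)] by simp
qed

text \<open>
  The partition according to the first coordinate attains the supremum.
\<close>
lemma metric_entropy_eq: "metric_entropy \<nu> shift = ereal word_entropy_rate"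
proof (rule antisym)
  show "metric_entropy \<nu> shift \<le> ereal word_entropy_rate"
    unfolding metric_entropy_def by (intro SUP_least) (simp add: entropy_wrt_partition_le)
next
  define G where "G i = {x \<in> space \<nu>. x 0 = i}" for i :: nat
  let ?\<xi> = "G ` {1..M}"
  have G_cyl: "G i = cylset M 1 {[i]}" for i by (auto simp: G_def cylset_def space_\<nu>)
  have nonempty: "G i \<noteq> {}" if "i \<in> {1..M}" for i
  proof -
    have "(\<lambda>_. i) \<in> G i" using that by (simp add: G_def space_\<nu> mem_full_shift)
    then show ?thesis by blast
  qed
  have mem: "x 0 \<in> {1..M}" if "x \<in> space \<nu>" for x using that by (simp add: space_\<nu> mem_full_shift)
  have \<xi>: "finite_measurable_partition \<nu> ?\<xi>"
    unfolding finite_measurable_partition_def partition_on_def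
  proof (intro conjI)
    show "?\<xi> \<subseteq> sets \<nu>" by (auto simp: G_cyl)
    show "\<Union> ?\<xi> = space \<nu>" using mem by (auto simp: G_def)
    show "disjoint ?\<xi>" unfolding disjoint_def by (auto simp: G_def)
    show "{} \<notin> ?\<xi>" using nonempty by (metis imageE)
  qed simp
  have atom: "atom ?\<xi> x = G (x 0)" if "x \<in> space \<nu>" for x
    using that mem[OF that] by (intro atom_eq[OF \<xi>]) (auto simp: G_def)
  have G_inj: "G i = G j \<Longrightarrow> i = j" if "i \<in> {1..M}" "j \<in> {1..M}" for i j
    using nonempty[OF that(1)] by (auto simp: G_def)
  have "shannon \<nu> (block (atom ?\<xi>) n) = word_entropy n" for n
  proof -
    define F where "F w = (\<lambda>k\<in>{..<n}. G (w ! k))" for w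
    have eq: "block (atom ?\<xi>) n x = F (initial n x)" if x: "x \<in> space \<nu>" for x
      using atom[OF iterate_in_space[OF x]] by (auto simp: block_def F_def shift_iterate fun_eq_iff restrict_def)
    have inj: "inj_on F (initial n ` space \<nu>)"
    proof (rule inj_onI)
      fix u v assume u: "u \<in> initial n ` space \<nu>" and v: "v \<in> initial n ` space \<nu>" and F: "F u = F v"
      have uv: "u \<in> words M n" "v \<in> words M n" using u v initial_in_words by auto
      have "u ! k = v ! k" if "k < n" for k
      proof (rule G_inj)
        show "u ! k \<in> {1..M}" "v ! k \<in> {1..M}" using nth_words[OF uv(1) that] nth_words[OF uv(2) that] by (simp_all only:)
        show "G (u ! k) = G (v ! k)" using fun_cong[OF F, of k] that by (simp add: F_def)
      qed
      then show "u = v" using uv by (intro nth_equalityI) (auto simp: words_def)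
    qed
    have "shannon \<nu> (block (atom ?\<xi>) n) = shannon \<nu> (\<lambda>x. F (initial n x))"
      by (rule shannon_cong) (rule eq)
    also have "\<dots> = word_entropy n"
      unfolding word_entropy_def by (rule shannon_comp_inj[OF simple_function_initial inj])
    finally show ?thesis .
  qed
  then have "entropy_wrt_partition \<nu> shift ?\<xi> = word_entropy_rate"
    using entropy_wrt_partition_eq[OF \<xi>] word_entropy_rate(1) by simp
  then have rate: "ereal word_entropy_rate = ereal (entropy_wrt_partition \<nu> shift ?\<xi>)" by simp
  show "ereal word_entropy_rate \<le> metric_entropy \<nu> shift"
    unfolding metric_entropy_def rate using \<xi> by (intro SUP_upper) (rule CollectI)
qed

end

section \<open>Lyapunov exponents\<close>

lemma words_iff: "w \<in> words M n \<longleftrightarrow> length w = n \<and> (\<forall>i\<in>set w. i \<in> {1..M})"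
  unfolding words_def by blast

lemma words_append: "u \<in> words M m \<Longrightarrow> v \<in> words M n \<Longrightarrow> u @ v \<in> words M (m + n)"
  by (auto simp: words_iff)

lemma words_subset_lists: "words M n \<subseteq> lists {1..M}"
  by (auto simp: words_iff)

lemma sum_words_add:
  fixes f :: "nat list \<Rightarrow> 'b::comm_monoid_add"
  shows "(\<Sum>w\<in>words M (m + n). f w) = (\<Sum>u\<in>words M m. \<Sum>v\<in>words M n. f (u @ v))"
proof -
  have "bij_betw (\<lambda>(u, v). u @ v) (words M m \<times> words M n) (words M (m + n))"
  proof (rule bij_betw_byWitness[where f' = "\<lambda>w. (take m w, drop m w)"])
    show "(\<lambda>w. (take m w, drop m w)) ` words M (m + n) \<subseteq> words M m \<times> words M n"
      by (auto simp: words_iff) (meson in_set_takeD in_set_dropD)+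
  qed (auto simp: words_iff)
  then have "(\<Sum>w\<in>words M (m + n). f w) = (\<Sum>p\<in>words M m \<times> words M n. f (case p of (u, v) \<Rightarrow> u @ v))"
    by (rule sum.reindex_bij_betw[symmetric])
  then show ?thesis by (simp add: sum.cartesian_product case_prod_beta)
qed

lemma words_0: "words M 0 = {[]}"
  by (auto simp: words_iff)

context shift_invariant
begin

lemma cyl_prob_right: "cyl_prob \<nu> u = (\<Sum>v\<in>words M n. cyl_prob \<nu> (u @ v))" if u: "u \<in> words M m"
proof -
  have "cyl_prob \<nu> u = measure \<nu> (cylset M m {u})" using u by (simp add: cyl_prob_altdef words_def)
  also have "cylset M m {u} = cylset M (m + n) {w. take m w \<in> {u}}" by (rule cylset_extend) simp
  also have "measure \<nu> \<dots> = (\<Sum>w\<in>words M (m + n) \<inter> {w. take m w \<in> {u}}. cyl_prob \<nu> w)"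
    by (rule measure_cylset)
  also have "words M (m + n) \<inter> {w. take m w \<in> {u}} = (\<lambda>v. u @ v) ` words M n"
  proof (intro equalityI subsetI)
    fix w assume w: "w \<in> words M (m + n) \<inter> {w. take m w \<in> {u}}"
    then have "w = u @ drop m w" by (metis IntD2 append_take_drop_id mem_Collect_eq singletonD)
    moreover have "drop m w \<in> words M n"
      using w set_drop_subset[of m w] by (auto simp: words_iff)
    ultimately show "w \<in> (\<lambda>v. u @ v) ` words M n" by blast
  next
    fix w assume "w \<in> (\<lambda>v. u @ v) ` words M n"
    then obtain v where "w = u @ v" "v \<in> words M n" by blast
    with u show "w \<in> words M (m + n) \<inter> {w. take m w \<in> {u}}" by (auto simp: words_iff)
  qed
  also have "(\<Sum>w\<in>(\<lambda>v. u @ v) ` words M n. cyl_prob \<nu> w) = (\<Sum>v\<in>words M n. cyl_prob \<nu> (u @ v))"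
    by (subst sum.reindex) (auto simp: inj_on_def)
  finally show ?thesis .
qed

lemma nn_integral_initial:
  "(\<integral>\<^sup>+x. F (initial n x) \<partial>\<nu>) = (\<Sum>w\<in>words M n. F w * ennreal (cyl_prob \<nu> w))"
proof -
  have "(\<integral>\<^sup>+x. F (initial n x) \<partial>\<nu>) = (\<integral>\<^sup>+x. (\<Sum>w\<in>words M n. F w * indicator (cylset M n {w}) x) \<partial>\<nu>)"
  proof (intro nn_integral_cong)
    fix x assume x: "x \<in> space \<nu>"
    have "(\<Sum>w\<in>words M n. F w * indicator (cylset M n {w}) x)
        = (\<Sum>w\<in>{initial n x}. F w * indicator (cylset M n {w}) x)"
      using initial_in_words[OF x] finite_words
      by (intro sum.mono_neutral_right) (auto simp: cylset_def indicator_def)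
    then show "F (initial n x) = (\<Sum>w\<in>words M n. F w * indicator (cylset M n {w}) x)"
      using x by (simp add: cylset_def space_\<nu>)
  qed
  also have "\<dots> = (\<Sum>w\<in>words M n. (\<integral>\<^sup>+x. F w * indicator (cylset M n {w}) x \<partial>\<nu>))"
    by (intro nn_integral_sum borel_measurable_times_ennreal borel_measurable_indicator
        borel_measurable_const cylset_sets)
  also have "\<dots> = (\<Sum>w\<in>words M n. F w * ennreal (cyl_prob \<nu> w))"
    by (intro sum.cong refl) (simp add: nn_integral_cmult_indicator emeasure_eq_measure cyl_prob_altdef words_def)
  finally show ?thesis .
qed

text \<open>
  A function of the initial word takes finitely many values. The integral is $-\infty$ exactly if the
  value $0$ of $g$, whose logarithm is $-\infty$, occurs with positive probability.
\<close>
lemma extended_integral_initial: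
  fixes g :: "nat list \<Rightarrow> real"
  assumes g: "\<And>w. g w \<ge> 0"
  shows "extended_integral \<nu> (\<lambda>x. extended_ln (g (initial n x)))
    = (if \<exists>w\<in>words M n. cyl_prob \<nu> w > 0 \<and> g w = 0 then - \<infinity>
       else ereal (\<Sum>w\<in>words M n. cyl_prob \<nu> w * ln (g w)))"
proof -
  let ?c = "cyl_prob \<nu>"
  have pos: "(\<integral>\<^sup>+x. e2ennreal (extended_ln (g (initial n x))) \<partial>\<nu>)
      = ennreal (\<Sum>w\<in>words M n. max 0 (ln (g w)) * ?c w)"
  proof -
    have "(\<integral>\<^sup>+x. e2ennreal (extended_ln (g (initial n x))) \<partial>\<nu>)
        = (\<Sum>w\<in>words M n. e2ennreal (extended_ln (g w)) * ennreal (?c w))"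
      by (rule nn_integral_initial[where F = "\<lambda>w. e2ennreal (extended_ln (g w))"])
    also have "\<dots> = (\<Sum>w\<in>words M n. ennreal (max 0 (ln (g w)) * ?c w))"
      by (intro sum.cong refl)
         (simp add: extended_ln_def e2ennreal_neg ennreal_mult cyl_prob_nonneg max_def ennreal_neg)
    also have "\<dots> = ennreal (\<Sum>w\<in>words M n. max 0 (ln (g w)) * ?c w)"
      by (intro sum_ennreal) (simp add: cyl_prob_nonneg)
    finally show ?thesis .
  qed
  have neg: "(\<integral>\<^sup>+x. e2ennreal (- extended_ln (g (initial n x))) \<partial>\<nu>)
      = (\<Sum>w\<in>words M n. e2ennreal (- extended_ln (g w)) * ennreal (?c w))"
    by (rule nn_integral_initial[where F = "\<lambda>w. e2ennreal (- extended_ln (g w))"])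
  show ?thesis
  proof (cases "\<exists>w\<in>words M n. ?c w > 0 \<and> g w = 0")
    case True
    then obtain w where w: "w \<in> words M n" "?c w > 0" "g w = 0" by blast
    have "e2ennreal (- extended_ln (g w)) * ennreal (?c w) = \<infinity>"
      using w by (simp add: extended_ln_def ennreal_top_mult)
    then have "\<infinity> \<le> (\<Sum>w\<in>words M n. e2ennreal (- extended_ln (g w)) * ennreal (?c w))"
      using member_le_sum[OF w(1), of "\<lambda>w. e2ennreal (- extended_ln (g w)) * ennreal (?c w)"] finite_words
      by simp
    then have "(\<Sum>w\<in>words M n. e2ennreal (- extended_ln (g w)) * ennreal (?c w)) = \<infinity>"
      by (simp add: top_unique)
    then show ?thesis
      using True unfolding extended_integral_def pos neg by (simp add: sum_nonneg cyl_prob_nonneg)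
  next
    case False
    have "(\<Sum>w\<in>words M n. e2ennreal (- extended_ln (g w)) * ennreal (?c w))
        = (\<Sum>w\<in>words M n. ennreal (max 0 (- ln (g w)) * ?c w))"
    proof (rule sum.cong[OF refl])
      fix w assume w: "w \<in> words M n"
      show "e2ennreal (- extended_ln (g w)) * ennreal (?c w) = ennreal (max 0 (- ln (g w)) * ?c w)"
      proof (cases "g w = 0")
        case True
        then have "?c w = 0" using False w cyl_prob_nonneg[of w] by force
        then show ?thesis by simp
      next
        case False
        then show ?thesis
          by (simp add: extended_ln_def ennreal_mult cyl_prob_nonneg max_def ennreal_neg)
      qed
    qed
    also have "\<dots> = ennreal (\<Sum>w\<in>words M n. max 0 (- ln (g w)) * ?c w)"
      by (intro sum_ennreal) (simp add: cyl_prob_nonneg)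
    finally have "extended_integral \<nu> (\<lambda>x. extended_ln (g (initial n x)))
        = ereal ((\<Sum>w\<in>words M n. max 0 (ln (g w)) * ?c w) - (\<Sum>w\<in>words M n. max 0 (- ln (g w)) * ?c w))"
      unfolding extended_integral_def pos neg by (simp add: sum_nonneg cyl_prob_nonneg)
    also have "(\<Sum>w\<in>words M n. max 0 (ln (g w)) * ?c w) - (\<Sum>w\<in>words M n. max 0 (- ln (g w)) * ?c w)
        = (\<Sum>w\<in>words M n. ?c w * ln (g w))"
      unfolding sum_subtractf[symmetric] by (intro sum.cong refl) (simp add: max_def)
    finally show ?thesis using False by simp
  qed
qed

text \<open>
  This separates the two ways in which the Lyapunov exponent can be $-\infty$. A tuple that is not
  charged has infinite integrals from some length on; for a charged tuple the integrals are finite, but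
  their growth rate may still be $-\infty$.
\<close>
definition charged :: "(nat \<Rightarrow> real ^ 'd ^ 'd) \<Rightarrow> bool" where
  "charged A \<longleftrightarrow> (\<forall>w\<in>lists {1..M}. cyl_prob \<nu> w > 0 \<longrightarrow> word_product A w \<noteq> 0)"

definition mean_log :: "(nat \<Rightarrow> real ^ 'd ^ 'd) \<Rightarrow> nat \<Rightarrow> real" where
  "mean_log A n = (\<Sum>w\<in>words M n. cyl_prob \<nu> w * ln (operator_norm (word_product A w)))"

lemma mean_log_subadditive:
  assumes A: "charged A"
  shows "mean_log A (m + n) \<le> mean_log A m + mean_log A n"
proof -
  let ?l = "\<lambda>w. ln (operator_norm (word_product A w))"
  have meanlog: "mean_log A n = (\<integral>x. ?l (initial n x) \<partial>\<nu>)" for n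
    unfolding mean_log_def by (rule integral_initial[of ?l, symmetric])
  have meas: "(\<lambda>x. ?l (initial n x)) \<in> borel_measurable \<nu>" for n
    using integrable_initial[of ?l n] by (rule borel_measurable_integrable)
  have int_n: "integrable \<nu> (\<lambda>x. ?l (initial n ((shift ^^ m) x)))"
    by (rule integrable_distr[OF measurable_iterate])
       (simp add: distr_iterate integrable_initial[of ?l n])
  have "mean_log A (m + n) \<le> (\<integral>x. ?l (initial m x) + ?l (initial n ((shift ^^ m) x)) \<partial>\<nu>)"
    unfolding meanlog
  proof (rule integral_mono_AE)
    show "integrable \<nu> (\<lambda>x. ?l (initial (m + n) x))" by (rule integrable_initial[of ?l])
    show "integrable \<nu> (\<lambda>x. ?l (initial m x) + ?l (initial n ((shift ^^ m) x)))"
      using integrable_initial[of ?l m] int_n by (rule Bochner_Integration.integrable_add)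
    show "AE x in \<nu>. ?l (initial (m + n) x) \<le> ?l (initial m x) + ?l (initial n ((shift ^^ m) x))"
      using AE_cyl_prob_pos[of "m + n"] AE_space
    proof eventually_elim
      case (elim x)
      let ?u = "initial m x" and ?v = "initial n ((shift ^^ m) x)"
      have uv: "initial (m + n) x = ?u @ ?v" by (rule initial_add)
      have "?u @ ?v \<in> lists {1..M}"
        using initial_in_words[OF elim(2), of "m + n"] words_subset_lists unfolding uv by blast
      then have "word_product A (?u @ ?v) \<noteq> 0"
        using A elim(1) unfolding charged_def uv by blast
      then have "0 < operator_norm (word_product A (?u @ ?v))"
        using operator_norm_eq_0[of "word_product A (?u @ ?v)"] operator_norm_nonneg[of "word_product A (?u @ ?v)"]
        by linarith
      also have le: "\<dots> \<le> operator_norm (word_product A ?v) * operator_norm (word_product A ?u)"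
        unfolding word_product_append by (rule operator_norm_mult)
      finally have pos: "operator_norm (word_product A ?v) > 0" "operator_norm (word_product A ?u) > 0"
        using operator_norm_nonneg[of "word_product A ?v"] operator_norm_nonneg[of "word_product A ?u"]
        by (auto simp: zero_less_mult_iff)
      have "?l (?u @ ?v) \<le> ln (operator_norm (word_product A ?v) * operator_norm (word_product A ?u))"
        using le \<open>0 < operator_norm (word_product A (?u @ ?v))\<close> by (rule ln_mono)
      also have "\<dots> = ?l ?u + ?l ?v" using pos by (simp add: ln_mult)
      finally show ?case unfolding uv .
    qed
  qed
  also have "\<dots> = (\<integral>x. ?l (initial m x) \<partial>\<nu>) + (\<integral>x. ?l (initial n ((shift ^^ m) x)) \<partial>\<nu>)"
    using integrable_initial[of ?l m] int_n by (rule Bochner_Integration.integral_add)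
  also have "(\<integral>x. ?l (initial n ((shift ^^ m) x)) \<partial>\<nu>) = (\<integral>x. ?l (initial n x) \<partial>\<nu>)"
    by (rule integral_iterate[OF meas])
  finally show ?thesis unfolding meanlog .
qed

lemma lyapunov_charged:
  assumes A: "charged A"
  shows "(\<lambda>n. ereal (mean_log A n / real n)) \<longlonglongrightarrow> lyapunov A \<nu>"
    and "n \<ge> 1 \<Longrightarrow> lyapunov A \<nu> \<le> ereal (mean_log A n / real n)"
proof -
  have lim: "(\<lambda>n. ereal (mean_log A n / real n)) \<longlonglongrightarrow> (INF n\<in>{1..}. ereal (mean_log A n / real n))"
    by (rule fekete) (rule mean_log_subadditive[OF A])
  have seq: "extended_integral \<nu> (\<lambda>x. extended_ln (operator_norm (word_product A (initial n x)))) / ereal (real n)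
      = ereal (mean_log A n / real n)" if "n \<ge> 1" for n
  proof -
    have "\<not> (\<exists>w\<in>words M n. cyl_prob \<nu> w > 0 \<and> operator_norm (word_product A w) = 0)"
      using A words_subset_lists unfolding charged_def operator_norm_eq_0 by blast
    then have "extended_integral \<nu> (\<lambda>x. extended_ln (operator_norm (word_product A (initial n x)))) = ereal (mean_log A n)"
      unfolding mean_log_def
      using extended_integral_initial[of "\<lambda>w. operator_norm (word_product A w)" n, OF operator_norm_nonneg]
      by (simp only: if_False)
    then show ?thesis using that by simp
  qed
  have "(\<lambda>n. extended_integral \<nu> (\<lambda>x. extended_ln (operator_norm (word_product A (initial n x)))) / ereal (real n))
      \<longlonglongrightarrow> (INF n\<in>{1..}. ereal (mean_log A n / real n))"
    using seq by (intro Lim_transform_eventually[OF lim]) (auto intro!: eventually_sequentiallyI[of 1])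
  then have "lyapunov A \<nu> = (INF n\<in>{1..}. ereal (mean_log A n / real n))"
    unfolding lyapunov_def by (rule limI)
  then show "(\<lambda>n. ereal (mean_log A n / real n)) \<longlonglongrightarrow> lyapunov A \<nu>"
    and "n \<ge> 1 \<Longrightarrow> lyapunov A \<nu> \<le> ereal (mean_log A n / real n)"
    using lim by (auto intro!: INF_lower)
qed

lemma lyapunov_not_charged:
  fixes A :: "nat \<Rightarrow> real ^ 'd ^ 'd"
  assumes A: "\<not> charged A"
  shows "lyapunov A \<nu> = - \<infinity>"
proof -
  obtain u where u: "u \<in> lists {1..M}" "cyl_prob \<nu> u > 0" "word_product A u = 0"
    using A unfolding charged_def by blast
  have "u \<noteq> []" using u(3) mat_one_nonzero[where 'd = 'd] by auto
  then have len: "length u \<ge> 1" by (cases u) auto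
  have u_word: "u \<in> words M (length u)" using u(1) by (auto simp: words_iff)
  have seq: "extended_integral \<nu> (\<lambda>x. extended_ln (operator_norm (word_product A (initial n x)))) / ereal (real n) = - \<infinity>"
    if n: "n \<ge> length u" for n
  proof -
    obtain k where k: "n = length u + k" using n le_Suc_ex by blast
    have "\<exists>v\<in>words M k. cyl_prob \<nu> (u @ v) > 0"
    proof (rule ccontr)
      assume "\<not> ?thesis"
      then have "(\<Sum>v\<in>words M k. cyl_prob \<nu> (u @ v)) \<le> 0" by (intro sum_nonpos) (simp add: not_less)
      then show False using u(2) cyl_prob_right[OF u_word, of k] by linarith
    qed
    then obtain v where v: "v \<in> words M k" "cyl_prob \<nu> (u @ v) > 0" by blast
    have "word_product A (u @ v) = 0" unfolding word_product_append u(3) by (simp add: matrix_matrix_mult_def vec_eq_iff)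
    then have "operator_norm (word_product A (u @ v)) = 0" by (simp add: operator_norm_eq_0)
    moreover have "u @ v \<in> words M n" unfolding k by (rule words_append[OF u_word v(1)])
    ultimately have "\<exists>w\<in>words M n. cyl_prob \<nu> w > 0 \<and> operator_norm (word_product A w) = 0"
      using v(2) by blast
    then have "extended_integral \<nu> (\<lambda>x. extended_ln (operator_norm (word_product A (initial n x)))) = - \<infinity>"
      using extended_integral_initial[of "\<lambda>w. operator_norm (word_product A w)" n, OF operator_norm_nonneg]
      by (simp only: if_True)
    then show ?thesis using n len by simp
  qed
  have "(\<lambda>n. extended_integral \<nu> (\<lambda>x. extended_ln (operator_norm (word_product A (initial n x)))) / ereal (real n))
      \<longlonglongrightarrow> - \<infinity>"
    using seq by (intro tendsto_eventually) (auto intro!: eventually_sequentiallyI[of "length u"])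
  then show ?thesis unfolding lyapunov_def by (rule limI)
qed

end

section \<open>Pressure and quasi-multiplicative weights\<close>

definition weight :: "(nat \<Rightarrow> real ^ 'd ^ 'd) \<Rightarrow> real \<Rightarrow> nat list \<Rightarrow> real" where
  "weight A s w = operator_norm (word_product A w) powr s"

lemma weight_nonneg: "weight A s w \<ge> 0"
  by (simp add: weight_def)

lemma weight_Nil: "weight A s [] = 1"
  by (simp add: weight_def operator_norm_one)

lemma weight_append_le:
  assumes "s > 0"
  shows "weight A s (u @ v) \<le> weight A s u * weight A s v"
proof -
  have "weight A s (u @ v) \<le> (operator_norm (word_product A v) * operator_norm (word_product A u)) powr s"
    unfolding weight_def word_product_append
    using assms by (intro powr_mono2 operator_norm_mult operator_norm_nonneg) auto
  also have "\<dots> = weight A s u * weight A s v"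
    by (simp add: weight_def powr_mult operator_norm_nonneg)
  finally show ?thesis .
qed

definition normalised_weight :: "(nat \<Rightarrow> real ^ 'd ^ 'd) \<Rightarrow> real \<Rightarrow> real \<Rightarrow> nat list \<Rightarrow> real" where
  "normalised_weight A s p w = exp (- real (length w) * p) * weight A s w"

lemma normalised_weight_words:
  "w \<in> words M n \<Longrightarrow> normalised_weight A s p w = exp (- real n * p) * operator_norm (word_product A w) powr s"
  by (simp add: normalised_weight_def weight_def words_def)

lemma normalised_weight_nonneg: "normalised_weight A s p w \<ge> 0"
  by (simp add: normalised_weight_def weight_nonneg)

lemma normalised_weight_pos_iff: "normalised_weight A s p w > 0 \<longleftrightarrow> word_product A w \<noteq> 0"
proof -
  have "operator_norm (word_product A w) powr s > 0 \<longleftrightarrow> word_product A w \<noteq> 0"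
    using operator_norm_eq_0[of "word_product A w"] by simp
  then show ?thesis by (simp add: normalised_weight_def weight_def zero_less_mult_iff)
qed

lemma exp_length_append:
  "exp (- real (length (u @ v)) * p) = exp (- real (length u) * p) * exp (- real (length v) * p)"
  by (simp add: algebra_simps flip: exp_add)

lemma normalised_weight_append_le:
  assumes "s > 0"
  shows "normalised_weight A s p (u @ v) \<le> normalised_weight A s p u * normalised_weight A s p v"
proof -
  have "normalised_weight A s p (u @ v) \<le> exp (- real (length (u @ v)) * p) * (weight A s u * weight A s v)"
    unfolding normalised_weight_def by (intro mult_left_mono weight_append_le assms) simp
  also have "\<dots> = normalised_weight A s p u * normalised_weight A s p v"
    unfolding normalised_weight_def exp_length_append by (simp only: mult_ac)
  finally show ?thesis .
qed

definition partition_sum :: "nat \<Rightarrow> (nat list \<Rightarrow> real) \<Rightarrow> nat \<Rightarrow> real" where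
  "partition_sum M \<phi> n = (\<Sum>w\<in>words M n. \<phi> w)"

text \<open>
  The properties of the normalised weights $e^{-nP(A,s)} \|A_{i_n} \cdots A_{i_1}\|^s$ of an irreducible
  tuple on which existence, ergodicity and uniqueness of the Gibbs measure depend.
\<close>
locale quasi_bernoulli =
  fixes M :: nat and \<phi> :: "nat list \<Rightarrow> real" and F :: "nat list set" and c K :: real
  assumes nonneg: "\<phi> w \<ge> 0"
    and submult: "\<phi> (u @ v) \<le> \<phi> u * \<phi> v"
    and finite_F: "finite F" and F_lists: "F \<subseteq> lists {1..M}" and c_pos: "c > 0"
    and quasi: "\<exists>k\<in>F. \<phi> (u @ k @ v) \<ge> c * \<phi> u * \<phi> v"
    and sum_ge_1: "partition_sum M \<phi> n \<ge> 1"
    and sum_le_K: "partition_sum M \<phi> n \<le> K"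

lemma partition_sum_submult:
  assumes nonneg: "\<And>w. \<phi> w \<ge> (0::real)" and submult: "\<And>u v. \<phi> (u @ v) \<le> \<phi> u * \<phi> v"
  shows "partition_sum M \<phi> (m + n) \<le> partition_sum M \<phi> m * partition_sum M \<phi> n"
proof -
  have "partition_sum M \<phi> (m + n) = (\<Sum>u\<in>words M m. \<Sum>v\<in>words M n. \<phi> (u @ v))"
    unfolding partition_sum_def by (rule sum_words_add)
  also have "\<dots> \<le> (\<Sum>u\<in>words M m. \<Sum>v\<in>words M n. \<phi> u * \<phi> v)"
    by (intro sum_mono submult)
  also have "\<dots> = partition_sum M \<phi> m * partition_sum M \<phi> n"
    by (simp add: partition_sum_def sum_product)
  finally show ?thesis .
qed

text \<open>
  Summing quasi-multiplicativity over all pairs of words bounds the product of two partition sums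
  by partition sums for words that are longer by the length of a connecting word, and
  submultiplicativity removes the additional length.
\<close>
lemma partition_sum_quasi:
  assumes nonneg: "\<And>w. \<phi> w \<ge> (0::real)" and submult: "\<And>u v. \<phi> (u @ v) \<le> \<phi> u * \<phi> v"
    and F: "finite F" "F \<subseteq> lists {1..M}"
    and quasi: "\<And>u v. \<exists>k\<in>F. \<phi> (u @ k @ v) \<ge> c * \<phi> u * \<phi> v"
  shows "c * partition_sum M \<phi> m * partition_sum M \<phi> n
    \<le> (\<Sum>k\<in>F. partition_sum M \<phi> (length k)) * partition_sum M \<phi> (m + n)"
proof -
  let ?Z = "partition_sum M \<phi>"
  have Z_nonneg: "?Z n \<ge> 0" for n unfolding partition_sum_def by (intro sum_nonneg nonneg)
  have "c * ?Z m * ?Z n = (\<Sum>u\<in>words M m. \<Sum>v\<in>words M n. c * \<phi> u * \<phi> v)"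
    unfolding partition_sum_def mult.assoc sum_product by (simp only: sum_distrib_left)
  also have "\<dots> \<le> (\<Sum>u\<in>words M m. \<Sum>v\<in>words M n. \<Sum>k\<in>F. \<phi> (u @ k @ v))"
  proof (intro sum_mono)
    fix u v :: "nat list"
    obtain k where k: "k \<in> F" "\<phi> (u @ k @ v) \<ge> c * \<phi> u * \<phi> v" using quasi by blast
    have "\<phi> (u @ k @ v) \<le> (\<Sum>k\<in>F. \<phi> (u @ k @ v))"
      using k(1) F(1) nonneg by (intro member_le_sum) auto
    with k(2) show "c * \<phi> u * \<phi> v \<le> (\<Sum>k\<in>F. \<phi> (u @ k @ v))" by linarith
  qed
  also have "\<dots> = (\<Sum>u\<in>words M m. \<Sum>k\<in>F. \<Sum>v\<in>words M n. \<phi> (u @ k @ v))"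
    by (rule sum.cong[OF refl]) (rule sum.swap)
  also have "\<dots> = (\<Sum>k\<in>F. \<Sum>u\<in>words M m. \<Sum>v\<in>words M n. \<phi> (u @ k @ v))"
    by (rule sum.swap)
  also have "\<dots> \<le> (\<Sum>k\<in>F. ?Z (length k) * ?Z (m + n))"
  proof (rule sum_mono)
    fix k assume "k \<in> F"
    then have k: "k \<in> words M (length k)" using F(2) by (auto simp: words_iff)
    have "(\<Sum>u\<in>words M m. \<Sum>v\<in>words M n. \<phi> (u @ k @ v))
        \<le> (\<Sum>u\<in>words M m. \<Sum>k'\<in>words M (length k). \<Sum>v\<in>words M n. \<phi> (u @ k' @ v))"
      using k by (intro sum_mono member_le_sum[of k "words M (length k)" "\<lambda>k'. \<Sum>v\<in>words M n. \<phi> (_ @ k' @ v)"])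
        (auto intro!: sum_nonneg nonneg finite_words)
    also have "\<dots> = ?Z (m + (length k + n))"
      unfolding partition_sum_def sum_words_add by simp
    also have "m + (length k + n) = length k + (m + n)" by simp
    also have "?Z (length k + (m + n)) \<le> ?Z (length k) * ?Z (m + n)"
      using nonneg submult by (rule partition_sum_submult)
    finally show "(\<Sum>u\<in>words M m. \<Sum>v\<in>words M n. \<phi> (u @ k @ v)) \<le> ?Z (length k) * ?Z (m + n)" .
  qed
  also have "\<dots> = (\<Sum>k\<in>F. ?Z (length k)) * ?Z (m + n)"
    by (rule sum_distrib_right[symmetric])
  finally show ?thesis .
qed

lemma weight_quasi:
  fixes A :: "nat \<Rightarrow> real ^ 'd ^ 'd"
  assumes irr: "irreducible_tuple M A" and s: "s > 0"
  obtains F e where "finite F" "F \<subseteq> lists {1..M}" "e > 0"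
    "\<And>u v. \<exists>k\<in>F. weight A s (u @ k @ v) \<ge> e * weight A s u * weight A s v"
proof -
  obtain F e where F: "finite F" "F \<subseteq> lists {1..M}" "e > 0"
    and q: "\<And>X Y. \<exists>u\<in>F. operator_norm (X ** word_product A u ** Y) \<ge> e * operator_norm X * operator_norm Y"
    using operator_norm_quasi_multiplicative[OF irr] by blast
  have "\<exists>k\<in>F. weight A s (u @ k @ v) \<ge> e powr s * weight A s u * weight A s v" for u v
  proof -
    obtain k where k: "k \<in> F" and le: "e * operator_norm (word_product A v) * operator_norm (word_product A u)
        \<le> operator_norm (word_product A v ** word_product A k ** word_product A u)"
      using q by blast
    have "(e * operator_norm (word_product A v) * operator_norm (word_product A u)) powr s \<le> weight A s (u @ k @ v)"
      unfolding weight_def word_product_append using le s F(3)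
      by (intro powr_mono2) (auto simp: operator_norm_nonneg)
    moreover have "(e * operator_norm (word_product A v) * operator_norm (word_product A u)) powr s
        = e powr s * weight A s u * weight A s v"
      using F(3) by (simp add: weight_def powr_mult operator_norm_nonneg)
    ultimately show ?thesis using k by auto
  qed
  moreover have "e powr s > 0" using F(3) by simp
  ultimately show thesis using F that by blast
qed

text \<open>
  Submultiplicativity of the partition sums $Z_n$ and Fekete's lemma give $\log Z_n \geq nP$. By
  \<open>partition_sum_quasi\<close> the numbers $-\log Z_n$ are subadditive up to a constant, so Fekete's lemma also
  gives $\log Z_n \leq nP + $ const.
\<close>
lemma quasi_bernoulli_normalised_weight:
  fixes A :: "nat \<Rightarrow> real ^ 'd ^ 'd"
  assumes irr: "irreducible_tuple M A" and s: "s > 0" and P: "pressure M A s > - \<infinity>"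
  defines "p \<equiv> real_of_ereal (pressure M A s)"
  obtains F c K where "quasi_bernoulli M (normalised_weight A s p) F c K"
proof -
  let ?W = "weight A s"
  let ?Z = "partition_sum M ?W"
  note sub = partition_sum_submult[of ?W M, OF weight_nonneg weight_append_le[OF s]]
  have Z_nonneg: "?Z n \<ge> 0" for n unfolding partition_sum_def by (intro sum_nonneg weight_nonneg)
  have pressure_eq: "pressure M A s = lim (\<lambda>n. extended_ln (?Z n) / ereal (real n))"
    unfolding pressure_def partition_sum_def weight_def ..
  have Z_pos: "?Z n > 0" for n
  proof (rule ccontr)
    assume "\<not> ?Z n > 0"
    then have n0: "?Z n = 0" using Z_nonneg[of n] by linarith
    have "?Z m = 0" if "m \<ge> n" for m
    proof -
      have "m = n + (m - n)" using that by simp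
      then have "?Z m \<le> ?Z n * ?Z (m - n)" using sub[of n "m - n"] by simp
      then show ?thesis using n0 Z_nonneg[of m] by simp
    qed
    then have "\<forall>\<^sub>F m in sequentially. extended_ln (?Z m) / ereal (real m) = - \<infinity>"
      by (intro eventually_sequentiallyI[of "max n 1"]) (simp add: extended_ln_def)
    then have "pressure M A s = - \<infinity>"
      unfolding pressure_eq by (intro limI tendsto_eventually)
    with P show False by simp
  qed
  have ln_sub: "ln (?Z (m + n)) \<le> ln (?Z m) + ln (?Z n)" for m n
  proof -
    have "ln (?Z (m + n)) \<le> ln (?Z m * ?Z n)" using sub[of m n] Z_pos[of "m + n"] by (intro ln_mono)
    then show ?thesis using Z_pos[of m] Z_pos[of n] by (simp add: ln_mult)
  qed
  let ?I = "INF n\<in>{1..}. ereal (ln (?Z n) / real n)"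
  have lim: "(\<lambda>n. ereal (ln (?Z n) / real n)) \<longlonglongrightarrow> ?I"
    by (rule fekete) (rule ln_sub)
  have seq: "ereal (ln (?Z n) / real n) = extended_ln (?Z n) / ereal (real n)" if "n \<ge> 1" for n
    using Z_pos[of n] that by (simp add: extended_ln_def)
  have "(\<lambda>n. extended_ln (?Z n) / ereal (real n)) \<longlonglongrightarrow> ?I"
    using seq by (intro Lim_transform_eventually[OF lim] eventually_sequentiallyI[of 1])
  then have P_I: "pressure M A s = ?I" unfolding pressure_eq by (rule limI)
  have "?I \<le> ereal (ln (?Z 1) / real 1)" by (rule INF_lower) simp
  then have "pressure M A s \<noteq> \<infinity>" unfolding P_I by auto
  then have p: "pressure M A s = ereal p" using P unfolding p_def by (cases "pressure M A s") auto
  have lim_p: "(\<lambda>n. ln (?Z n) / real n) \<longlonglongrightarrow> p" using lim unfolding P_I[symmetric] p by simp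
  have lower: "ln (?Z n) \<ge> real n * p" for n
  proof (cases "n = 0")
    case True
    then show ?thesis by (simp add: partition_sum_def words_0 weight_Nil)
  next
    case False
    then have "?I \<le> ereal (ln (?Z n) / real n)" by (intro INF_lower) simp
    then show ?thesis using False unfolding P_I[symmetric] p by (simp add: field_simps)
  qed
  obtain F e where F: "finite F" "F \<subseteq> lists {1..M}" "e > 0"
    and q: "\<And>u v. \<exists>k\<in>F. ?W (u @ k @ v) \<ge> e * ?W u * ?W v"
    using weight_quasi[OF irr s] by blast
  define C where "C = (\<Sum>k\<in>F. ?Z (length k))"
  have "F \<noteq> {}" using q by blast
  then have C: "C > 0" unfolding C_def using F(1) Z_pos by (intro sum_pos)
  have super: "e * ?Z m * ?Z n \<le> C * ?Z (m + n)" for m n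
    unfolding C_def by (rule partition_sum_quasi[OF weight_nonneg weight_append_le[OF s] F(1,2) q])
  define b where "b n = ln C - ln e - ln (?Z n)" for n
  have b_sub: "b (m + n) \<le> b m + b n" for m n
  proof -
    have "ln (e * ?Z m * ?Z n) \<le> ln (C * ?Z (m + n))"
      using super[of m n] F(3) Z_pos[of m] Z_pos[of n] by (intro ln_mono mult_pos_pos)
    then show ?thesis using F(3) C Z_pos[of m] Z_pos[of n] Z_pos[of "m + n"]
      by (simp add: b_def ln_mult)
  qed
  have "(\<lambda>n. (ln C - ln e) / real n - ln (?Z n) / real n) \<longlonglongrightarrow> 0 - p"
    by (intro tendsto_diff lim_p lim_const_over_n)
  then have "(\<lambda>n. ereal (b n / real n)) \<longlonglongrightarrow> ereal (- p)" by (simp add: b_def diff_divide_distrib)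
  then have b_lim: "(INF n\<in>{1..}. ereal (b n / real n)) = ereal (- p)"
    using fekete[of b, OF b_sub] LIMSEQ_unique by blast
  have upper: "ln (?Z n) \<le> real n * p + (ln C - ln e)" if "n \<ge> 1" for n
  proof -
    have "ereal (- p) \<le> ereal (b n / real n)"
      unfolding b_lim[symmetric] using that by (intro INF_lower) simp
    then have "- p * real n \<le> b n" using that by (simp add: field_simps)
    then show ?thesis by (simp add: b_def algebra_simps)
  qed
  define K where "K = max 1 (C / e)"
  let ?\<phi> = "normalised_weight A s p"
  have sum_phi: "partition_sum M ?\<phi> n = exp (- real n * p) * ?Z n" for n
    unfolding partition_sum_def sum_distrib_left
    by (intro sum.cong refl) (simp add: normalised_weight_def words_def)
  have exp_ln: "exp (ln (?Z n)) = ?Z n" for n using Z_pos[of n] by simp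
  \<comment> \<open>The constant d absorbs the normalising factors of the connecting words.\<close>
  define d where "d = Min ((\<lambda>k. exp (- real (length k) * p)) ` F)"
  have d: "d > 0" unfolding d_def using F(1) \<open>F \<noteq> {}\<close> by (subst Min_gr_iff) auto
  have "quasi_bernoulli M ?\<phi> F (d * e) K"
  proof
    show "?\<phi> w \<ge> 0" for w by (rule normalised_weight_nonneg)
    show "?\<phi> (u @ v) \<le> ?\<phi> u * ?\<phi> v" for u v by (rule normalised_weight_append_le[OF s])
    show "finite F" "F \<subseteq> lists {1..M}" "d * e > 0" using F d by auto
    show "\<exists>k\<in>F. ?\<phi> (u @ k @ v) \<ge> d * e * ?\<phi> u * ?\<phi> v" for u v
    proof -
      obtain k where k: "k \<in> F" "?W (u @ k @ v) \<ge> e * ?W u * ?W v" using q by blast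
      have "d \<le> exp (- real (length k) * p)" unfolding d_def using k(1) F(1) by (intro Min_le) auto
      then have "d * (exp (- real (length u) * p) * exp (- real (length v) * p) * (e * ?W u * ?W v))
          \<le> exp (- real (length k) * p) * (exp (- real (length u) * p) * exp (- real (length v) * p) * ?W (u @ k @ v))"
        using k(2) d F(3) by (intro mult_mono mult_left_mono mult_nonneg_nonneg) (auto simp: weight_nonneg)
      also have "\<dots> = ?\<phi> (u @ k @ v)"
        unfolding normalised_weight_def exp_length_append by (simp only: mult_ac)
      finally show ?thesis
        using k(1) unfolding normalised_weight_def by (intro bexI[of _ k]) (simp_all only: mult_ac)
    qed
    show "1 \<le> partition_sum M ?\<phi> n" for n
    proof -
      have "1 = exp (- real n * p) * exp (real n * p)" by (simp flip: exp_add)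
      also have "\<dots> \<le> exp (- real n * p) * exp (ln (?Z n))"
        using lower[of n] by (intro mult_left_mono) auto
      finally show ?thesis unfolding sum_phi exp_ln .
    qed
    show "partition_sum M ?\<phi> n \<le> K" for n
    proof (cases "n = 0")
      case True
      then show ?thesis unfolding sum_phi by (simp add: partition_sum_def words_0 weight_Nil K_def)
    next
      case False
      have "exp (- real n * p) * exp (ln (?Z n)) \<le> exp (- real n * p) * exp (real n * p + (ln C - ln e))"
        using upper[of n] False by (intro mult_left_mono) auto
      also have "\<dots> = C / e" using C F(3) by (simp add: exp_add exp_diff exp_minus)
      also have "\<dots> \<le> K" by (simp add: K_def)
      finally show ?thesis unfolding sum_phi exp_ln .
    qed
  qed
  then show thesis by (rule that)
qed

section \<open>Consistent masses of cylinders comparable with a weight\<close>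

lemma sum_words_1:
  fixes f :: "nat list \<Rightarrow> 'b::comm_monoid_add"
  shows "(\<Sum>v\<in>words M 1. f v) = (\<Sum>a\<in>{1..M}. f [a])"
proof -
  have "words M 1 = (\<lambda>a. [a]) ` {1..M}"
    by (auto simp: words_iff length_Suc_conv)
  then show ?thesis by (simp add: sum.reindex inj_on_def)
qed

text \<open>
  A subsequence of the averages converges at all points simultaneously, as a countable product of
  compact intervals is sequentially compact. Shifting the summation index changes the averages by
  $O(1/n)$, so the limit is the same; this is how invariance arises.
\<close>
lemma cesaro_subsequence:
  fixes f :: "nat \<Rightarrow> 'i::countable \<Rightarrow> real"
  assumes f: "\<And>l w. 0 \<le> f l w" "\<And>l w. f l w \<le> b w"
  obtains r g where "strict_mono (r :: nat \<Rightarrow> nat)"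
    "\<And>w. (\<lambda>k. (\<Sum>l<r k. f l w) / real (r k)) \<longlonglongrightarrow> g w"
    "\<And>w. (\<lambda>k. (\<Sum>l<r k. f (Suc l) w) / real (r k)) \<longlonglongrightarrow> g w"
proof -
  define h where "h n w = (\<Sum>l<n. f l w) / real n" for n w
  let ?S = "PiE UNIV (\<lambda>w. {0..b w})"
  have b: "b w \<ge> 0" for w using f(1)[of 0 w] f(2)[of 0 w] by linarith
  have "h n w \<in> {0..b w}" for n w
  proof (cases "n = 0")
    case False
    have "(\<Sum>l<n. f l w) \<le> real n * b w"
      using sum_bounded_above[of "{..<n}" "\<lambda>l. f l w" "b w"] f(2) by simp
    then show ?thesis using False f(1) by (simp add: h_def sum_nonneg field_simps)
  qed (simp add: h_def b)
  then have h_S: "\<forall>n. h n \<in> ?S" by (simp add: PiE_UNIV_domain)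
  have "compactin (product_topology (\<lambda>_. euclidean) UNIV) ?S"
    unfolding compactin_PiE by simp
  then have "compact ?S" by (simp add: euclidean_product_topology)
  then obtain g r where r: "strict_mono (r :: nat \<Rightarrow> nat)" and lim: "(h \<circ> r) \<longlonglongrightarrow> g"
    using compact_imp_seq_compact h_S by (metis seq_compactE)
  have conv: "(\<lambda>k. (\<Sum>l<r k. f l w) / real (r k)) \<longlonglongrightarrow> g w" for w
  proof -
    have cont: "continuous_on UNIV (\<lambda>x :: 'i \<Rightarrow> real. x w)" by simp
    have "(\<lambda>k. (h \<circ> r) k w) \<longlonglongrightarrow> g w"
      by (rule continuous_on_tendsto_compose[OF cont lim]) simp_all
    then show ?thesis by (simp add: h_def)
  qed
  have "(\<lambda>k. (\<Sum>l<r k. f (Suc l) w) / real (r k)) \<longlonglongrightarrow> g w" for w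
  proof -
    have "(\<lambda>k. (f (r k) w - f 0 w) / real (r k)) \<longlonglongrightarrow> 0"
    proof (rule Lim_null_comparison)
      have "\<bar>f (r k) w - f 0 w\<bar> \<le> b w" for k
        using f(1)[of "r k" w] f(1)[of 0 w] f(2)[of "r k" w] f(2)[of 0 w] by linarith
      then show "\<forall>\<^sub>F k in sequentially. norm ((f (r k) w - f 0 w) / real (r k)) \<le> b w / real (r k)"
        by (simp add: divide_right_mono)
      show "(\<lambda>k. b w / real (r k)) \<longlonglongrightarrow> 0"
        using LIMSEQ_subseq_LIMSEQ[OF lim_const_over_n[of "b w"] r] by (simp add: comp_def)
    qed
    then have "(\<lambda>k. (\<Sum>l<r k. f l w) / real (r k) + (f (r k) w - f 0 w) / real (r k)) \<longlonglongrightarrow> g w + 0"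
      by (intro tendsto_add conv)
    moreover have "(\<Sum>l<n. f (Suc l) w) = (\<Sum>l<n. f l w) + (f n w - f 0 w)" for n
      by (induction n) auto
    ultimately show ?thesis by (simp add: add_divide_distrib)
  qed
  with r conv show thesis using that by blast
qed

lemma cesaro_bounds:
  fixes f :: "nat \<Rightarrow> real"
  assumes "\<And>l. x \<le> f l" "\<And>l. f l \<le> y" "strict_mono (r :: nat \<Rightarrow> nat)"
    and lim: "(\<lambda>k. (\<Sum>l<r k. f l) / real (r k)) \<longlonglongrightarrow> g"
  shows "x \<le> g" "g \<le> y"
proof -
  have pos: "r k > 0" if "k \<ge> 1" for k
    using seq_suble[OF assms(3), of k] that by linarith
  have "x \<le> (\<Sum>l<r k. f l) / real (r k)" "(\<Sum>l<r k. f l) / real (r k) \<le> y" if "k \<ge> 1" for k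
  proof -
    have "real (r k) * x \<le> (\<Sum>l<r k. f l)"
      using sum_bounded_below[of "{..<r k}" x f] assms(1) by simp
    moreover have "(\<Sum>l<r k. f l) \<le> real (r k) * y"
      using sum_bounded_above[of "{..<r k}" f y] assms(2) by simp
    ultimately show "x \<le> (\<Sum>l<r k. f l) / real (r k)" "(\<Sum>l<r k. f l) / real (r k) \<le> y"
      using pos[OF that] by (simp_all add: field_simps)
  qed
  then show "x \<le> g" "g \<le> y"
    using LIMSEQ_le_const[OF lim] LIMSEQ_le_const2[OF lim] by blast+
qed

context quasi_bernoulli
begin

lemma F_ne: "F \<noteq> {}"
  using quasi by blast

lemma card_F: "real (card F) > 0"
  using F_ne finite_F by (simp add: card_gt_0_iff)

lemma K_ge_1: "K \<ge> 1"
  using sum_ge_1[of 0] sum_le_K[of 0] by linarith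

definition kappa :: real  (\<open>\<kappa>\<close>) where "\<kappa> = c / (real (card F) * K)"

lemma kappa_pos: "\<kappa> > 0"
  unfolding kappa_def using c_pos card_F K_ge_1 by simp

lemma right_sum_le: "(\<Sum>v\<in>words M l. \<phi> (w @ v)) \<le> K * \<phi> w"
proof -
  have "(\<Sum>v\<in>words M l. \<phi> (w @ v)) \<le> (\<Sum>v\<in>words M l. \<phi> w * \<phi> v)"
    by (intro sum_mono submult)
  also have "\<dots> = \<phi> w * partition_sum M \<phi> l" by (simp add: partition_sum_def sum_distrib_left)
  also have "\<dots> \<le> \<phi> w * K" by (intro mult_left_mono sum_le_K nonneg)
  finally show ?thesis by (simp add: mult.commute)
qed

lemma left_sum_le: "(\<Sum>u\<in>words M l. \<phi> (u @ w)) \<le> K * \<phi> w"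
proof -
  have "(\<Sum>u\<in>words M l. \<phi> (u @ w)) \<le> (\<Sum>u\<in>words M l. \<phi> u * \<phi> w)"
    by (intro sum_mono submult)
  also have "\<dots> = partition_sum M \<phi> l * \<phi> w" by (simp add: partition_sum_def sum_distrib_right)
  also have "\<dots> \<le> K * \<phi> w" by (intro mult_right_mono sum_le_K nonneg)
  finally show ?thesis .
qed

text \<open>
  Every pair of words can be joined by a connecting word, so the sums over extensions by words of
  length $l + |k|$, $k \in F$, together dominate $c \phi(w) Z_l$; removing the last $|k|$ letters
  costs at most the factor $K$.
\<close>
lemma right_sum_ge: "\<kappa> * \<phi> w \<le> (\<Sum>v\<in>words M l. \<phi> (w @ v))"
proof -
  let ?R = "\<Sum>v\<in>words M l. \<phi> (w @ v)"
  have "c * \<phi> w * 1 \<le> c * \<phi> w * partition_sum M \<phi> l"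
    using c_pos nonneg sum_ge_1 by (intro mult_left_mono mult_nonneg_nonneg) auto
  also have "\<dots> = (\<Sum>v\<in>words M l. c * \<phi> w * \<phi> v)" by (simp add: partition_sum_def sum_distrib_left)
  also have "\<dots> \<le> (\<Sum>v\<in>words M l. \<Sum>k\<in>F. \<phi> (w @ k @ v))"
  proof (rule sum_mono)
    fix v
    obtain k where k: "k \<in> F" "c * \<phi> w * \<phi> v \<le> \<phi> (w @ k @ v)" using quasi by blast
    have "\<phi> (w @ k @ v) \<le> (\<Sum>k\<in>F. \<phi> (w @ k @ v))"
      using k(1) finite_F nonneg by (intro member_le_sum) auto
    with k(2) show "c * \<phi> w * \<phi> v \<le> (\<Sum>k\<in>F. \<phi> (w @ k @ v))" by linarith
  qed
  also have "\<dots> = (\<Sum>k\<in>F. \<Sum>v\<in>words M l. \<phi> (w @ k @ v))" by (rule sum.swap)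
  also have "\<dots> \<le> (\<Sum>k\<in>F. K * ?R)"
  proof (rule sum_mono)
    fix k assume "k \<in> F"
    then have k: "k \<in> words M (length k)" using F_lists by (auto simp: words_iff)
    have "(\<Sum>v\<in>words M l. \<phi> (w @ k @ v)) \<le> (\<Sum>k'\<in>words M (length k). \<Sum>v\<in>words M l. \<phi> (w @ k' @ v))"
      by (rule member_le_sum[OF k]) (auto intro!: sum_nonneg nonneg finite_words)
    also have "\<dots> = (\<Sum>x\<in>words M (length k + l). \<phi> (w @ x))"
      by (rule sum_words_add[symmetric])
    also have "\<dots> = (\<Sum>x\<in>words M (l + length k). \<phi> (w @ x))" by (simp add: add.commute)
    also have "\<dots> = (\<Sum>v\<in>words M l. \<Sum>v'\<in>words M (length k). \<phi> ((w @ v) @ v'))"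
      unfolding sum_words_add by simp
    also have "\<dots> \<le> (\<Sum>v\<in>words M l. K * \<phi> (w @ v))"
      by (intro sum_mono right_sum_le)
    also have "\<dots> = K * ?R" by (simp add: sum_distrib_left)
    finally show "(\<Sum>v\<in>words M l. \<phi> (w @ k @ v)) \<le> K * ?R" .
  qed
  also have "\<dots> = real (card F) * K * ?R" by simp
  finally show ?thesis unfolding kappa_def using card_F K_ge_1 by (simp add: field_simps)
qed

lemma left_sum_ge: "\<kappa> * \<phi> w \<le> (\<Sum>u\<in>words M l. \<phi> (u @ w))"
proof -
  let ?R = "\<Sum>u\<in>words M l. \<phi> (u @ w)"
  have "c * \<phi> w * 1 \<le> c * \<phi> w * partition_sum M \<phi> l"
    using c_pos nonneg sum_ge_1 by (intro mult_left_mono mult_nonneg_nonneg) auto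
  also have "\<dots> = (\<Sum>u\<in>words M l. c * \<phi> u * \<phi> w)"
    by (simp add: partition_sum_def sum_distrib_left mult_ac)
  also have "\<dots> \<le> (\<Sum>u\<in>words M l. \<Sum>k\<in>F. \<phi> (u @ k @ w))"
  proof (rule sum_mono)
    fix u
    obtain k where k: "k \<in> F" "c * \<phi> u * \<phi> w \<le> \<phi> (u @ k @ w)" using quasi by blast
    have "\<phi> (u @ k @ w) \<le> (\<Sum>k\<in>F. \<phi> (u @ k @ w))"
      using k(1) finite_F nonneg by (intro member_le_sum) auto
    with k(2) show "c * \<phi> u * \<phi> w \<le> (\<Sum>k\<in>F. \<phi> (u @ k @ w))" by linarith
  qed
  also have "\<dots> = (\<Sum>k\<in>F. \<Sum>u\<in>words M l. \<phi> (u @ k @ w))" by (rule sum.swap)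
  also have "\<dots> \<le> (\<Sum>k\<in>F. K * ?R)"
  proof (rule sum_mono)
    fix k assume "k \<in> F"
    then have k: "k \<in> words M (length k)" using F_lists by (auto simp: words_iff)
    have "(\<Sum>u\<in>words M l. \<phi> (u @ k @ w)) \<le> (\<Sum>u\<in>words M l. \<Sum>k'\<in>words M (length k). \<phi> (u @ k' @ w))"
      by (intro sum_mono member_le_sum[OF k, of "\<lambda>k'. \<phi> (_ @ k' @ w)"]) (auto intro!: nonneg finite_words)
    also have "\<dots> = (\<Sum>x\<in>words M (l + length k). \<phi> (x @ w))"
      unfolding sum_words_add by simp
    also have "\<dots> = (\<Sum>x\<in>words M (length k + l). \<phi> (x @ w))" by (simp add: add.commute)
    also have "\<dots> = (\<Sum>v\<in>words M (length k). \<Sum>u\<in>words M l. \<phi> (v @ (u @ w)))"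
      unfolding sum_words_add by simp
    also have "\<dots> = (\<Sum>u\<in>words M l. \<Sum>v\<in>words M (length k). \<phi> (v @ (u @ w)))" by (rule sum.swap)
    also have "\<dots> \<le> (\<Sum>u\<in>words M l. K * \<phi> (u @ w))"
      by (intro sum_mono left_sum_le)
    also have "\<dots> = K * ?R" by (simp add: sum_distrib_left)
    finally show "(\<Sum>u\<in>words M l. \<phi> (u @ k @ w)) \<le> K * ?R" .
  qed
  also have "\<dots> = real (card F) * K * ?R" by simp
  finally show ?thesis unfolding kappa_def using card_F K_ge_1 by (simp add: field_simps)
qed

text \<open>
  Average the sums of $\phi$ over all right extensions by words of length $l$.
\<close>
lemma exists_right_consistent:
  obtains g where "\<And>w. g w = (\<Sum>a\<in>{1..M}. g (w @ [a]))" "\<And>w. \<kappa> * \<phi> w \<le> g w" "\<And>w. g w \<le> K * \<phi> w"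
proof -
  define f where "f l w = (\<Sum>v\<in>words M l. \<phi> (w @ v))" for l w
  have f_nonneg: "0 \<le> f l w" for l w by (simp add: f_def sum_nonneg nonneg)
  have f_le: "f l w \<le> K * \<phi> w" for l w unfolding f_def by (rule right_sum_le)
  obtain r g where r: "strict_mono (r :: nat \<Rightarrow> nat)"
    and g: "\<And>w. (\<lambda>k. (\<Sum>l<r k. f l w) / real (r k)) \<longlonglongrightarrow> g w"
    and g': "\<And>w. (\<lambda>k. (\<Sum>l<r k. f (Suc l) w) / real (r k)) \<longlonglongrightarrow> g w"
    using cesaro_subsequence[of f "\<lambda>w. K * \<phi> w", OF f_nonneg f_le] by blast
  have f_Suc: "f (Suc l) w = (\<Sum>a\<in>{1..M}. f l (w @ [a]))" for l w
    unfolding f_def using sum_words_add[of "\<lambda>v. \<phi> (w @ v)" M 1 l] by (simp add: sum_words_1[unfolded One_nat_def])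
  have "g w = (\<Sum>a\<in>{1..M}. g (w @ [a]))" for w
  proof (rule LIMSEQ_unique[OF g'])
    have "(\<Sum>l<n. f (Suc l) w) / real n = (\<Sum>a\<in>{1..M}. (\<Sum>l<n. f l (w @ [a])) / real n)" for n
      unfolding f_Suc sum_divide_distrib[symmetric] by (subst sum.swap) (rule refl)
    then show "(\<lambda>k. (\<Sum>l<r k. f (Suc l) w) / real (r k)) \<longlonglongrightarrow> (\<Sum>a\<in>{1..M}. g (w @ [a]))"
      by (simp only:) (intro tendsto_sum g)
  qed
  moreover have "\<kappa> * \<phi> w \<le> g w" "g w \<le> K * \<phi> w" for w
    using cesaro_bounds[of "\<kappa> * \<phi> w" "\<lambda>l. f l w" "K * \<phi> w" r "g w"] right_sum_ge f_le r g
    unfolding f_def by blast+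
  ultimately show thesis by (rule that)
qed

text \<open>
  Averaging the sums over left extensions of a right consistent function makes it left consistent and
  preserves right consistency. Left consistency is shift invariance.
\<close>
lemma exists_consistent:
  obtains m where "\<And>w. m w = (\<Sum>a\<in>{1..M}. m (w @ [a]))" "\<And>w. m w = (\<Sum>a\<in>{1..M}. m (a # w))"
    "\<And>w. \<kappa> * \<kappa> * \<phi> w \<le> m w" "\<And>w. m w \<le> K * K * \<phi> w"
proof -
  obtain h where h: "\<And>w. h w = (\<Sum>a\<in>{1..M}. h (w @ [a]))" "\<And>w. \<kappa> * \<phi> w \<le> h w" "\<And>w. h w \<le> K * \<phi> w"
    using exists_right_consistent by blast
  define f where "f l w = (\<Sum>u\<in>words M l. h (u @ w))" for l w
  have h_nonneg: "h w \<ge> 0" for w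
    using h(2)[of w] kappa_pos nonneg[of w] by (meson mult_nonneg_nonneg order_trans less_imp_le)
  have f_nonneg: "0 \<le> f l w" for l w by (simp add: f_def sum_nonneg h_nonneg)
  have f_le: "f l w \<le> K * K * \<phi> w" for l w
  proof -
    have "f l w \<le> (\<Sum>u\<in>words M l. K * \<phi> (u @ w))" unfolding f_def by (intro sum_mono h(3))
    also have "\<dots> \<le> K * (K * \<phi> w)"
      unfolding sum_distrib_left[symmetric] using K_ge_1 by (intro mult_left_mono left_sum_le) auto
    finally show ?thesis by simp
  qed
  have f_ge: "\<kappa> * \<kappa> * \<phi> w \<le> f l w" for l w
  proof -
    have "\<kappa> * (\<kappa> * \<phi> w) \<le> (\<Sum>u\<in>words M l. \<kappa> * \<phi> (u @ w))"
      unfolding sum_distrib_left[symmetric] using kappa_pos by (intro mult_left_mono left_sum_ge) auto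
    also have "\<dots> \<le> f l w" unfolding f_def by (intro sum_mono h(2))
    finally show ?thesis by simp
  qed
  obtain r m where r: "strict_mono (r :: nat \<Rightarrow> nat)"
    and m: "\<And>w. (\<lambda>k. (\<Sum>l<r k. f l w) / real (r k)) \<longlonglongrightarrow> m w"
    and m': "\<And>w. (\<lambda>k. (\<Sum>l<r k. f (Suc l) w) / real (r k)) \<longlonglongrightarrow> m w"
    using cesaro_subsequence[of f "\<lambda>w. K * K * \<phi> w", OF f_nonneg f_le] by blast
  have f_Suc: "f (Suc l) w = (\<Sum>a\<in>{1..M}. f l (a # w))" for l w
    unfolding f_def using sum_words_add[of "\<lambda>v. h (v @ w)" M l 1]
    by (simp add: sum_words_1[unfolded One_nat_def] sum.swap[of _ "words M l"])
  have f_right: "f l w = (\<Sum>a\<in>{1..M}. f l (w @ [a]))" for l w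
  proof -
    have "f l w = (\<Sum>u\<in>words M l. \<Sum>a\<in>{1..M}. h ((u @ w) @ [a]))"
      unfolding f_def by (intro sum.cong refl h(1))
    also have "\<dots> = (\<Sum>a\<in>{1..M}. f l (w @ [a]))" unfolding f_def by (subst sum.swap) simp
    finally show ?thesis .
  qed
  have "m w = (\<Sum>a\<in>{1..M}. m (a # w))" for w
  proof (rule LIMSEQ_unique[OF m'])
    have "(\<Sum>l<n. f (Suc l) w) / real n = (\<Sum>a\<in>{1..M}. (\<Sum>l<n. f l (a # w)) / real n)" for n
      unfolding f_Suc sum_divide_distrib[symmetric] by (subst sum.swap) (rule refl)
    then show "(\<lambda>k. (\<Sum>l<r k. f (Suc l) w) / real (r k)) \<longlonglongrightarrow> (\<Sum>a\<in>{1..M}. m (a # w))"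
      by (simp only:) (intro tendsto_sum m)
  qed
  moreover have "m w = (\<Sum>a\<in>{1..M}. m (w @ [a]))" for w
  proof (rule LIMSEQ_unique[OF m])
    have "(\<Sum>l<n. f l w) / real n = (\<Sum>a\<in>{1..M}. (\<Sum>l<n. f l (w @ [a])) / real n)" for n
    proof -
      have "(\<Sum>l<n. f l w) = (\<Sum>l<n. \<Sum>a\<in>{1..M}. f l (w @ [a]))"
        by (intro sum.cong refl f_right)
      also have "\<dots> = (\<Sum>a\<in>{1..M}. \<Sum>l<n. f l (w @ [a]))" by (rule sum.swap)
      finally show ?thesis by (simp only: sum_divide_distrib)
    qed
    then show "(\<lambda>k. (\<Sum>l<r k. f l w) / real (r k)) \<longlonglongrightarrow> (\<Sum>a\<in>{1..M}. m (w @ [a]))"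
      by (simp only:) (intro tendsto_sum m)
  qed
  moreover have "\<kappa> * \<kappa> * \<phi> w \<le> m w" "m w \<le> K * K * \<phi> w" for w
    using cesaro_bounds[of "\<kappa> * \<kappa> * \<phi> w" "\<lambda>l. f l w" "K * K * \<phi> w" r "m w"] f_ge f_le r m by blast+
  ultimately show thesis using that by blast
qed

end

section \<open>Invariant measures with prescribed masses of cylinders\<close>

lemma measure_cylset_sum:
  assumes N: "finite_measure N" "sets N = sets (full_shift_borel M)"
  shows "measure N (cylset M n W) = (\<Sum>w\<in>words M n \<inter> W. measure N (cylset M n {w}))"
proof -
  interpret finite_measure N by fact
  have "cylset M n W = (\<Union>w\<in>words M n \<inter> W. cylset M n {w})"
    using map_in_words by (auto simp: cylset_def)
  also have "measure N \<dots> = (\<Sum>w\<in>words M n \<inter> W. measure N (cylset M n {w}))"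
  proof (rule finite_measure_finite_Union)
    show "finite (words M n \<inter> W)" by (simp add: finite_words)
    show "(\<lambda>w. cylset M n {w}) ` (words M n \<inter> W) \<subseteq> sets N"
      unfolding N(2) sets_full_shift_borel by (auto simp: cylsets_def)
    show "disjoint_family_on (\<lambda>w. cylset M n {w}) (words M n \<inter> W)"
      by (auto simp: disjoint_family_on_def cylset_def)
  qed
  finally show ?thesis .
qed

lemma measure_eqI_cylinders:
  assumes N: "finite_measure N" "sets N = sets (full_shift_borel M)"
    and N': "finite_measure N'" "sets N' = sets (full_shift_borel M)"
    and eq: "\<And>n w. w \<in> words M n \<Longrightarrow> measure N (cylset M n {w}) = measure N' (cylset M n {w})"
  shows "N = N'"
proof (rule measure_eqI_generator_eq)
  let ?O = "topspace (full_shift M)"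
  interpret N: finite_measure N by fact
  interpret N': finite_measure N' by fact
  interpret algebra ?O "cylsets M" by (rule algebra_cylsets)
  show "Int_stable (cylsets M)" by (auto simp: Int_stable_def)
  show "cylsets M \<subseteq> Pow ?O" by (rule space_closed)
  show "sets N = sigma_sets ?O (cylsets M)" "sets N' = sigma_sets ?O (cylsets M)"
    using N(2) N'(2) by (simp_all add: sets_full_shift_borel)
  show "range (\<lambda>_ :: nat. ?O) \<subseteq> cylsets M" using top by auto
  show "(\<Union>i :: nat. ?O) = ?O" by simp
  show "emeasure N ?O \<noteq> \<infinity>" by simp
  fix U assume "U \<in> cylsets M"
  then obtain n W where U: "U = cylset M n W" by (auto simp: cylsets_def)
  have "measure N U = measure N' U"
    unfolding U measure_cylset_sum[OF N, of n W] measure_cylset_sum[OF N', of n W]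
    by (intro sum.cong refl) (simp add: eq)
  then show "emeasure N U = emeasure N' U"
    by (simp only: N.emeasure_eq_measure N'.emeasure_eq_measure)
qed

text \<open>
  Right consistency makes $m$ a probability on words of each length that is compatible with
  extension. The measure is obtained from Lebesgue measure on $[0,1)$: the words of length $n$ in
  lexicographic order tile $[0,1)$ by intervals of length $m(w)$, and a point is coded by the words
  of the intervals that contain it. Left consistency makes the image measure shift invariant.
\<close>
locale cylinder_mass =
  fixes M :: nat and m :: "nat list \<Rightarrow> real"
  assumes m_nonneg: "m w \<ge> 0" and m_Nil: "m [] = 1"
    and m_right: "m w = (\<Sum>a\<in>{1..M}. m (w @ [a]))"
    and m_left: "m w = (\<Sum>a\<in>{1..M}. m (a # w))"
begin

text \<open>
  The total mass of the words of the same length that precede $w$ lexicographically, grouped by the first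
  position $i$ where they differ from $w$.
\<close>
definition left_end :: "nat list \<Rightarrow> real" where
  "left_end w = (\<Sum>i<length w. \<Sum>b\<in>{1..<w ! i}. m (take i w @ [b]))"

definition cell :: "nat list \<Rightarrow> real set" where
  "cell w = {left_end w..<left_end w + m w}"

lemma left_end_snoc: "left_end (w @ [a]) = left_end w + (\<Sum>b\<in>{1..<a}. m (w @ [b]))"
proof -
  let ?f = "\<lambda>u i. \<Sum>b\<in>{1..<u ! i}. m (take i u @ [b])"
  have "left_end (w @ [a]) = (\<Sum>i<length w. ?f (w @ [a]) i) + ?f (w @ [a]) (length w)"
    unfolding left_end_def length_append_singleton by (rule sum.lessThan_Suc)
  also have "(\<Sum>i<length w. ?f (w @ [a]) i) = left_end w"
    unfolding left_end_def by (intro sum.cong refl) (simp_all add: nth_append)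
  also have "?f (w @ [a]) (length w) = (\<Sum>b\<in>{1..<a}. m (w @ [b]))"
    by (simp only: nth_append_length) simp
  finally show ?thesis .
qed

lemma left_end_snoc_Suc: "a \<ge> 1 \<Longrightarrow> left_end (w @ [Suc a]) = left_end (w @ [a]) + m (w @ [a])"
  by (simp add: left_end_snoc atLeastLessThanSuc)

lemma left_end_snoc_mono: "a \<le> b \<Longrightarrow> left_end (w @ [a]) \<le> left_end (w @ [b])"
  by (auto simp: left_end_snoc m_nonneg intro!: sum_mono2)

lemma left_end_snoc_last: "left_end (w @ [Suc M]) = left_end w + m w"
  by (simp add: left_end_snoc m_right[of w] atLeastLessThanSuc_atLeastAtMost)

lemma cell_child:
  assumes x: "x \<in> cell w"
  shows "\<exists>!a. a \<in> {1..M} \<and> x \<in> cell (w @ [a])"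
proof -
  have x1: "left_end (w @ [1]) \<le> x" and x2: "x < left_end (w @ [Suc M])"
    using x by (simp_all add: cell_def left_end_snoc_last, simp add: left_end_snoc)
  define a where "a = Max {a \<in> {1..M}. left_end (w @ [a]) \<le> x}"
  have M: "M \<ge> 1"
  proof (rule ccontr)
    assume "\<not> M \<ge> 1"
    then have "Suc M = 1" by simp
    then have "left_end (w @ [Suc M]) = left_end (w @ [1])" by (simp only:)
    with x1 x2 show False by linarith
  qed
  have fin: "finite {a \<in> {1..M}. left_end (w @ [a]) \<le> x}" by simp
  have "1 \<in> {a \<in> {1..M}. left_end (w @ [a]) \<le> x}" using x1 M by simp
  then have a: "a \<in> {1..M}" "left_end (w @ [a]) \<le> x"
    using Max_in[OF fin] unfolding a_def by blast+
  have "x < left_end (w @ [Suc a])"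
  proof (cases "a = M")
    case False
    then have "Suc a \<in> {1..M}" using a(1) by simp
    moreover have "Suc a \<notin> {a \<in> {1..M}. left_end (w @ [a]) \<le> x}"
      using Max_ge[OF fin, of "Suc a"] unfolding a_def[symmetric] by auto
    ultimately show ?thesis by simp
  qed (use x2 in simp)
  then have mem: "x \<in> cell (w @ [a])"
    using a left_end_snoc_Suc[of a w] by (simp add: cell_def)
  have "b = a" if b: "b \<in> {1..M}" "x \<in> cell (w @ [b])" for b
  proof (rule ccontr)
    assume "b \<noteq> a"
    have bx: "left_end (w @ [b]) \<le> x" "x < left_end (w @ [Suc b])"
      using b left_end_snoc_Suc[of b w] by (simp_all add: cell_def)
    show False
    proof (cases "a < b")
      case True
      then have "left_end (w @ [Suc a]) \<le> left_end (w @ [b])" by (intro left_end_snoc_mono) simp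
      with \<open>x < left_end (w @ [Suc a])\<close> bx(1) show False by linarith
    next
      case False
      then have "left_end (w @ [Suc b]) \<le> left_end (w @ [a])"
        using \<open>b \<noteq> a\<close> by (intro left_end_snoc_mono) simp
      with bx(2) a(2) show False by linarith
    qed
  qed
  with a(1) mem show ?thesis by blast
qed

lemma cell_snoc_subset: "a \<in> {1..M} \<Longrightarrow> cell (w @ [a]) \<subseteq> cell w"
proof -
  assume a: "a \<in> {1..M}"
  have "left_end w \<le> left_end (w @ [a])"
    by (simp add: left_end_snoc m_nonneg sum_nonneg)
  moreover have "left_end (w @ [a]) + m (w @ [a]) \<le> left_end w + m w"
    using a left_end_snoc_mono[of "Suc a" "Suc M" w] left_end_snoc_Suc[of a w] left_end_snoc_last[of w] by simp
  ultimately show ?thesis by (auto simp: cell_def)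
qed

definition next_letter :: "nat list \<Rightarrow> real \<Rightarrow> nat" where
  "next_letter w x = (THE a. a \<in> {1..M} \<and> x \<in> cell (w @ [a]))"

primrec code_word :: "nat \<Rightarrow> real \<Rightarrow> nat list" where
  "code_word 0 x = []"
| "code_word (Suc n) x = code_word n x @ [next_letter (code_word n x) x]"

definition code :: "real \<Rightarrow> nat \<Rightarrow> nat" where
  "code x n = next_letter (code_word n x) x"

lemma initial_code: "initial n (code x) = code_word n x"
  by (induction n) (simp_all add: code_def)

lemma cell_Nil: "cell [] = {0..<1}"
  by (simp add: cell_def left_end_def m_Nil)

lemma code_word_cell:
  assumes x: "x \<in> {0..<1}"
  shows "code_word n x \<in> words M n \<and> x \<in> cell (code_word n x)"
proof (induction n)
  case 0
  then show ?case using x by (simp add: words_0 cell_Nil)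
next
  case (Suc n)
  have "next_letter (code_word n x) x \<in> {1..M} \<and> x \<in> cell (code_word n x @ [next_letter (code_word n x) x])"
    unfolding next_letter_def by (rule theI'[OF cell_child]) (use Suc in blast)
  then show ?case using Suc by (auto simp: words_iff)
qed

lemma code_word_unique:
  assumes "w \<in> words M n" "x \<in> cell w"
  shows "x \<in> {0..<1} \<and> code_word n x = w"
  using assms
proof (induction n arbitrary: w)
  case 0
  then show ?case by (simp add: words_0 cell_Nil)
next
  case (Suc n)
  then have "w \<noteq> []" by (auto simp: words_iff)
  then obtain v a where w: "w = v @ [a]" by (metis append_butlast_last_id)
  have v: "v \<in> words M n" and a: "a \<in> {1..M}" using Suc.prems(1) by (auto simp: w words_iff)
  have "x \<in> cell v" using cell_snoc_subset[OF a, of v] Suc.prems(2) unfolding w by blast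
  then have IH: "x \<in> {0..<1} \<and> code_word n x = v" using Suc.IH[OF v] by blast
  have "next_letter v x = a"
    unfolding next_letter_def
    using cell_child[OF \<open>x \<in> cell v\<close>] a Suc.prems(2) unfolding w by (intro the1_equality) auto
  then show ?case using IH by (simp add: w)
qed

abbreviation unit_interval :: "real measure" where
  "unit_interval \<equiv> restrict_space lborel {0..<1}"

lemma code_in_full_shift: "x \<in> {0..<1} \<Longrightarrow> code x \<in> topspace (full_shift M)"
proof -
  assume x: "x \<in> {0..<1}"
  have "code x n \<in> {1..M}" for n
    using code_word_cell[OF x, of "Suc n"] by (auto simp: words_iff code_def)
  then show ?thesis by (simp add: mem_full_shift)
qed

lemma code_vimage: "code -` cylset M n {w} \<inter> {0..<1} = cell w" if w: "w \<in> words M n"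
proof (intro equalityI subsetI)
  fix x assume x: "x \<in> code -` cylset M n {w} \<inter> {0..<1}"
  then have "code_word n x = w" by (auto simp: cylset_def initial_code)
  then show "x \<in> cell w" using code_word_cell[of x n] x by auto
next
  fix x assume "x \<in> cell w"
  then have "x \<in> {0..<1}" "code_word n x = w" using code_word_unique[OF w] by auto
  then show "x \<in> code -` cylset M n {w} \<inter> {0..<1}"
    using code_in_full_shift[of x] by (auto simp: cylset_def initial_code)
qed

lemma space_interval: "space unit_interval = {0..<1}"
  by (simp add: space_restrict_space)

lemma cell_subset: "w \<in> words M n \<Longrightarrow> cell w \<subseteq> {0..<1}"
  using code_word_unique by blast

lemma cell_sets: "w \<in> words M n \<Longrightarrow> cell w \<in> sets unit_interval"
  using cell_subset[of w n] by (subst sets_restrict_space_iff) (auto simp: cell_def)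

lemma measurable_code: "code \<in> measurable unit_interval (full_shift_borel M)"
proof (rule measurable_sigma_sets[OF sets_full_shift_borel])
  show "cylsets M \<subseteq> Pow (topspace (full_shift M))" by (auto simp: cylsets_def cylset_def)
  show "code \<in> space unit_interval \<rightarrow> topspace (full_shift M)"
    unfolding space_interval using code_in_full_shift by blast
  fix U assume "U \<in> cylsets M"
  then obtain n W where U: "U = cylset M n W" by (auto simp: cylsets_def)
  have "cylset M n W = (\<Union>w\<in>words M n \<inter> W. cylset M n {w})"
    using map_in_words by (auto simp: cylset_def)
  then have "code -` U \<inter> space unit_interval = (\<Union>w\<in>words M n \<inter> W. code -` cylset M n {w} \<inter> {0..<1})"
    unfolding U space_interval by blast
  also have "\<dots> = (\<Union>w\<in>words M n \<inter> W. cell w)" using code_vimage by auto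
  also have "\<dots> \<in> sets unit_interval"
    using finite_words by (intro sets.finite_UN) (auto intro: cell_sets)
  finally show "code -` U \<inter> space unit_interval \<in> sets unit_interval" .
qed

definition coded_measure :: "(nat \<Rightarrow> nat) measure" where
  "coded_measure = distr unit_interval (full_shift_borel M) code"

lemma cylset_sets: "cylset M n W \<in> sets (full_shift_borel M)"
  unfolding sets_full_shift_borel by (auto simp: cylsets_def)

lemma measure_coded_cylinder:
  assumes w: "w \<in> words M n"
  shows "measure coded_measure (cylset M n {w}) = m w"
proof -
  have "measure coded_measure (cylset M n {w}) = measure unit_interval (cell w)"
    unfolding coded_measure_def
    by (subst measure_distr[OF measurable_code cylset_sets]) (simp add: code_vimage[OF w] space_interval)
  also have "\<dots> = measure lborel (cell w)"
    using cell_subset[OF w] by (intro measure_restrict_space) auto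
  also have "\<dots> = m w"
    using m_nonneg[of w] by (simp add: cell_def)
  finally show ?thesis .
qed

lemma prob_space_coded: "prob_space coded_measure"
proof -
  have "emeasure unit_interval (space unit_interval) = 1"
    unfolding space_interval by (subst emeasure_restrict_space) auto
  then have "prob_space unit_interval" by (rule prob_spaceI)
  then show ?thesis unfolding coded_measure_def using measurable_code by (rule prob_space.prob_space_distr)
qed

lemma sets_coded: "sets coded_measure = sets (full_shift_borel M)"
  by (simp add: coded_measure_def)

lemma coded_invariant: "coded_measure \<in> invariant_measures M"
proof -
  interpret prob_space coded_measure by (rule prob_space_coded)
  have meas: "shift \<in> measurable coded_measure coded_measure"
    by (rule measurable_shift_full_shift[OF sets_coded])
  have "distr coded_measure coded_measure shift = coded_measure"
  proof (rule measure_eqI_cylinders[where M = M])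
    show "finite_measure (distr coded_measure coded_measure shift)"
      using prob_space_distr[OF meas] by (simp add: prob_space_def)
    show "finite_measure coded_measure" by (rule finite_measure_axioms)
    show "sets (distr coded_measure coded_measure shift) = sets (full_shift_borel M)"
      "sets coded_measure = sets (full_shift_borel M)" by (simp_all add: sets_coded)
    fix n w assume w: "w \<in> words M n"
    have sp: "space coded_measure = topspace (full_shift M)"
      using sets_eq_imp_space_eq[OF sets_coded] by (simp add: space_full_shift_borel)
    have init: "initial (Suc n) x = x 0 # initial n (shift x)" for x :: "nat \<Rightarrow> nat"
      using initial_add[where m = 1 and n = n and x = x] by (simp add: shift_iterate shift_def)
    have "measure (distr coded_measure coded_measure shift) (cylset M n {w})
        = measure coded_measure (shift -` cylset M n {w} \<inter> space coded_measure)"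
      by (rule measure_distr[OF meas]) (simp add: sets_coded cylset_sets)
    also have "shift -` cylset M n {w} \<inter> space coded_measure = cylset M (Suc n) {v. tl v = w}"
      unfolding cylset_def sp using shift_in_full_shift by (auto simp: init simp del: upt_Suc)
    also have "measure coded_measure \<dots> = (\<Sum>v\<in>words M (Suc n) \<inter> {v. tl v = w}. m v)"
      unfolding measure_cylset_sum[OF finite_measure_axioms sets_coded, of "Suc n" "{v. tl v = w}"]
      by (intro sum.cong refl) (simp add: measure_coded_cylinder)
    also have "words M (Suc n) \<inter> {v. tl v = w} = (\<lambda>a. a # w) ` {1..M}"
    proof (intro equalityI subsetI)
      fix v assume v: "v \<in> words M (Suc n) \<inter> {v. tl v = w}"
      then obtain a u where au: "v = a # u" by (cases v) (auto simp: words_iff)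
      then have "v = a # w" "a \<in> {1..M}" using v by (simp_all add: words_iff)
      then show "v \<in> (\<lambda>a. a # w) ` {1..M}" by blast
    next
      fix v assume "v \<in> (\<lambda>a. a # w) ` {1..M}"
      then obtain a where "v = a # w" "a \<in> {1..M}" by blast
      then show "v \<in> words M (Suc n) \<inter> {v. tl v = w}" using w by (simp add: words_iff)
    qed
    also have "(\<Sum>v\<in>(\<lambda>a. a # w) ` {1..M}. m v) = m w"
      by (subst sum.reindex) (auto simp: inj_on_def m_left[of w])
    finally show "measure (distr coded_measure coded_measure shift) (cylset M n {w})
        = measure coded_measure (cylset M n {w})" by (simp add: measure_coded_cylinder[OF w])
  qed
  then show ?thesis unfolding invariant_measures_def using sets_coded prob_space_coded by blast
qed

lemma exists_invariant_measure: "\<exists>\<mu>\<in>invariant_measures M. \<forall>w\<in>lists {1..M}. cyl_prob \<mu> w = m w"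
proof
  show "coded_measure \<in> invariant_measures M" by (rule coded_invariant)
  then interpret shift_invariant M coded_measure by unfold_locales
  show "\<forall>w\<in>lists {1..M}. cyl_prob coded_measure w = m w"
    using measure_coded_cylinder by (auto simp: cyl_prob_altdef words_iff)
qed

end

section \<open>Gibbs measures: existence, ergodicity and uniqueness\<close>

text \<open>
  Let $f$ be the density of $\nu$ and $E = \{f > 1\}$. Both measures are invariant, so
  $E \setminus T^{-1}E$ and $T^{-1}E \setminus E$ have equal measure with respect to each of them. On the
  first of these sets $\nu$ exceeds $\mu$ and on the second it does not, so both
  sets have the same measure for $\nu$ as for $\mu$, which for a subset of $E$ is possible only if it
  is null. Hence $E$ is invariant up to null sets and by
  ergodicity has measure $0$ or $1$. Measure $1$ is impossible as $f$ has integral $1$, so $f \leq 1$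
  almost everywhere, and then $f = 1$.
\<close>
lemma absolutely_continuous_invariant_eq:
  assumes mu: "measure_preserving_system \<mu> T" and nu: "measure_preserving_system \<nu> T"
    and sets: "sets \<nu> = sets \<mu>" and ac: "absolutely_continuous \<mu> \<nu>"
    and ergodic: "\<And>E. E \<in> sets \<mu> \<Longrightarrow> measure \<mu> (sym_diff E (T -` E \<inter> space \<mu>)) = 0 \<Longrightarrow>
      measure \<mu> E = 0 \<or> measure \<mu> E = 1"
  shows "\<nu> = \<mu>"
proof -
  interpret mu: measure_preserving_system \<mu> T by fact
  interpret nu: measure_preserving_system \<nu> T by fact
  have space: "space \<nu> = space \<mu>" using sets by (rule sets_eq_imp_space_eq)
  obtain f where f: "f \<in> borel_measurable \<mu>" "density \<mu> f = \<nu>"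
    using mu.Radon_Nikodym[OF ac sets] by blast
  have em: "emeasure \<nu> G = (\<integral>\<^sup>+x. f x * indicator G x \<partial>\<mu>)" if "G \<in> sets \<mu>" for G
    using emeasure_density[OF f(1) that] f(2) by simp
  define E where "E = {x \<in> space \<mu>. f x > 1}"
  have E: "E \<in> sets \<mu>" unfolding E_def using f(1) by measurable
  have ind: "emeasure \<mu> G = (\<integral>\<^sup>+x. indicator G x \<partial>\<mu>)" if "G \<in> sets \<mu>" for G
    using that by simp
  have above: "emeasure \<mu> G \<le> emeasure \<nu> G" if G: "G \<in> sets \<mu>" "G \<subseteq> E" for G
    unfolding em[OF G(1)] ind[OF G(1)]
    using G(2) by (intro nn_integral_mono) (auto simp: indicator_def E_def)
  have below: "emeasure \<nu> G \<le> emeasure \<mu> G" if G: "G \<in> sets \<mu>" "G \<inter> E = {}" for G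
    unfolding em[OF G(1)] ind[OF G(1)]
    using G(2) by (intro nn_integral_mono) (auto simp: indicator_def E_def not_less)
  have strict: "emeasure \<mu> G = 0" if G: "G \<in> sets \<mu>" "G \<subseteq> E" "emeasure \<nu> G = emeasure \<mu> G" for G
  proof -
    have "emeasure \<nu> G = (\<integral>\<^sup>+x. indicator G x + (f x - 1) * indicator G x \<partial>\<mu>)"
      unfolding em[OF G(1)]
    proof (intro nn_integral_cong)
      fix x
      show "f x * indicator G x = indicator G x + (f x - 1) * indicator G x"
      proof (cases "x \<in> G")
        case True
        then have "1 \<le> f x" using G(2) by (auto simp: E_def)
        then have eq: "1 + (f x - 1) = f x" by (rule add_diff_inverse_ennreal)
        show ?thesis using True by (simp add: eq)
      qed simp
    qed
    also have "\<dots> = emeasure \<mu> G + (\<integral>\<^sup>+x. (f x - 1) * indicator G x \<partial>\<mu>)"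
      using G(1) f(1) by (subst nn_integral_add) auto
    finally have "emeasure \<mu> G + 0 = emeasure \<mu> G + (\<integral>\<^sup>+x. (f x - 1) * indicator G x \<partial>\<mu>)"
      using G(3) by simp
    then have zero: "(\<integral>\<^sup>+x. (f x - 1) * indicator G x \<partial>\<mu>) = 0"
      using mu.emeasure_finite[of G] by (simp add: ennreal_add_left_cancel)
    have meas: "(\<lambda>x. (f x - 1) * indicator G x) \<in> borel_measurable \<mu>" using f(1) G(1) by measurable
    have "AE x in \<mu>. (f x - 1) * indicator G x = 0"
      using zero nn_integral_0_iff_AE[OF meas] by simp
    then have "AE x in \<mu>. x \<notin> G"
    proof eventually_elim
      case (elim x)
      show ?case
      proof
        assume x: "x \<in> G"
        then have "f x - 1 = 0" using elim by simp
        then have "f x \<le> 1" by (simp add: diff_eq_0_iff_ennreal)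
        with x G(2) show False by (auto simp: E_def)
      qed
    qed
    then have "G \<in> null_sets \<mu>" using G(1) by (simp add: AE_iff_null_sets)
    then show ?thesis by auto
  qed
  define E' where "E' = T -` E \<inter> space \<mu>"
  have E': "E' \<in> sets \<mu>" unfolding E'_def using mu.measurable_T E by (rule measurable_sets)
  have mu_inv: "emeasure \<mu> E' = emeasure \<mu> E"
    using emeasure_distr[OF mu.measurable_T E] by (simp add: mu.distr_T E'_def)
  have nu_inv: "emeasure \<nu> E' = emeasure \<nu> E"
  proof -
    have "E \<in> sets \<nu>" using E sets by simp
    from emeasure_distr[OF nu.measurable_T this] show ?thesis
      by (simp add: nu.distr_T E'_def space)
  qed
  have diff_eq: "emeasure L (E - E') = emeasure L (E' - E)"
    if "finite_measure L" "sets L = sets \<mu>" "emeasure L E' = emeasure L E" for L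
  proof -
    interpret L: finite_measure L by fact
    have EL: "E \<in> sets L" "E' \<in> sets L" using E E' that(2) by auto
    have "measure L (E - E') = measure L E - measure L (E \<inter> E')"
      "measure L (E' - E) = measure L E' - measure L (E \<inter> E')"
      using L.finite_measure_Diff'[OF EL] L.finite_measure_Diff'[OF EL(2,1)] by (simp_all add: Int_commute)
    moreover have "measure L E' = measure L E" using that(3) by (simp add: measure_def)
    ultimately show ?thesis by (simp add: L.emeasure_eq_measure)
  qed
  have d_mu: "emeasure \<mu> (E - E') = emeasure \<mu> (E' - E)"
    by (rule diff_eq) (simp_all add: mu.finite_measure_axioms mu_inv)
  have d_nu: "emeasure \<nu> (E - E') = emeasure \<nu> (E' - E)"
    by (rule diff_eq) (simp_all add: nu.finite_measure_axioms nu_inv sets)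
  have D: "E - E' \<in> sets \<mu>" "E' - E \<in> sets \<mu>" using E E' by auto
  have "emeasure \<mu> (E - E') \<le> emeasure \<nu> (E - E')" by (rule above[OF D(1)]) blast
  moreover have "emeasure \<nu> (E' - E) \<le> emeasure \<mu> (E' - E)" by (rule below[OF D(2)]) blast
  ultimately have "emeasure \<nu> (E - E') = emeasure \<mu> (E - E')"
    using d_mu d_nu by (intro antisym) simp_all
  then have z1: "emeasure \<mu> (E - E') = 0" by (intro strict D(1)) auto
  then have z2: "emeasure \<mu> (E' - E) = 0" using d_mu by simp
  have "emeasure \<mu> (sym_diff E E') \<le> emeasure \<mu> (E - E') + emeasure \<mu> (E' - E)"
    using D by (rule emeasure_subadditive)
  then have "emeasure \<mu> (sym_diff E E') = 0" using z1 z2 by simp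
  then have "measure \<mu> (sym_diff E E') = 0" by (simp add: measure_def)
  then have "measure \<mu> E = 0 \<or> measure \<mu> E = 1" unfolding E'_def by (rule ergodic[OF E])
  moreover have "measure \<mu> E \<noteq> 1"
  proof
    assume one: "measure \<mu> E = 1"
    then have mE: "emeasure \<mu> E = 1" by (simp add: mu.emeasure_eq_measure)
    have "emeasure \<nu> E \<le> 1" using nu.prob_le_1[of E] by (simp add: nu.emeasure_eq_measure)
    then have "emeasure \<nu> E = emeasure \<mu> E" using above[OF E order_refl] mE by (intro antisym) simp_all
    then have "emeasure \<mu> E = 0" by (intro strict E) auto
    with mE show False by simp
  qed
  ultimately have "measure \<mu> E = 0" by blast
  then have E0: "E \<in> null_sets \<mu>" using E by (simp add: null_sets_def mu.emeasure_eq_measure)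
  then have E0': "E \<in> null_sets \<nu>" using ac unfolding absolutely_continuous_def by blast
  have le: "measure \<nu> G \<le> measure \<mu> G" if G: "G \<in> sets \<mu>" for G
  proof -
    have "emeasure \<nu> G = emeasure \<nu> (G - E)"
      using emeasure_Diff_null_set[OF E0'] G sets by simp
    also have "\<dots> \<le> emeasure \<mu> (G - E)" using G E by (intro below) auto
    also have "\<dots> = emeasure \<mu> G" using emeasure_Diff_null_set[OF E0 G] by simp
    finally show ?thesis by (simp add: mu.emeasure_eq_measure nu.emeasure_eq_measure)
  qed
  show ?thesis
  proof (rule measure_eqI[OF sets])
    fix G assume "G \<in> sets \<nu>"
    then have G: "G \<in> sets \<mu>" by (simp add: sets)
    have "measure \<nu> (space \<mu> - G) \<le> measure \<mu> (space \<mu> - G)" using G by (intro le) auto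
    then have "1 - measure \<nu> G \<le> 1 - measure \<mu> G"
      using mu.prob_compl[OF G] nu.prob_compl[of G] G by (simp add: sets space)
    then have "measure \<nu> G = measure \<mu> G" using le[OF G] by linarith
    then show "emeasure \<nu> G = emeasure \<mu> G" by (simp add: mu.emeasure_eq_measure nu.emeasure_eq_measure)
  qed
qed

definition (in quasi_bernoulli) gibbs :: "(nat \<Rightarrow> nat) measure \<Rightarrow> real \<Rightarrow> bool" where
  "gibbs \<mu> D \<longleftrightarrow> D > 0 \<and> (\<forall>w\<in>lists {1..M}. cyl_prob \<mu> w \<le> D * \<phi> w \<and> \<phi> w \<le> D * cyl_prob \<mu> w)"

lemma (in quasi_bernoulli) exists_gibbs:
  obtains \<mu> D where "\<mu> \<in> invariant_measures M" "gibbs \<mu> D"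
proof -
  obtain m where m: "\<And>w. m w = (\<Sum>a\<in>{1..M}. m (w @ [a]))" "\<And>w. m w = (\<Sum>a\<in>{1..M}. m (a # w))"
    "\<And>w. \<kappa> * \<kappa> * \<phi> w \<le> m w" "\<And>w. m w \<le> K * K * \<phi> w"
    using exists_consistent by blast
  have "\<phi> [] \<ge> 1" using sum_ge_1[of 0] by (simp add: partition_sum_def words_0)
  then have "0 < \<kappa> * \<kappa> * \<phi> []" using kappa_pos by simp
  then have m0: "m [] > 0" using m(3)[of "[]"] by linarith
  have m_nonneg: "m w \<ge> 0" for w
  proof -
    have "0 \<le> \<kappa> * \<kappa> * \<phi> w" using kappa_pos nonneg by simp
    then show ?thesis using m(3)[of w] by linarith
  qed
  interpret cm: cylinder_mass M "\<lambda>w. m w / m []"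
  proof
    show "0 \<le> m w / m []" for w using m_nonneg m0 by simp
    show "m [] / m [] = 1" using m0 by simp
    show "m w / m [] = (\<Sum>a\<in>{1..M}. m (w @ [a]) / m [])" for w
      unfolding sum_divide_distrib[symmetric] using m(1)[of w] by simp
    show "m w / m [] = (\<Sum>a\<in>{1..M}. m (a # w) / m [])" for w
      unfolding sum_divide_distrib[symmetric] using m(2)[of w] by simp
  qed
  obtain \<mu> where \<mu>: "\<mu> \<in> invariant_measures M" "\<And>w. w \<in> lists {1..M} \<Longrightarrow> cyl_prob \<mu> w = m w / m []"
    using cm.exists_invariant_measure by blast
  define D where "D = max (K * K / m []) (m [] / (\<kappa> * \<kappa>))"
  have D: "D > 0" unfolding D_def using K_ge_1 m0 by (simp add: less_max_iff_disj)
  have "m w / m [] \<le> D * \<phi> w \<and> \<phi> w \<le> D * (m w / m [])" for w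
  proof
    have "m w / m [] \<le> K * K / m [] * \<phi> w" using m(4)[of w] m0 by (simp add: field_simps)
    also have "\<dots> \<le> D * \<phi> w" unfolding D_def by (intro mult_right_mono nonneg) simp
    finally show "m w / m [] \<le> D * \<phi> w" .
    have "\<phi> w \<le> m [] / (\<kappa> * \<kappa>) * (m w / m [])" using m(3)[of w] kappa_pos m0 by (simp add: field_simps)
    also have "\<dots> \<le> D * (m w / m [])"
      unfolding D_def using m_nonneg[of w] m0 by (intro mult_right_mono) auto
    finally show "\<phi> w \<le> D * (m w / m [])" .
  qed
  then have "gibbs \<mu> D" unfolding gibbs_def using D \<mu>(2) by simp
  with \<mu>(1) show thesis by (rule that)
qed

locale quasi_bernoulli_invariant = quasi_bernoulli M \<phi> F c K + shift_invariant M \<nu>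
  for M \<phi> F c K \<nu>
begin

definition admissible :: bool where
  "admissible \<longleftrightarrow> (\<forall>w\<in>lists {1..M}. cyl_prob \<nu> w > 0 \<longrightarrow> \<phi> w > 0)"

definition energy :: "nat \<Rightarrow> real" where
  "energy n = (\<Sum>w\<in>words M n. cyl_prob \<nu> w * ln (\<phi> w))"

lemma admissible_pos: "admissible \<Longrightarrow> w \<in> words M n \<Longrightarrow> cyl_prob \<nu> w > 0 \<Longrightarrow> \<phi> w > 0"
  unfolding admissible_def using words_subset_lists by blast

text \<open>
  The Gibbs inequality with the weights $\phi$ in place of probabilities.
\<close>
lemma free_energy_le:
  assumes "admissible"
  shows "word_entropy n + energy n \<le> K - 1"
proof -
  have "shannon \<nu> (initial n) \<le> - (\<Sum>w\<in>words M n. law \<nu> (initial n) w * ln (\<phi> w)) + (sum \<phi> (words M n) - 1)"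
  proof (rule shannon_le_cross_entropy[OF simple_function_initial finite_words])
    show "initial n ` space \<nu> \<subseteq> words M n" using initial_in_words by blast
    show "0 \<le> \<phi> w" for w by (rule nonneg)
    show "0 < \<phi> w" if "w \<in> words M n" "0 < law \<nu> (initial n) w" for w
      using admissible_pos[OF assms that(1)] that by (simp add: law_initial)
  qed
  also have "(\<Sum>w\<in>words M n. law \<nu> (initial n) w * ln (\<phi> w)) = energy n"
    unfolding energy_def by (intro sum.cong refl) (simp add: law_initial)
  finally show ?thesis
    using sum_le_K[of n] unfolding word_entropy_def partition_sum_def by linarith
qed

lemma gibbs_free_energy_ge:
  assumes "gibbs \<nu> D"
  shows "word_entropy n + energy n \<ge> - ln D" and "admissible"
proof -
  have D: "D > 0" and g: "\<And>w. w \<in> lists {1..M} \<Longrightarrow> cyl_prob \<nu> w \<le> D * \<phi> w"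
    using assms unfolding gibbs_def by auto
  show adm: "admissible"
    unfolding admissible_def
  proof (intro ballI impI)
    fix w assume "w \<in> lists {1..M}" "0 < cyl_prob \<nu> w"
    then have "0 < D * \<phi> w" using g[of w] by linarith
    then show "0 < \<phi> w" using D by (simp add: zero_less_mult_iff)
  qed
  have "cyl_prob \<nu> w * (- ln D) \<le> cyl_prob \<nu> w * ln (\<phi> w) - cyl_prob \<nu> w * ln (cyl_prob \<nu> w)"
    if w: "w \<in> words M n" for w
  proof (cases "cyl_prob \<nu> w = 0")
    case False
    then have pos: "cyl_prob \<nu> w > 0" using cyl_prob_nonneg[of w] by linarith
    have \<phi>: "\<phi> w > 0" by (rule admissible_pos[OF adm w pos])
    have "ln (cyl_prob \<nu> w) \<le> ln (D * \<phi> w)"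
      using g[of w] w words_subset_lists pos by (intro ln_mono) auto
    also have "\<dots> = ln D + ln (\<phi> w)" using D \<phi> by (simp add: ln_mult)
    finally have "- ln D \<le> ln (\<phi> w) - ln (cyl_prob \<nu> w)" by simp
    then have "cyl_prob \<nu> w * (- ln D) \<le> cyl_prob \<nu> w * (ln (\<phi> w) - ln (cyl_prob \<nu> w))"
      using pos by (intro mult_left_mono) auto
    then show ?thesis by (simp only: right_diff_distrib)
  qed simp
  then have "(\<Sum>w\<in>words M n. cyl_prob \<nu> w * (- ln D))
      \<le> (\<Sum>w\<in>words M n. cyl_prob \<nu> w * ln (\<phi> w) - cyl_prob \<nu> w * ln (cyl_prob \<nu> w))"
    by (rule sum_mono)
  then show "word_entropy n + energy n \<ge> - ln D"
    using sum_cyl_prob[of n]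
    unfolding word_entropy_eq energy_def sum_subtractf sum_distrib_right[symmetric] by simp
qed

text \<open>
  The hypothesis bounds the relative entropy of $\nu$ with respect to $\phi$, hence to $\mu$, on words of
  every length. Suppose that $\nu(G) = a > 0 = \mu(G)$ and approximate $G$ by a union $U$ of
  cylinders. The words in $U$ carry at least half of $a$ for $\nu$ but very little $\phi$-mass, so
  that their contribution to word entropy plus energy is very negative, while the remaining words
  contribute at most $K$.
\<close>
lemma absolutely_continuous_of_free_energy:
  assumes adm: "admissible" and free: "\<And>n. word_entropy n + energy n \<ge> 0"
    and \<mu>: "\<mu> \<in> invariant_measures M" and gibbs: "gibbs \<mu> D"
  shows "absolutely_continuous \<mu> \<nu>"
proof -
  interpret mu: shift_invariant M \<mu> by unfold_locales (rule \<mu>)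
  have D: "D > 0" and g: "\<And>w. w \<in> lists {1..M} \<Longrightarrow> \<phi> w \<le> D * cyl_prob \<mu> w"
    using gibbs unfolding gibbs_def by auto
  have "measure \<nu> G = 0" if G: "G \<in> sets \<mu>" "measure \<mu> G = 0" for G
  proof (rule ccontr)
    assume "measure \<nu> G \<noteq> 0"
    define a where "a = measure \<nu> G"
    have a: "a > 0" using \<open>measure \<nu> G \<noteq> 0\<close> measure_nonneg[of \<nu> G] unfolding a_def by linarith
    \<comment> \<open>Then (a / 2) ln b = - (K + 2), which outweighs all other contributions.\<close>
    define b where "b = exp (- (2 * (K + 2) / a))"
    have b: "b > 0" "ln b = - (2 * (K + 2) / a)" by (simp_all add: b_def)
    define e where "e = min (a / 2) (b / D)"
    have e: "e > 0" using a b(1) D by (simp add: e_def)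
    have G_nu: "G \<in> sets \<nu>" using G(1) by (simp add: sets_\<nu> mu.sets_\<nu>)
    obtain n W where approx: "measure \<nu> (sym_diff G (cylset M n W)) + measure \<mu> (sym_diff G (cylset M n W)) < e"
      using approx_by_cylset_two_measures[OF finite_measure_axioms sets_\<nu> mu.finite_measure_axioms mu.sets_\<nu> G_nu e] by blast
    let ?U = "cylset M n W"
    have "a \<le> measure \<nu> (?U \<union> sym_diff G ?U)"
      unfolding a_def using G_nu by (intro finite_measure_mono) auto
    also have "\<dots> \<le> measure \<nu> ?U + measure \<nu> (sym_diff G ?U)"
      using G_nu by (intro measure_Un_le) auto
    finally have nuU: "measure \<nu> ?U \<ge> a / 2"
      using approx measure_nonneg[of \<mu> "sym_diff G ?U"] unfolding e_def by linarith
    have "measure \<mu> ?U \<le> measure \<mu> (G \<union> sym_diff G ?U)"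
      using G(1) by (intro mu.finite_measure_mono) auto
    also have "\<dots> \<le> measure \<mu> G + measure \<mu> (sym_diff G ?U)"
      using G(1) by (intro measure_Un_le) auto
    finally have "measure \<mu> ?U \<le> b / D"
      using approx G(2) measure_nonneg[of \<nu> "sym_diff G ?U"] unfolding e_def by linarith
    then have muU: "D * measure \<mu> ?U \<le> b" using D by (simp add: field_simps)
    have "(\<Sum>w\<in>words M n \<inter> W. \<phi> w) \<le> (\<Sum>w\<in>words M n \<inter> W. D * cyl_prob \<mu> w)"
      using words_subset_lists by (intro sum_mono g) blast
    also have "\<dots> = D * measure \<mu> ?U" by (simp add: mu.measure_cylset sum_distrib_left)
    finally have phiU: "(\<Sum>w\<in>words M n \<inter> W. \<phi> w) \<le> b" using muU by linarith
    have term_le: "cyl_prob \<nu> w * ln (\<phi> w) - cyl_prob \<nu> w * ln (cyl_prob \<nu> w)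
        \<le> \<phi> w / t + cyl_prob \<nu> w * ln t" if w: "w \<in> words M n" and t: "t > 0" for w t
    proof (cases "cyl_prob \<nu> w = 0")
      case True
      then show ?thesis using nonneg[of w] t by simp
    next
      case False
      then have pos: "cyl_prob \<nu> w > 0" using cyl_prob_nonneg[of w] by linarith
      have \<phi>: "\<phi> w > 0" by (rule admissible_pos[OF adm w pos])
      have "ln (\<phi> w / (t * cyl_prob \<nu> w)) \<le> \<phi> w / (t * cyl_prob \<nu> w) - 1"
        using pos \<phi> t by (intro ln_le_minus_one) simp
      then have "ln (\<phi> w) - ln t - ln (cyl_prob \<nu> w) \<le> \<phi> w / (t * cyl_prob \<nu> w)"
        using pos \<phi> t by (simp add: ln_div ln_mult)
      then have "cyl_prob \<nu> w * (ln (\<phi> w) - ln t - ln (cyl_prob \<nu> w)) \<le> cyl_prob \<nu> w * (\<phi> w / (t * cyl_prob \<nu> w))"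
        using pos by (intro mult_left_mono) auto
      also have "\<dots> = \<phi> w / t" using pos t by simp
      finally show ?thesis by (simp add: algebra_simps)
    qed
    let ?T = "\<lambda>w. cyl_prob \<nu> w * ln (\<phi> w) - cyl_prob \<nu> w * ln (cyl_prob \<nu> w)"
    have "word_entropy n + energy n = (\<Sum>w\<in>words M n. ?T w)"
      unfolding word_entropy_eq energy_def sum_subtractf by simp
    also have "\<dots> = (\<Sum>w\<in>words M n \<inter> W. ?T w) + (\<Sum>w\<in>words M n - W. ?T w)"
      by (subst sum.union_disjoint[symmetric]) (auto simp: finite_words Int_Diff_Un)
    also have "\<dots> \<le> (\<Sum>w\<in>words M n \<inter> W. \<phi> w / b + cyl_prob \<nu> w * ln b) + (\<Sum>w\<in>words M n - W. \<phi> w)"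
    proof (intro add_mono sum_mono)
      show "?T w \<le> \<phi> w / b + cyl_prob \<nu> w * ln b" if "w \<in> words M n \<inter> W" for w
        using term_le[of w b] that b(1) by blast
      show "?T w \<le> \<phi> w" if "w \<in> words M n - W" for w
        using term_le[of w 1] that by simp
    qed
    also have "(\<Sum>w\<in>words M n \<inter> W. \<phi> w / b + cyl_prob \<nu> w * ln b)
        = (\<Sum>w\<in>words M n \<inter> W. \<phi> w) / b + measure \<nu> ?U * ln b"
      by (simp add: sum.distrib sum_divide_distrib sum_distrib_right measure_cylset)
    also have "(\<Sum>w\<in>words M n - W. \<phi> w) \<le> partition_sum M \<phi> n"
      unfolding partition_sum_def by (intro sum_mono2 finite_words nonneg) auto
    finally have "word_entropy n + energy n \<le> (\<Sum>w\<in>words M n \<inter> W. \<phi> w) / b + measure \<nu> ?U * ln b + K"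
      using sum_le_K[of n] by linarith
    moreover have "(\<Sum>w\<in>words M n \<inter> W. \<phi> w) / b \<le> 1" using phiU b(1) by simp
    moreover have "measure \<nu> ?U * ln b \<le> - (K + 2)"
    proof -
      have "ln b \<le> 0" using b(2) a K_ge_1 by simp
      then have "measure \<nu> ?U * ln b \<le> a / 2 * ln b" using nuU by (rule mult_right_mono_neg[rotated])
      also have "\<dots> = - (K + 2)" using a by (simp add: b(2) field_simps)
      finally show ?thesis .
    qed
    ultimately show False using free[of n] by linarith
  qed
  then have "null_sets \<mu> \<subseteq> null_sets \<nu>"
    unfolding null_sets_def
    by (auto simp: emeasure_eq_measure mu.emeasure_eq_measure sets_\<nu> mu.sets_\<nu>)
  then show ?thesis unfolding absolutely_continuous_def .
qed

text \<open>
  Quasi-multiplicativity in terms of the measure: $\nu(v) \nu(w)$ is at most a constant times the measure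
  of the set where $v$ is followed, after one of the connecting words, by $w$. Sum over all $v$ and $w$.
\<close>
lemma gibbs_mixing:
  assumes gibbs: "gibbs \<nu> D"
  shows "measure \<nu> (cylset M n V) * measure \<nu> (cylset M n W)
    \<le> D ^ 3 / c * (\<Sum>k\<in>F. measure \<nu> (cylset M n V \<inter> ((shift ^^ (n + length k)) -` cylset M n W \<inter> space \<nu>)))"
proof -
  have D: "D > 0" and g: "\<And>w. w \<in> lists {1..M} \<Longrightarrow> cyl_prob \<nu> w \<le> D * \<phi> w"
    "\<And>w. w \<in> lists {1..M} \<Longrightarrow> \<phi> w \<le> D * cyl_prob \<nu> w"
    using gibbs unfolding gibbs_def by auto
  let ?V = "words M n \<inter> V" and ?W = "words M n \<inter> W"
  have fin: "finite ?V" "finite ?W" by (simp_all add: finite_words)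
  have "cyl_prob \<nu> v * cyl_prob \<nu> w \<le> D ^ 3 / c * (\<Sum>k\<in>F. cyl_prob \<nu> (v @ k @ w))"
    if v: "v \<in> ?V" and w: "w \<in> ?W" for v w
  proof -
    have vw: "v \<in> lists {1..M}" "w \<in> lists {1..M}" using v w words_subset_lists by blast+
    obtain k where k: "k \<in> F" "c * \<phi> v * \<phi> w \<le> \<phi> (v @ k @ w)" using quasi by blast
    have kl: "v @ k @ w \<in> lists {1..M}" using vw k(1) F_lists by auto
    have "cyl_prob \<nu> v * cyl_prob \<nu> w \<le> (D * \<phi> v) * (D * \<phi> w)"
      using D nonneg by (intro mult_mono g vw cyl_prob_nonneg mult_nonneg_nonneg) auto
    also have "\<dots> = D ^ 2 / c * (c * \<phi> v * \<phi> w)" using c_pos by (simp add: power2_eq_square)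
    also have "\<dots> \<le> D ^ 2 / c * (D * cyl_prob \<nu> (v @ k @ w))"
      using c_pos D k(2) g(2)[OF kl] by (intro mult_left_mono) auto
    also have "\<dots> = D ^ 3 / c * cyl_prob \<nu> (v @ k @ w)" by (simp add: power2_eq_square power3_eq_cube)
    also have "\<dots> \<le> D ^ 3 / c * (\<Sum>k\<in>F. cyl_prob \<nu> (v @ k @ w))"
    proof (rule mult_left_mono)
      show "cyl_prob \<nu> (v @ k @ w) \<le> (\<Sum>k\<in>F. cyl_prob \<nu> (v @ k @ w))"
        by (rule member_le_sum[OF k(1)]) (simp_all add: cyl_prob_nonneg finite_F)
      show "0 \<le> D ^ 3 / c" using D c_pos by simp
    qed
    finally show ?thesis .
  qed
  then have "(\<Sum>v\<in>?V. \<Sum>w\<in>?W. cyl_prob \<nu> v * cyl_prob \<nu> w)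
      \<le> (\<Sum>v\<in>?V. \<Sum>w\<in>?W. D ^ 3 / c * (\<Sum>k\<in>F. cyl_prob \<nu> (v @ k @ w)))"
    by (intro sum_mono)
  also have "\<dots> = D ^ 3 / c * (\<Sum>v\<in>?V. \<Sum>w\<in>?W. \<Sum>k\<in>F. cyl_prob \<nu> (v @ k @ w))"
    by (simp only: sum_distrib_left)
  also have "(\<Sum>v\<in>?V. \<Sum>w\<in>?W. \<Sum>k\<in>F. cyl_prob \<nu> (v @ k @ w))
      = (\<Sum>v\<in>?V. \<Sum>k\<in>F. \<Sum>w\<in>?W. cyl_prob \<nu> (v @ k @ w))"
    by (rule sum.cong[OF refl]) (rule sum.swap)
  also have "\<dots> = (\<Sum>k\<in>F. \<Sum>v\<in>?V. \<Sum>w\<in>?W. cyl_prob \<nu> (v @ k @ w))"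
    by (rule sum.swap)
  finally have 1: "(\<Sum>v\<in>?V. \<Sum>w\<in>?W. cyl_prob \<nu> v * cyl_prob \<nu> w)
      \<le> D ^ 3 / c * (\<Sum>k\<in>F. \<Sum>v\<in>?V. \<Sum>w\<in>?W. cyl_prob \<nu> (v @ k @ w))" .
  have 2: "(\<Sum>v\<in>?V. \<Sum>w\<in>?W. cyl_prob \<nu> (v @ k @ w))
      \<le> measure \<nu> (cylset M n V \<inter> ((shift ^^ (n + length k)) -` cylset M n W \<inter> space \<nu>))"
    if k: "k \<in> F" for k
  proof -
    let ?N = "n + length k + n"
    let ?f = "\<lambda>(v, w). v @ k @ w"
    let ?X = "?f ` (?V \<times> ?W)"
    have kl: "k \<in> words M (length k)" using k F_lists by (auto simp: words_iff)
    have X_words: "?X \<subseteq> words M ?N"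
    proof
      fix x assume "x \<in> ?X"
      then obtain v w where "x = v @ k @ w" "v \<in> words M n" "w \<in> words M n" by auto
      then show "x \<in> words M ?N" using kl by (auto simp: words_iff)
    qed
    have inj: "inj_on ?f (?V \<times> ?W)"
      by (auto simp: inj_on_def words_iff)
    have "(\<Sum>v\<in>?V. \<Sum>w\<in>?W. cyl_prob \<nu> (v @ k @ w)) = (\<Sum>p\<in>?V \<times> ?W. cyl_prob \<nu> (?f p))"
      by (simp add: sum.cartesian_product case_prod_beta)
    also have "\<dots> = (\<Sum>x\<in>?X. cyl_prob \<nu> x)" by (simp add: sum.reindex[OF inj])
    also have "?X = words M ?N \<inter> ?X" using X_words by blast
    also have "(\<Sum>x\<in>words M ?N \<inter> ?X. cyl_prob \<nu> x) = measure \<nu> (cylset M ?N ?X)"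
      by (rule measure_cylset[symmetric])
    also have "\<dots> \<le> measure \<nu> (cylset M n V \<inter> ((shift ^^ (n + length k)) -` cylset M n W \<inter> space \<nu>))"
    proof (rule finite_measure_mono)
      show "cylset M n V \<inter> ((shift ^^ (n + length k)) -` cylset M n W \<inter> space \<nu>) \<in> sets \<nu>"
        by (intro sets.Int cylset_sets measurable_sets[OF measurable_iterate])
      show "cylset M ?N ?X \<subseteq> cylset M n V \<inter> ((shift ^^ (n + length k)) -` cylset M n W \<inter> space \<nu>)"
      proof
        fix x assume x: "x \<in> cylset M ?N ?X"
        then have sp: "x \<in> topspace (full_shift M)" by (simp add: cylset_def)
        obtain v w where vw: "v \<in> ?V" "w \<in> ?W" "initial ?N x = v @ k @ w"
          using x by (auto simp: cylset_def)
        have "initial n x @ initial (length k) ((shift ^^ n) x) @ initial n ((shift ^^ (n + length k)) x) = v @ k @ w"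
          using vw(3) unfolding initial_add[where m = "n + length k" and n = n] initial_add[where m = n and n = "length k"] by simp
        then have "initial n x = v" "initial n ((shift ^^ (n + length k)) x) = w"
          using vw(1,2) by (simp_all add: words_iff)
        moreover have "(shift ^^ (n + length k)) x \<in> topspace (full_shift M)"
          using iterate_in_space[of x "n + length k"] sp by (simp add: space_\<nu>)
        ultimately show "x \<in> cylset M n V \<inter> ((shift ^^ (n + length k)) -` cylset M n W \<inter> space \<nu>)"
          using vw(1,2) sp by (simp add: cylset_def space_\<nu>)
      qed
    qed
    finally show ?thesis .
  qed
  have "measure \<nu> (cylset M n V) * measure \<nu> (cylset M n W) = (\<Sum>v\<in>?V. \<Sum>w\<in>?W. cyl_prob \<nu> v * cyl_prob \<nu> w)"
    by (simp only: measure_cylset sum_product)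
  also note 1
  also have "D ^ 3 / c * (\<Sum>k\<in>F. \<Sum>v\<in>?V. \<Sum>w\<in>?W. cyl_prob \<nu> (v @ k @ w))
      \<le> D ^ 3 / c * (\<Sum>k\<in>F. measure \<nu> (cylset M n V \<inter> ((shift ^^ (n + length k)) -` cylset M n W \<inter> space \<nu>)))"
    using D c_pos by (intro mult_left_mono sum_mono 2) auto
  finally show ?thesis .
qed

lemma iterate_sym_diff_null:
  assumes E: "E \<in> sets \<nu>" and inv: "measure \<nu> (sym_diff E (shift -` E \<inter> space \<nu>)) = 0"
  shows "measure \<nu> (sym_diff E ((shift ^^ j) -` E \<inter> space \<nu>)) = 0"
proof (induction j)
  case 0
  have "sym_diff E ((shift ^^ 0) -` E \<inter> space \<nu>) = {}" using sets.sets_into_space[OF E] by auto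
  then show ?case by (simp only: measure_empty)
next
  case (Suc j)
  let ?E = "\<lambda>j. (shift ^^ j) -` E \<inter> space \<nu>"
  let ?S = "sym_diff E (shift -` E \<inter> space \<nu>)"
  have Ej: "?E j \<in> sets \<nu>" for j using measurable_iterate E by (rule measurable_sets)
  have S: "?S \<in> sets \<nu>" using Ej[of 1] E by auto
  have sub: "sym_diff E (?E (Suc j)) \<subseteq> sym_diff E (?E j) \<union> ((shift ^^ j) -` ?S \<inter> space \<nu>)"
    using iterate_in_space[of _ j] by auto
  have "measure \<nu> (sym_diff E (?E (Suc j))) \<le> measure \<nu> (sym_diff E (?E j) \<union> ((shift ^^ j) -` ?S \<inter> space \<nu>))"
  proof (rule finite_measure_mono[OF sub])
    show "sym_diff E (?E j) \<union> ((shift ^^ j) -` ?S \<inter> space \<nu>) \<in> sets \<nu>"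
      using E Ej measurable_sets[OF measurable_iterate S] by (intro sets.Un sets.Diff)
  qed
  also have "\<dots> \<le> measure \<nu> (sym_diff E (?E j)) + measure \<nu> ((shift ^^ j) -` ?S \<inter> space \<nu>)"
    using E Ej measurable_sets[OF measurable_iterate S] by (intro measure_Un_le sets.Un sets.Diff)
  also have "\<dots> = 0" unfolding Suc measure_iterate_vimage[OF S] inv by simp
  finally show ?case using measure_nonneg[of \<nu> "sym_diff E (?E (Suc j))"] by linarith
qed

text \<open>
  Approximate an invariant set $E$ by a union $U$ of cylinders and apply \<open>gibbs_mixing\<close> to the
  complement of $U$ and $U$. A point of the complement of $E$ never enters $E$, up to null sets, so the right
  hand side is of the order of the error of approximation, whereas the left hand side is close to
  $(1 - \nu(E)) \nu(E)$.
\<close>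
lemma gibbs_ergodic:
  assumes gibbs: "gibbs \<nu> D"
    and E: "E \<in> sets \<nu>" and inv: "measure \<nu> (sym_diff E (shift -` E \<inter> space \<nu>)) = 0"
  shows "measure \<nu> E = 0 \<or> measure \<nu> E = 1"
proof (rule ccontr)
  assume contra: "\<not> ?thesis"
  define x where "x = measure \<nu> E"
  have x: "0 < x" "x < 1"
    using contra measure_nonneg[of \<nu> E] prob_le_1[of E] unfolding x_def by linarith+
  have D: "D > 0" using gibbs unfolding gibbs_def by blast
  define C where "C = D ^ 3 / c * real (card F) * 2"
  have C: "C > 0" unfolding C_def using D c_pos card_F by simp
  \<comment> \<open>The first two bounds keep both factors at least half as large as for E, the third contradicts mixing.\<close>
  define e where "e = min (min (x / 2) ((1 - x) / 2)) (x * (1 - x) / (8 * C))"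
  have e: "e > 0" unfolding e_def using x C by simp
  obtain n W where approx: "measure \<nu> (sym_diff E (cylset M n W)) < e"
    using approx_by_cylset[OF finite_measure_axioms sets_\<nu> E e] by blast
  let ?U = "cylset M n W" and ?V = "cylset M n (- W)"
  have V: "?V = space \<nu> - ?U" by (auto simp: cylset_def space_\<nu>)
  have sd: "sym_diff E ?U \<in> sets \<nu>" using E by auto
  have "x \<le> measure \<nu> (?U \<union> sym_diff E ?U)"
    unfolding x_def using E by (intro finite_measure_mono) auto
  also have "\<dots> \<le> measure \<nu> ?U + measure \<nu> (sym_diff E ?U)"
    using E by (intro measure_Un_le) auto
  finally have U_ge: "measure \<nu> ?U \<ge> x / 2" using approx unfolding e_def by linarith
  have "measure \<nu> ?U \<le> measure \<nu> (E \<union> sym_diff E ?U)"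
    using E by (intro finite_measure_mono) auto
  also have "\<dots> \<le> x + measure \<nu> (sym_diff E ?U)"
    unfolding x_def using E by (intro measure_Un_le) auto
  finally have V_ge: "measure \<nu> ?V \<ge> (1 - x) / 2"
    using approx prob_compl[of ?U] unfolding e_def V by simp
  have "measure \<nu> (?V \<inter> ((shift ^^ j) -` ?U \<inter> space \<nu>)) \<le> 2 * e" for j
  proof -
    let ?Ej = "(shift ^^ j) -` E \<inter> space \<nu>" and ?Sj = "(shift ^^ j) -` sym_diff E ?U \<inter> space \<nu>"
    have Ej: "?Ej \<in> sets \<nu>" using measurable_iterate E by (rule measurable_sets)
    have Sj: "?Sj \<in> sets \<nu>" using measurable_iterate sd by (rule measurable_sets)
    have sub: "?V \<inter> ((shift ^^ j) -` ?U \<inter> space \<nu>) \<subseteq> (sym_diff E ?Ej \<union> sym_diff E ?U) \<union> ?Sj"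
      unfolding V by blast
    have "measure \<nu> (?V \<inter> ((shift ^^ j) -` ?U \<inter> space \<nu>)) \<le> measure \<nu> ((sym_diff E ?Ej \<union> sym_diff E ?U) \<union> ?Sj)"
      using E Ej Sj sd by (intro finite_measure_mono[OF sub] sets.Un sets.Diff) auto
    also have "\<dots> \<le> measure \<nu> (sym_diff E ?Ej \<union> sym_diff E ?U) + measure \<nu> ?Sj"
      using E Ej Sj sd by (intro measure_Un_le sets.Un sets.Diff) auto
    also have "measure \<nu> (sym_diff E ?Ej \<union> sym_diff E ?U) \<le> measure \<nu> (sym_diff E ?Ej) + measure \<nu> (sym_diff E ?U)"
      using E Ej sd by (intro measure_Un_le sets.Un sets.Diff) auto
    finally show ?thesis
      using approx iterate_sym_diff_null[OF E inv, of j] measure_iterate_vimage[OF sd, of j] by linarith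
  qed
  then have "(\<Sum>k\<in>F. measure \<nu> (?V \<inter> ((shift ^^ (n + length k)) -` ?U \<inter> space \<nu>))) \<le> (\<Sum>k\<in>F. 2 * e)"
    by (intro sum_mono)
  then have "D ^ 3 / c * (\<Sum>k\<in>F. measure \<nu> (?V \<inter> ((shift ^^ (n + length k)) -` ?U \<inter> space \<nu>))) \<le> D ^ 3 / c * (\<Sum>k\<in>F. 2 * e)"
    using D c_pos by (intro mult_left_mono) auto
  also have "\<dots> = C * e" by (simp add: C_def)
  finally have "measure \<nu> ?V * measure \<nu> ?U \<le> C * e"
    using gibbs_mixing[OF gibbs, of n "- W" W] by linarith
  moreover have "(1 - x) / 2 * (x / 2) \<le> measure \<nu> ?V * measure \<nu> ?U"
    using U_ge V_ge x by (intro mult_mono) auto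
  moreover have "C * e \<le> C * (x * (1 - x) / (8 * C))"
    unfolding e_def using C by (intro mult_left_mono) auto
  moreover have "C * (x * (1 - x) / (8 * C)) = x * (1 - x) / 8" using C by simp
  moreover have "(1 - x) / 2 * (x / 2) = x * (1 - x) / 4" by simp
  moreover have "x * (1 - x) > 0" using x by simp
  ultimately show False by linarith
qed

lemma eq_gibbs_of_free_energy:
  assumes "admissible" "\<And>n. word_entropy n + energy n \<ge> 0"
    and \<mu>: "\<mu> \<in> invariant_measures M" and gibbs: "gibbs \<mu> D"
  shows "\<nu> = \<mu>"
proof -
  interpret mu: quasi_bernoulli_invariant M \<phi> F c K \<mu> by unfold_locales (rule \<mu>)
  show ?thesis
  proof (rule absolutely_continuous_invariant_eq[where T = shift])
    show "measure_preserving_system \<mu> shift" by (rule mu.measure_preserving_system_axioms)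
    show "measure_preserving_system \<nu> shift" by (rule measure_preserving_system_axioms)
    show "sets \<nu> = sets \<mu>" by (simp add: sets_\<nu> mu.sets_\<nu>)
    show "absolutely_continuous \<mu> \<nu>" by (rule absolutely_continuous_of_free_energy[OF assms])
    show "measure \<mu> E = 0 \<or> measure \<mu> E = 1"
      if "E \<in> sets \<mu>" "measure \<mu> (sym_diff E (shift -` E \<inter> space \<mu>)) = 0" for E
      using gibbs that by (rule mu.gibbs_ergodic)
  qed
qed

end

section \<open>Equilibrium states\<close>

context shift_invariant
begin

lemma mean_normalised_weight:
  assumes A: "charged A"
  shows "(\<Sum>w\<in>words M n. cyl_prob \<nu> w * ln (normalised_weight A s p w)) = s * mean_log A n - real n * p"
proof -
  have "(\<Sum>w\<in>words M n. cyl_prob \<nu> w * ln (normalised_weight A s p w))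
      = (\<Sum>w\<in>words M n. s * (cyl_prob \<nu> w * ln (operator_norm (word_product A w))) - cyl_prob \<nu> w * (real n * p))"
  proof (rule sum.cong[OF refl])
    fix w assume w: "w \<in> words M n"
    show "cyl_prob \<nu> w * ln (normalised_weight A s p w)
        = s * (cyl_prob \<nu> w * ln (operator_norm (word_product A w))) - cyl_prob \<nu> w * (real n * p)"
    proof (cases "cyl_prob \<nu> w = 0")
      case False
      then have "cyl_prob \<nu> w > 0" using cyl_prob_nonneg[of w] by linarith
      then have "word_product A w \<noteq> 0" using A w words_subset_lists unfolding charged_def by blast
      then have pos: "operator_norm (word_product A w) > 0"
        using operator_norm_eq_0[of "word_product A w"] operator_norm_nonneg[of "word_product A w"] by linarith
      have log_weight: "ln (normalised_weight A s p w) = - real n * p + s * ln (operator_norm (word_product A w))"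
        unfolding normalised_weight_words[OF w] using pos by (simp add: ln_mult ln_powr)
      show ?thesis unfolding log_weight by (simp add: algebra_simps)
    qed simp
  qed
  also have "\<dots> = s * mean_log A n - real n * p"
    using sum_cyl_prob[of n]
    unfolding mean_log_def sum_subtractf sum_distrib_left[symmetric] sum_distrib_right[symmetric] by simp
  finally show ?thesis .
qed

end

text \<open>
  The pressure enters only as the number $p$ for which the normalised weights are quasi-Bernoulli.
\<close>
locale thermodynamic =
  fixes M :: nat and A :: "nat \<Rightarrow> real ^ 'd ^ 'd" and s p F c K
  assumes s_pos: "s > 0"
    and qb: "quasi_bernoulli M (normalised_weight A s p) F c K"

sublocale thermodynamic \<subseteq> quasi_bernoulli M "normalised_weight A s p" F c K
  by (rule qb)

context thermodynamic
begin

definition free_energy :: "(nat \<Rightarrow> nat) measure \<Rightarrow> ereal" where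
  "free_energy \<nu> = metric_entropy \<nu> shift + ereal s * lyapunov A \<nu>"

lemma invariant_system:
  "\<nu> \<in> invariant_measures M \<Longrightarrow> quasi_bernoulli_invariant M (normalised_weight A s p) F c K \<nu>"
  by (intro quasi_bernoulli_invariant.intro qb shift_invariant.intro)

lemma admissible_iff_charged:
  assumes "\<nu> \<in> invariant_measures M"
  shows "quasi_bernoulli_invariant.admissible M (normalised_weight A s p) \<nu> \<longleftrightarrow> shift_invariant.charged M \<nu> A"
proof -
  interpret quasi_bernoulli_invariant M "normalised_weight A s p" F c K \<nu>
    using assms by (rule invariant_system)
  show ?thesis unfolding admissible_def charged_def normalised_weight_pos_iff ..
qed

lemma free_energy_not_charged:
  assumes \<nu>: "\<nu> \<in> invariant_measures M" and "\<not> shift_invariant.charged M \<nu> A"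
  shows "free_energy \<nu> = - \<infinity>"
proof -
  interpret shift_invariant M \<nu> by unfold_locales (rule \<nu>)
  show ?thesis
    using s_pos assms(2) by (simp add: free_energy_def metric_entropy_eq lyapunov_not_charged)
qed

lemma free_energy_le_p:
  assumes \<nu>: "\<nu> \<in> invariant_measures M"
  shows "free_energy \<nu> \<le> ereal p"
proof (cases "shift_invariant.charged M \<nu> A")
  case False
  then show ?thesis using free_energy_not_charged[OF \<nu>] by simp
next
  case True
  interpret quasi_bernoulli_invariant M "normalised_weight A s p" F c K \<nu>
    using \<nu> by (rule invariant_system)
  have adm: "admissible" using admissible_iff_charged[OF \<nu>] True by blast
  have bound: "word_entropy n + s * mean_log A n \<le> real n * p + (K - 1)" for n
    using free_energy_le[OF adm, of n] unfolding energy_def mean_normalised_weight[OF True] by linarith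
  have lyap_le: "lyapunov A \<nu> \<le> ereal (mean_log A n / real n)" if "n \<ge> 1" for n
    using lyapunov_charged(2)[OF True that] .
  show ?thesis
  proof (cases "lyapunov A \<nu>")
    case (real L)
    have "word_entropy_rate + s * L \<le> p + (K - 1) / real n" if n: "n \<ge> 1" for n
    proof -
      have "L * real n \<le> mean_log A n" using lyap_le[OF n] n unfolding real by (simp add: field_simps)
      then have "s * (L * real n) \<le> s * mean_log A n" using s_pos by (intro mult_left_mono) auto
      then have "(word_entropy_rate + s * L) * real n \<le> real n * p + (K - 1)"
        using word_entropy_rate(2)[of n] bound[of n] by (simp add: algebra_simps)
      then show ?thesis using n by (simp add: field_simps)
    qed
    moreover have "(\<lambda>n. p + (K - 1) / real n) \<longlonglongrightarrow> p + 0"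
      by (intro tendsto_intros lim_const_over_n)
    ultimately have "word_entropy_rate + s * L \<le> p"
      using LIMSEQ_le_const[of "\<lambda>n. p + (K - 1) / real n" "p + 0"] by auto
    then show ?thesis by (simp add: free_energy_def metric_entropy_eq real)
  next
    case PInf
    then show ?thesis using lyap_le[of 1] by simp
  next
    case MInf
    then show ?thesis using s_pos by (simp add: free_energy_def metric_entropy_eq)
  qed
qed

lemma free_energy_gibbs:
  assumes \<mu>: "\<mu> \<in> invariant_measures M" and gibbs: "gibbs \<mu> D"
  shows "free_energy \<mu> = ereal p"
proof (rule antisym[OF free_energy_le_p[OF \<mu>]])
  interpret quasi_bernoulli_invariant M "normalised_weight A s p" F c K \<mu>
    using \<mu> by (rule invariant_system)
  have charged: "charged A"
    using admissible_iff_charged[OF \<mu>] gibbs_free_energy_ge(2)[OF gibbs] by blast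
  have "(\<lambda>n. (p - ln D / real n - word_entropy n / real n) / s) \<longlonglongrightarrow> (p - 0 - word_entropy_rate) / s"
    using s_pos by (intro tendsto_intros lim_const_over_n word_entropy_rate(1)) auto
  then have lim: "(\<lambda>n. ereal ((p - ln D / real n - word_entropy n / real n) / s)) \<longlonglongrightarrow> ereal ((p - word_entropy_rate) / s)"
    by simp
  have "ereal ((p - word_entropy_rate) / s) \<le> lyapunov A \<mu>"
  proof (rule LIMSEQ_le[OF lim lyapunov_charged(1)[OF charged]])
    have "(p - ln D / real n - word_entropy n / real n) / s \<le> mean_log A n / real n" if n: "n \<ge> 1" for n
    proof -
      have "- ln D \<le> word_entropy n + (s * mean_log A n - real n * p)"
        using gibbs_free_energy_ge(1)[OF gibbs, of n] unfolding energy_def mean_normalised_weight[OF charged] .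
      then have "real n * p - ln D - word_entropy n \<le> s * mean_log A n" by linarith
      then have "(real n * p - ln D - word_entropy n) / real n / s \<le> s * mean_log A n / real n / s"
        using s_pos by (intro divide_right_mono) auto
      moreover have "(real n * p - ln D - word_entropy n) / real n = p - ln D / real n - word_entropy n / real n"
        using n by (simp add: diff_divide_distrib)
      moreover have "s * mean_log A n / real n / s = mean_log A n / real n" using s_pos by simp
      ultimately show ?thesis by (simp only:)
    qed
    then show "\<exists>N. \<forall>n\<ge>N. ereal ((p - ln D / real n - word_entropy n / real n) / s) \<le> ereal (mean_log A n / real n)"
      by (intro exI[of _ 1]) simp
  qed
  then show "ereal p \<le> free_energy \<mu>"
  proof (cases "lyapunov A \<mu>")
    case (real L)
    assume "ereal ((p - word_entropy_rate) / s) \<le> lyapunov A \<mu>"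
    then have "p \<le> word_entropy_rate + s * L" using s_pos unfolding real by (simp add: field_simps)
    then show ?thesis by (simp add: free_energy_def metric_entropy_eq real)
  qed (use s_pos in \<open>auto simp: free_energy_def metric_entropy_eq\<close>)
qed

lemma eq_gibbs_of_free_energy_eq_p:
  assumes \<nu>: "\<nu> \<in> invariant_measures M" and eq: "free_energy \<nu> = ereal p"
    and \<mu>: "\<mu> \<in> invariant_measures M" and gibbs: "gibbs \<mu> D"
  shows "\<nu> = \<mu>"
proof -
  interpret quasi_bernoulli_invariant M "normalised_weight A s p" F c K \<nu>
    using \<nu> by (rule invariant_system)
  have charged: "charged A" using free_energy_not_charged[OF \<nu>] eq by auto
  obtain L where L: "lyapunov A \<nu> = ereal L"
  proof (cases "lyapunov A \<nu>")
    case PInf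
    then show ?thesis using lyapunov_charged(2)[OF charged, of 1] by simp
  next
    case MInf
    then show ?thesis using eq s_pos by (simp add: free_energy_def metric_entropy_eq)
  qed
  then have p: "word_entropy_rate + s * L = p" using eq by (simp add: free_energy_def metric_entropy_eq)
  have "word_entropy n + energy n \<ge> 0" for n
  proof (cases "n = 0")
    case True
    have "energy 0 = 0"
      by (simp add: energy_def words_0 normalised_weight_def weight_Nil)
    then show ?thesis using True word_entropy_nonneg[of 0] by simp
  next
    case False
    then have "L * real n \<le> mean_log A n"
      using lyapunov_charged(2)[OF charged, of n] unfolding L by (simp add: field_simps)
    then have "s * (L * real n) \<le> s * mean_log A n" using s_pos by (intro mult_left_mono) auto
    then have "(word_entropy_rate + s * L) * real n \<le> word_entropy n + s * mean_log A n"
      using word_entropy_rate(2)[of n] by (simp add: algebra_simps)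
    then show ?thesis unfolding energy_def mean_normalised_weight[OF charged] p by (simp add: mult.commute)
  qed
  then show ?thesis
    using admissible_iff_charged[OF \<nu>] charged by (intro eq_gibbs_of_free_energy[OF _ _ \<mu> gibbs]) auto
qed

text \<open>
  This contains the variational principle: the supremum of the free energy is $p$, attained by the Gibbs
  measure only.
\<close>
lemma equilibrium_states_eq_gibbs:
  assumes \<mu>: "\<mu> \<in> invariant_measures M" and gibbs: "gibbs \<mu> D"
  shows "equilibrium_states M A s = {\<mu>}"
proof -
  have "(SUP \<nu>\<in>invariant_measures M. free_energy \<nu>) = ereal p"
  proof (rule antisym)
    show "(SUP \<nu>\<in>invariant_measures M. free_energy \<nu>) \<le> ereal p"
      by (rule SUP_least) (rule free_energy_le_p)
    show "ereal p \<le> (SUP \<nu>\<in>invariant_measures M. free_energy \<nu>)"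
      unfolding free_energy_gibbs[OF \<mu> gibbs, symmetric] by (rule SUP_upper[OF \<mu>])
  qed
  then have "equilibrium_states M A s = {\<nu> \<in> invariant_measures M. free_energy \<nu> = ereal p}"
    unfolding equilibrium_states_def free_energy_def by simp
  also have "\<dots> = {\<mu>}"
    using \<mu> free_energy_gibbs[OF \<mu> gibbs] eq_gibbs_of_free_energy_eq_p[OF _ _ \<mu> gibbs] by blast
  finally show ?thesis .
qed

end

lemma thermodynamic_irreducible:
  fixes A :: "nat \<Rightarrow> real ^ 'd ^ 'd"
  assumes "irreducible_tuple M A" "s > 0" "pressure M A s > - \<infinity>"
  obtains F c K where "thermodynamic M A s (real_of_ereal (pressure M A s)) F c K"
proof -
  obtain F c K where "quasi_bernoulli M (normalised_weight A s (real_of_ereal (pressure M A s))) F c K"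
    using quasi_bernoulli_normalised_weight[OF assms] by blast
  then show thesis using that assms(2) by (simp add: thermodynamic_def)
qed

section \<open>Comparison of two tuples\<close>

text \<open>
  The logarithms of comparable weights differ by a bounded amount, which disappears in the limit after
  division by the length. Both exponents are $-\infty$ if a product of positive probability vanishes,
  since comparable weights have the same zeros.
\<close>
lemma lyapunov_affine_of_comparable:
  fixes A :: "nat \<Rightarrow> real ^ 'd1 ^ 'd1" and B :: "nat \<Rightarrow> real ^ 'd2 ^ 'd2"
  assumes \<nu>: "\<nu> \<in> invariant_measures M" and s: "s > 0" and t: "t > 0" and C: "C > 0"
    and comp: "\<And>n w. n \<ge> 1 \<Longrightarrow> w \<in> words M n \<Longrightarrow>
      normalised_weight A s p w \<le> C * normalised_weight B t q w \<and>
      normalised_weight B t q w \<le> C * normalised_weight A s p w"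
  shows "ereal s * lyapunov A \<nu> = ereal (p - q) + ereal t * lyapunov B \<nu>"
proof -
  interpret shift_invariant M \<nu> by unfold_locales (rule \<nu>)
  have zero_iff: "word_product A w \<noteq> 0 \<longleftrightarrow> word_product B w \<noteq> 0" if w: "w \<in> lists {1..M}" for w
  proof (cases "w = []")
    case True
    then show ?thesis using mat_one_nonzero[where 'd = 'd1] mat_one_nonzero[where 'd = 'd2] by simp
  next
    case False
    then have "length w \<ge> 1" by (cases w) auto
    moreover have "w \<in> words M (length w)" using w by (auto simp: words_iff)
    ultimately have ab: "normalised_weight A s p w \<le> C * normalised_weight B t q w"
      "normalised_weight B t q w \<le> C * normalised_weight A s p w" using comp by blast+
    have "normalised_weight A s p w > 0 \<longleftrightarrow> normalised_weight B t q w > 0"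
    proof
      assume "normalised_weight A s p w > 0"
      then have "0 < C * normalised_weight B t q w" using ab(1) by linarith
      then show "normalised_weight B t q w > 0" using C by (simp add: zero_less_mult_iff)
    next
      assume "normalised_weight B t q w > 0"
      then have "0 < C * normalised_weight A s p w" using ab(2) by linarith
      then show "normalised_weight A s p w > 0" using C by (simp add: zero_less_mult_iff)
    qed
    then show ?thesis unfolding normalised_weight_pos_iff .
  qed
  then have charged_iff: "charged A \<longleftrightarrow> charged B"
    unfolding charged_def by blast
  show ?thesis
  proof (cases "charged A")
    case False
    then show ?thesis using charged_iff s t by (simp add: lyapunov_not_charged)
  next
    case True
    then have B: "charged B" using charged_iff by simp
    define d where "d n = (s * mean_log A n - real n * p) - (t * mean_log B n - real n * q)" for n
    have d_bound: "\<bar>d n\<bar> \<le> \<bar>ln C\<bar>" if n: "n \<ge> 1" for n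
    proof -
      let ?a = "normalised_weight A s p" and ?b = "normalised_weight B t q"
      have "d n = (\<Sum>w\<in>words M n. cyl_prob \<nu> w * (ln (?a w) - ln (?b w)))"
        unfolding d_def mean_normalised_weight[OF True, symmetric] mean_normalised_weight[OF B, symmetric]
        by (simp add: sum_subtractf right_diff_distrib)
      also have "\<bar>\<dots>\<bar> \<le> (\<Sum>w\<in>words M n. cyl_prob \<nu> w * \<bar>ln C\<bar>)"
      proof (rule order_trans[OF sum_abs sum_mono])
        fix w assume w: "w \<in> words M n"
        show "\<bar>cyl_prob \<nu> w * (ln (?a w) - ln (?b w))\<bar> \<le> cyl_prob \<nu> w * \<bar>ln C\<bar>"
        proof (cases "cyl_prob \<nu> w = 0")
          case False
          then have pos: "cyl_prob \<nu> w > 0" using cyl_prob_nonneg[of w] by linarith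
          have wl: "w \<in> lists {1..M}" using w words_subset_lists by blast
          have a: "?a w > 0" and b: "?b w > 0"
            using True B pos wl unfolding charged_def normalised_weight_pos_iff by blast+
          have "ln (?a w) \<le> ln (C * ?b w)" "ln (?b w) \<le> ln (C * ?a w)"
            using comp[OF n w] a b by (auto intro: ln_mono)
          then have "\<bar>ln (?a w) - ln (?b w)\<bar> \<le> \<bar>ln C\<bar>" using C a b by (simp add: ln_mult)
          then show ?thesis using pos by (simp add: abs_mult)
        qed simp
      qed
      also have "\<dots> = \<bar>ln C\<bar>" using sum_cyl_prob[of n] by (simp flip: sum_distrib_right)
      finally show ?thesis .
    qed
    have "(\<lambda>n. d n / real n) \<longlonglongrightarrow> 0"
    proof (rule Lim_null_comparison)
      show "\<forall>\<^sub>F n in sequentially. norm (d n / real n) \<le> \<bar>ln C\<bar> / real n"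
        using d_bound by (intro eventually_sequentiallyI[of 1]) (simp add: divide_right_mono)
      show "(\<lambda>n. \<bar>ln C\<bar> / real n) \<longlonglongrightarrow> 0" by (rule lim_const_over_n)
    qed
    then have "(\<lambda>n. (p - q) + d n / real n) \<longlonglongrightarrow> (p - q) + 0" by (intro tendsto_add tendsto_const)
    then have lim_d: "(\<lambda>n. ereal ((p - q) + d n / real n)) \<longlonglongrightarrow> ereal (p - q)" by simp
    have lim_A: "(\<lambda>n. ereal s * ereal (mean_log A n / real n)) \<longlonglongrightarrow> ereal s * lyapunov A \<nu>"
      by (intro tendsto_cmult_ereal lyapunov_charged(1)[OF True]) simp
    have lim_B: "(\<lambda>n. ereal t * ereal (mean_log B n / real n)) \<longlonglongrightarrow> ereal t * lyapunov B \<nu>"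
      by (intro tendsto_cmult_ereal lyapunov_charged(1)[OF B]) simp
    have "(\<lambda>n. ereal ((p - q) + d n / real n) + ereal t * ereal (mean_log B n / real n))
        \<longlonglongrightarrow> ereal (p - q) + ereal t * lyapunov B \<nu>"
      by (intro tendsto_add_ereal_general lim_d lim_B) simp
    moreover have "ereal ((p - q) + d n / real n) + ereal t * ereal (mean_log B n / real n)
        = ereal s * ereal (mean_log A n / real n)" if "n \<ge> 1" for n
      using that by (simp add: d_def field_simps)
    ultimately have "(\<lambda>n. ereal s * ereal (mean_log A n / real n)) \<longlonglongrightarrow> ereal (p - q) + ereal t * lyapunov B \<nu>"
      by (elim Lim_transform_eventually) (auto intro!: eventually_sequentiallyI[of 1])
    with lim_A show ?thesis by (rule LIMSEQ_unique)
  qed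
qed

lemma power_powr: "x \<ge> 0 \<Longrightarrow> (x ^ k) powr a = (x powr a) ^ k" for x :: real
  by (induction k) (simp_all add: powr_mult)

lemma word_product_replicate:
  "word_product A (concat (replicate k w)) = mat_power (word_product A w) k"
proof (induction k)
  case (Suc k)
  have "mat_power X k ** X = X ** mat_power X k" for X :: "real ^ 'a ^ 'a"
    by (induction k) (simp_all add: matrix_mul_assoc[symmetric])
  then show ?case using Suc by (simp add: word_product_append)
qed simp

lemma replicate_word_in_words: "w \<in> words M n \<Longrightarrow> concat (replicate k w) \<in> words M (n * k)"
  by (induction k) (auto simp: words_iff)

text \<open>
  Apply comparability to the powers of $w$. The left hand side of the claim to the power $k$ is at most the
  weight of $w^k$ for $A$, and the weight of $w^k$ for $B$ is at most a constant times $b^k$ for any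
  $b$ larger than the right hand side. So the opposite inequality would make a geometric sequence of
  ratio greater than $1$ bounded.
\<close>
lemma spectral_radius_le_of_comparable:
  fixes A :: "nat \<Rightarrow> real ^ 'd1 ^ 'd1" and B :: "nat \<Rightarrow> real ^ 'd2 ^ 'd2"
  assumes s: "s > 0" and t: "t > 0" and C: "C > 0"
    and comp: "\<And>n w. n \<ge> 1 \<Longrightarrow> w \<in> words M n \<Longrightarrow>
      normalised_weight A s p w \<le> C * normalised_weight B t q w"
    and n: "n \<ge> 1" and w: "w \<in> words M n"
  shows "exp (- real n * p) * spectral_radius (word_product A w) powr s
    \<le> exp (- real n * q) * spectral_radius (word_product B w) powr t"
proof (rule ccontr)
  let ?P = "word_product A w" and ?Q = "word_product B w"
  define a where "a = exp (- real n * p) * spectral_radius ?P powr s"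
  define r where "r = spectral_radius ?Q"
  have r: "r \<ge> 0" by (simp add: r_def spectral_radius_nonneg)
  assume "\<not> ?thesis"
  then have less: "exp (- real n * q) * r powr t < a" by (simp add: a_def r_def)
  moreover have "0 \<le> exp (- real n * q) * r powr t" by simp
  ultimately have a: "a > 0" by linarith
  \<comment> \<open>This is the solution of exp (- real n * q) * y powr t = a, so every R between r and y leaves b below a.\<close>
  define y where "y = (a * exp (real n * q)) powr (1 / t)"
  have y_powr: "y powr t = a * exp (real n * q)"
    using t a by (simp add: y_def powr_powr)
  have "r powr t < y powr t" using less unfolding y_powr by (simp add: exp_minus field_simps)
  then have ry: "r < y"
    using powr_mono2[of t y r] t by (metis less_eq_real_def not_le powr_ge_zero y_def)
  define R where "R = (r + y) / 2"
  have R: "r < R" "R < y" "R > 0" using ry r by (simp_all add: R_def)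
  define b where "b = exp (- real n * q) * R powr t"
  have b: "b > 0" using R by (simp add: b_def)
  have "R powr t < y powr t" using R t by (intro powr_less_mono2) auto
  then have "b < a" unfolding b_def y_powr by (simp add: exp_minus field_simps)
  obtain K where K: "K > 0" "\<And>k. operator_norm (mat_power ?Q k) \<le> K * R ^ k"
    using operator_norm_power_growth[of ?Q R] R(1) unfolding r_def by blast
  have exp_k: "exp (- real (n * k) * x) = exp (- real n * x) ^ k" for k x
    by (simp add: mult.assoc mult.left_commute flip: exp_of_nat_mult)
  have bound: "(a / b) ^ k \<le> C * K powr t" if k: "k \<ge> 1" for k
  proof -
    let ?w = "concat (replicate k w)"
    have ww: "?w \<in> words M (n * k)" by (rule replicate_word_in_words[OF w])
    have nk: "n * k \<ge> 1" using n k by simp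
    have "a ^ k = exp (- real (n * k) * p) * (spectral_radius ?P ^ k) powr s"
      unfolding a_def power_mult_distrib exp_k by (simp add: power_powr spectral_radius_nonneg)
    also have "\<dots> \<le> exp (- real (n * k) * p) * operator_norm (mat_power ?P k) powr s"
      using s by (intro mult_left_mono powr_mono2 spectral_radius_power_le) (auto simp: spectral_radius_nonneg)
    also have "\<dots> = normalised_weight A s p ?w"
      by (simp add: normalised_weight_words[OF ww] word_product_replicate)
    also have "\<dots> \<le> C * normalised_weight B t q ?w" by (rule comp[OF nk ww])
    also have "\<dots> = C * (exp (- real (n * k) * q) * operator_norm (mat_power ?Q k) powr t)"
      by (simp add: normalised_weight_words[OF ww] word_product_replicate)
    also have "\<dots> \<le> C * (exp (- real (n * k) * q) * (K * R ^ k) powr t)"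
      using C t K(2) by (intro mult_left_mono powr_mono2) (auto simp: operator_norm_nonneg)
    also have "\<dots> = C * K powr t * b ^ k"
      unfolding b_def power_mult_distrib exp_k using K(1) R(3) by (simp add: powr_mult power_powr)
    finally show ?thesis using b by (simp add: power_divide field_simps)
  qed
  have "a / b > 1" using \<open>b < a\<close> b by simp
  then obtain k where k: "C * K powr t < (a / b) ^ k" using real_arch_pow by blast
  also have "(a / b) ^ k \<le> (a / b) ^ Suc k" using \<open>a / b > 1\<close> by (intro power_increasing) auto
  also have "\<dots> \<le> C * K powr t" by (rule bound) simp
  finally show False by simp
qed

text \<open>
  The norm of $A_w$ is bounded by a multiple of the spectral radius of $A_w A_u$ for a word $u$ from a finite
  set. Pass to $B$ by hypothesis, bound the spectral radius by the norm there, and use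
  submultiplicativity to return from $B_w B_u$ to $B_w$.
\<close>
lemma comparable_of_spectral_radius:
  fixes A :: "nat \<Rightarrow> real ^ 'd1 ^ 'd1" and B :: "nat \<Rightarrow> real ^ 'd2 ^ 'd2"
  assumes irr: "irreducible_tuple M A" and s: "s > 0" and t: "t > 0"
    and rad: "\<And>n w. n \<ge> 1 \<Longrightarrow> w \<in> words M n \<Longrightarrow>
      exp (- real n * p) * spectral_radius (word_product A w) powr s
        = exp (- real n * q) * spectral_radius (word_product B w) powr t"
  obtains C where "C > 0" "\<And>n w. n \<ge> 1 \<Longrightarrow> w \<in> words M n \<Longrightarrow>
      normalised_weight A s p w \<le> C * normalised_weight B t q w"
proof -
  obtain F e where F: "finite F" "F \<subseteq> lists {1..M}" "e > 0"
    and low: "\<And>w. w \<in> lists {1..M} \<Longrightarrow>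
      \<exists>u\<in>F. spectral_radius (word_product A (u @ w)) \<ge> e * operator_norm (word_product A w)"
    using spectral_radius_comparable_to_norm[OF irr] by blast
  let ?b = "normalised_weight B t q"
  define g where "g u = exp (real (length u) * p) * ?b u / e powr s" for u
  have g: "g u \<ge> 0" for u by (simp add: g_def normalised_weight_nonneg)
  define C where "C = 1 + (\<Sum>u\<in>F. g u)"
  have C: "C > 0" unfolding C_def using g by (intro add_pos_nonneg sum_nonneg) auto
  have "normalised_weight A s p w \<le> C * ?b w" if n: "n \<ge> 1" and w: "w \<in> words M n" for n w
  proof -
    have wl: "w \<in> lists {1..M}" using w words_subset_lists by blast
    obtain u where u: "u \<in> F" "spectral_radius (word_product A (u @ w)) \<ge> e * operator_norm (word_product A w)"
      using low[OF wl] by blast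
    have uw: "u @ w \<in> words M (length u + n)" using u(1) F(2) w by (auto simp: words_iff)
    have "e powr s * operator_norm (word_product A w) powr s \<le> spectral_radius (word_product A (u @ w)) powr s"
      using u(2) F(3) s by (simp flip: powr_mult add: operator_norm_nonneg powr_mono2)
    then have "exp (- real (length u + n) * p) * (e powr s * operator_norm (word_product A w) powr s)
        \<le> exp (- real (length u + n) * p) * spectral_radius (word_product A (u @ w)) powr s"
      by (intro mult_left_mono) auto
    also have "\<dots> = exp (- real (length u + n) * q) * spectral_radius (word_product B (u @ w)) powr t"
      using n by (intro rad uw) simp
    also have "\<dots> \<le> exp (- real (length u + n) * q) * operator_norm (word_product B (u @ w)) powr t"
      using t by (intro mult_left_mono powr_mono2 spectral_radius_le_operator_norm) (auto simp: spectral_radius_nonneg)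
    also have "\<dots> = ?b (u @ w)" by (simp add: normalised_weight_words[OF uw])
    also have "\<dots> \<le> ?b u * ?b w" by (rule normalised_weight_append_le[OF t])
    finally have main: "exp (- real (length u + n) * p) * (e powr s * operator_norm (word_product A w) powr s) \<le> ?b u * ?b w" .
    have exp_split: "exp (- real (length u + n) * p) = exp (- real n * p) / exp (real (length u) * p)"
      by (simp add: algebra_simps flip: exp_diff)
    have es: "e powr s > 0" using F(3) by simp
    have "normalised_weight A s p w \<le> g u * ?b w"
      unfolding g_def normalised_weight_words[OF w, of A s p]
      using main es unfolding exp_split by (simp add: field_simps)
    also have "\<dots> \<le> C * ?b w"
    proof (rule mult_right_mono)
      have "g u \<le> (\<Sum>u\<in>F. g u)" using u(1) F(1) g by (intro member_le_sum) auto
      then show "g u \<le> C" by (simp add: C_def)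
    qed (rule normalised_weight_nonneg)
    finally show ?thesis .
  qed
  with C show thesis using that by blast
qed

theorem theorem9:
  fixes M :: nat
    and A :: "nat \<Rightarrow> real ^ 'd1 ^ 'd1"
    and B :: "nat \<Rightarrow> real ^ 'd2 ^ 'd2"
    and s t :: real
  assumes "M \<ge> 2"
    and "irreducible_tuple M A" and "irreducible_tuple M B"
    and "s > 0" and "t > 0"
    and "pressure M A s > - \<infinity>" and "pressure M B t > - \<infinity>"
  defines "p \<equiv> real_of_ereal (pressure M A s)"
    and "q \<equiv> real_of_ereal (pressure M B t)"
  defines "cond_i \<equiv> equilibrium_states M A s = equilibrium_states M B t"
    and "cond_ii \<equiv>
      \<exists>C>0. \<forall>n\<ge>1. \<forall>w\<in>words M n.
        inverse C * exp (- real n * p) * operator_norm (word_product A w) powr s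
          \<le> exp (- real n * q) * operator_norm (word_product B w) powr t \<and>
        exp (- real n * q) * operator_norm (word_product B w) powr t
          \<le> C * exp (- real n * p) * operator_norm (word_product A w) powr s"
    and "cond_iii \<equiv>
      \<forall>n\<ge>1. \<forall>w\<in>words M n.
        exp (- real n * p) * spectral_radius (word_product A w) powr s
          = exp (- real n * q) * spectral_radius (word_product B w) powr t"
    and "cond_iv \<equiv>
      \<exists>l::real. \<forall>\<nu>\<in>invariant_measures M.
        ereal s * lyapunov A \<nu> = ereal l + ereal t * lyapunov B \<nu>"
  shows "(cond_i \<longleftrightarrow> cond_ii) \<and> (cond_ii \<longleftrightarrow> cond_iii) \<and> (cond_iii \<longleftrightarrow> cond_iv)"
proof -
  note s = \<open>s > 0\<close> and t = \<open>t > 0\<close>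
  let ?a = "normalised_weight A s p" and ?b = "normalised_weight B t q"
  obtain F c K where "thermodynamic M A s p F c K"
    using thermodynamic_irreducible[OF \<open>irreducible_tuple M A\<close> s \<open>pressure M A s > - \<infinity>\<close>]
    unfolding p_def by blast
  then interpret A: thermodynamic M A s p F c K .
  obtain F' c' K' where "thermodynamic M B t q F' c' K'"
    using thermodynamic_irreducible[OF \<open>irreducible_tuple M B\<close> t \<open>pressure M B t > - \<infinity>\<close>]
    unfolding q_def by blast
  then interpret B: thermodynamic M B t q F' c' K' .
  obtain \<mu> D where \<mu>: "\<mu> \<in> invariant_measures M" "A.gibbs \<mu> D" by (rule A.exists_gibbs)
  obtain \<mu>' D' where \<mu>': "\<mu>' \<in> invariant_measures M" "B.gibbs \<mu>' D'" by (rule B.exists_gibbs)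
  have esA: "equilibrium_states M A s = {\<mu>}" by (rule A.equilibrium_states_eq_gibbs[OF \<mu>])
  have esB: "equilibrium_states M B t = {\<mu>'}" by (rule B.equilibrium_states_eq_gibbs[OF \<mu>'])
  define comparable where "comparable C \<longleftrightarrow> C > 0 \<and>
    (\<forall>n\<ge>1. \<forall>w\<in>words M n. ?a w \<le> C * ?b w \<and> ?b w \<le> C * ?a w)" for C
  have ii_iff: "cond_ii \<longleftrightarrow> (\<exists>C. comparable C)"
  proof -
    have "(inverse C * exp (- real n * p) * operator_norm (word_product A w) powr s
          \<le> exp (- real n * q) * operator_norm (word_product B w) powr t \<and>
        exp (- real n * q) * operator_norm (word_product B w) powr t
          \<le> C * exp (- real n * p) * operator_norm (word_product A w) powr s)
      \<longleftrightarrow> ?a w \<le> C * ?b w \<and> ?b w \<le> C * ?a w" if "C > 0" "w \<in> words M n" for C n w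
      using that(1) unfolding normalised_weight_words[OF that(2)] by (simp add: field_simps)
    then show ?thesis unfolding cond_ii_def comparable_def by (metis (lifting))
  qed
  have i_ii: "cond_ii" if "cond_i"
  proof -
    have eq: "\<mu>' = \<mu>" using that unfolding cond_i_def esA esB by simp
    have D: "D > 0" "D' > 0" using \<mu>(2) \<mu>'(2) unfolding A.gibbs_def B.gibbs_def by blast+
    have "?a w \<le> D * D' * ?b w \<and> ?b w \<le> D * D' * ?a w" if w: "w \<in> words M n" for n w
    proof -
      have wl: "w \<in> lists {1..M}" using w words_subset_lists by blast
      have "?a w \<le> D * cyl_prob \<mu> w" "cyl_prob \<mu> w \<le> D * ?a w"
        "?b w \<le> D' * cyl_prob \<mu> w" "cyl_prob \<mu> w \<le> D' * ?b w"
        using \<mu>(2) \<mu>'(2) wl unfolding A.gibbs_def B.gibbs_def eq by blast+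
      moreover have "D * cyl_prob \<mu> w \<le> D * (D' * ?b w)" "D' * cyl_prob \<mu> w \<le> D' * (D * ?a w)"
        using D calculation by (intro mult_left_mono; simp)+
      ultimately show ?thesis by (simp add: mult_ac)
    qed
    then have "comparable (D * D')" unfolding comparable_def using D by simp
    then show ?thesis unfolding ii_iff by blast
  qed
  have ii_iii: "cond_iii" if "cond_ii"
  proof -
    obtain C where C: "C > 0" "\<And>n w. n \<ge> 1 \<Longrightarrow> w \<in> words M n \<Longrightarrow> ?a w \<le> C * ?b w"
      "\<And>n w. n \<ge> 1 \<Longrightarrow> w \<in> words M n \<Longrightarrow> ?b w \<le> C * ?a w"
      using \<open>cond_ii\<close> unfolding ii_iff comparable_def by blast
    show ?thesis
      unfolding cond_iii_def
      using spectral_radius_le_of_comparable[OF s t C(1,2)] spectral_radius_le_of_comparable[OF t s C(1,3)]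
      by (intro allI impI ballI antisym)
  qed
  have iii_ii: "cond_ii" if "cond_iii"
  proof -
    have rad: "exp (- real n * p) * spectral_radius (word_product A w) powr s
        = exp (- real n * q) * spectral_radius (word_product B w) powr t" if "n \<ge> 1" "w \<in> words M n" for n w
      using \<open>cond_iii\<close> that unfolding cond_iii_def by blast
    obtain C where C: "C > 0" "\<And>n w. n \<ge> 1 \<Longrightarrow> w \<in> words M n \<Longrightarrow> ?a w \<le> C * ?b w"
      using comparable_of_spectral_radius[OF \<open>irreducible_tuple M A\<close> s t rad] by blast
    obtain C' where C': "C' > 0" "\<And>n w. n \<ge> 1 \<Longrightarrow> w \<in> words M n \<Longrightarrow> ?b w \<le> C' * ?a w"
      using comparable_of_spectral_radius[OF \<open>irreducible_tuple M B\<close> t s rad[symmetric]] by blast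
    have "?a w \<le> max C C' * ?b w \<and> ?b w \<le> max C C' * ?a w" if "n \<ge> 1" "w \<in> words M n" for n w
    proof
      show "?a w \<le> max C C' * ?b w"
        by (rule order_trans[OF C(2)[OF that] mult_right_mono]) (simp_all add: normalised_weight_nonneg)
      show "?b w \<le> max C C' * ?a w"
        by (rule order_trans[OF C'(2)[OF that] mult_right_mono]) (simp_all add: normalised_weight_nonneg)
    qed
    then have "comparable (max C C')" unfolding comparable_def using C(1) by (simp add: less_max_iff_disj)
    then show ?thesis unfolding ii_iff by blast
  qed
  have ii_iv: "cond_iv" if "cond_ii"
  proof -
    obtain C where C: "C > 0" "\<And>n w. n \<ge> 1 \<Longrightarrow> w \<in> words M n \<Longrightarrow> ?a w \<le> C * ?b w \<and> ?b w \<le> C * ?a w"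
      using \<open>cond_ii\<close> unfolding ii_iff comparable_def by blast
    show ?thesis
      unfolding cond_iv_def
      by (intro exI[of _ "p - q"] ballI lyapunov_affine_of_comparable[OF _ s t C(1) C(2)])
  qed
  have iv_i: "cond_i" if "cond_iv"
  proof -
    obtain l where l: "\<And>\<nu>. \<nu> \<in> invariant_measures M \<Longrightarrow>
        ereal s * lyapunov A \<nu> = ereal l + ereal t * lyapunov B \<nu>"
      using \<open>cond_iv\<close> unfolding cond_iv_def by blast
    have fe: "A.free_energy \<nu> = B.free_energy \<nu> + ereal l" if "\<nu> \<in> invariant_measures M" for \<nu>
      unfolding A.free_energy_def B.free_energy_def l[OF that] by (simp only: ac_simps)
    have "B.free_energy \<mu> + ereal l = ereal p"
      using fe[OF \<mu>(1)] A.free_energy_gibbs[OF \<mu>] by simp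
    moreover have "B.free_energy \<mu> \<le> ereal q" by (rule B.free_energy_le_p[OF \<mu>(1)])
    \<comment> \<open>The Gibbs measures test both suprema, which fixes the constant as l = p - q.\<close>
    ultimately have "p \<le> q + l" by (cases "B.free_energy \<mu>") auto
    moreover have "A.free_energy \<mu>' = ereal (q + l)"
      using fe[OF \<mu>'(1)] B.free_energy_gibbs[OF \<mu>'] by simp
    moreover have "A.free_energy \<mu>' \<le> ereal p" by (rule A.free_energy_le_p[OF \<mu>'(1)])
    ultimately have "A.free_energy \<mu>' = ereal p" by simp
    then have "\<mu>' = \<mu>" by (rule A.eq_gibbs_of_free_energy_eq_p[OF \<mu>'(1) _ \<mu>])
    then show ?thesis unfolding cond_i_def esA esB by simp
  qed
  show ?thesis using i_ii ii_iii iii_ii ii_iv iv_i by blast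
qed

end
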